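(* Let $\mathcal O\subseteq GL(n,\mathbb R)$ be a matrix Lie group with Lie algebra $\mathfrak o$, let $w(x)\,{\rm d}^3x$ be a fixed volume form on $\mathbb R^3$, and consider on $\mathcal C=\operatorname{Emb}(\mathbb R^3,\mathbb R^{2k}\times\mathfrak o^* )\times\mathcal F(\mathbb R^3,\mathcal O)\ni(\boldsymbol Q,\boldsymbol P,\sigma,\theta)$ the Poisson structure $$\{F,G\}=\int\frac1w\left(\frac{\delta F}{\delta\boldsymbol Q}\cdot\frac{\delta G}{\delta\boldsymbol P}-\frac{\delta G}{\delta\boldsymbol Q}\cdot\frac{\delta F}{\delta\boldsymbol P}\right){\rm d}^3x+\int\frac1w\left(\left\langle\sigma,\left[\frac{\delta F}{\delta\sigma},\frac{\delta G}{\delta\sigma}\right]\right\rangle+\left\langle\frac{\delta F}{\delta\theta},\frac{\delta G}{\delta\sigma}\theta\right\rangle-\left\langle\frac{\delta G}{\delta\theta},\frac{\delta F}{\delta\sigma}\theta\right\rangle\right){\rm d}^3x.$$ Then the infinitesimal action on $\mathcal C$ of volume-preserving automorphisms $(\mathbf u,\zeta)\in\mathfrak{aut}_{\rm vol}(\mathbb R^3\times\mathcal O)\simeq\mathfrak X_{\rm vol}(\mathbb R^3)\,\circledS\,\mathcal F(\mathbb R^3,\mathfrak o)$, $$(\mathbf u,\zeta)_{\mathcal C}(\boldsymbol Q,\boldsymbol P,\sigma,\theta)=\big((\mathbf u\cdot\nabla)\boldsymbol Q,\ (\mathbf u\cdot\nabla)\boldsymbol P,\ (\mathbf u\cdot\nabla)\sigma,\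 (\mathbf u\cdot\nabla)\theta+\theta\zeta\big),$$ admits the momentum map $$\mathbf J_R(\boldsymbol Q,\boldsymbol P,\sigma,\theta)=\Big(\operatorname{curl}\big(\nabla\boldsymbol Q^T\cdot\boldsymbol P+\langle\sigma,\nabla\theta\,\theta^{-1}\rangle\big),\ \operatorname{Ad}^*_\theta\sigma\Big)\in\mathfrak X_{\rm vol}(\mathbb R^3)^*\times\mathcal F(\mathbb R^3,\mathfrak o)^*;$$ that is, $\{F,\langle\mathbf J_R,(\mathbf u,\zeta)\rangle\}=\mathbf dF\cdot(\mathbf u,\zeta)_{\mathcal C}$ for all functionals $F$ on $\mathcal C$ and all $(\mathbf u,\zeta)$.
   Context: $\operatorname{Emb}$ denotes the set of embeddings and $\mathcal F(\mathbb R^3,\mathcal O)$ the set of smooth maps; the embedding is written $(\boldsymbol Q,\boldsymbol P,\sigma)$ with $\boldsymbol Q,\boldsymbol P:\mathbb R^3\to\mathbb R^k$ and $\sigma:\mathbb R^3\to\mathfrak o^*$, and $\theta:\mathbb R^3\to\mathcal O$. The bracket $\langle\cdot,\cdot\rangle$ between matrices is the trace pairing $\langle A,B\rangle=\operatorname{Tr}(A^TB)$, which is also used to pair $\mathfrak o^*$ with $\mathfrak o$. Functional derivatives in the Poisson bracket are taken with respect to ${\rm d}^3x$: $\mathbf dF\cdot\delta z=\int\langle\delta F/\delta z,\delta z\rangle\,{\rm d}^3x$. $\operatorname{Ad}_\theta\zeta=\theta\zeta\theta^{-1}$ and $\langle\operatorname{Ad}^*_\theta\sigma,\zeta\rangle=\langle\sigma,\operatorname{Ad}_\theta\zeta\rangle$.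 $\nabla\boldsymbol Q^T\cdot\boldsymbol P$ is the vector field with components $\sum_a P_a\,\partial_iQ^a$, and $\langle\sigma,\nabla\theta\,\theta^{-1}\rangle$ the one with components $\langle\sigma,(\partial_i\theta)\theta^{-1}\rangle$. $\mathfrak X_{\rm vol}(\mathbb R^3)$ is the space of vector fields preserving $w\,{\rm d}^3x$, i.e. $\operatorname{div}(w\mathbf u)=0$. An element of its dual is represented by $\boldsymbol\omega=\operatorname{curl}\mathbf v$ through $\langle\operatorname{curl}\mathbf v,\mathbf u\rangle=\int(\mathbf v\cdot\mathbf u)\,w\,{\rm d}^3x$, and $\mathcal F(\mathbb R^3,\mathfrak o)^*$ consists of $\mathfrak o^*$-valued functions $\lambda$ with $\langle\lambda,\zeta\rangle=\int\langle\lambda,\zeta\rangle\,w\,{\rm d}^3x$. As usual for formal momentum map statements, fields are such that the integrals converge and integration by parts gives no boundary terms (e.g. $(\mathbf u,\zeta)$ compactly supported). *)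

theory Defs
  imports "HOL-Analysis.Analysis"
begin

section \<open>Smooth maps and vector calculus on \<open>\<real>\<^sup>3\<close>\<close>

primrec C_k :: "nat \<Rightarrow> ('a::real_normed_vector \<Rightarrow> 'b::real_normed_vector) \<Rightarrow> bool" where
  "C_k 0 f \<longleftrightarrow> continuous_on UNIV f"
| "C_k (Suc m) f \<longleftrightarrow>
     (\<forall>x. f differentiable (at x)) \<and> (\<forall>h. C_k m (\<lambda>x. frechet_derivative f (at x) h))"

definition smooth :: "('a::real_normed_vector \<Rightarrow> 'b::real_normed_vector) \<Rightarrow> bool" where
  "smooth f \<longleftrightarrow> (\<forall>m. C_k m f)"

definition compactly_supported :: "('a::topological_space \<Rightarrow> 'b::zero) \<Rightarrow> bool" where
  "compactly_supported f \<longleftrightarrow> (\<exists>K. compact K \<and> (\<forall>x. x \<notin> K \<longrightarrow> f x = 0))"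

definition locally_integrable :: "('a::euclidean_space \<Rightarrow> 'b::euclidean_space) \<Rightarrow> bool" where
  "locally_integrable f \<longleftrightarrow> (\<forall>K. compact K \<longrightarrow> set_integrable lborel K f)"

definition partial :: "3 \<Rightarrow> (real^3 \<Rightarrow> 'b::real_normed_vector) \<Rightarrow> real^3 \<Rightarrow> 'b" where
  "partial i f x = frechet_derivative f (at x) (axis i 1)"

text \<open>The operator \<open>(u \<cdot> \<nabla>) f\<close>.\<close>
definition advect :: "(real^3 \<Rightarrow> real^3) \<Rightarrow> (real^3 \<Rightarrow> 'b::real_normed_vector) \<Rightarrow> real^3 \<Rightarrow> 'b" where
  "advect u f x = (\<Sum>i\<in>UNIV. u x $ i *\<^sub>R partial i f x)"

definition divergence :: "(real^3 \<Rightarrow> real^3) \<Rightarrow> real^3 \<Rightarrow> real" where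
  "divergence u x = (\<Sum>i\<in>UNIV. partial i (\<lambda>y. u y $ i) x)"

definition curl :: "(real^3 \<Rightarrow> real^3) \<Rightarrow> real^3 \<Rightarrow> real^3" where
  "curl v x = vector
     [partial 2 (\<lambda>y. v y $ 3) x - partial 3 (\<lambda>y. v y $ 2) x,
      partial 3 (\<lambda>y. v y $ 1) x - partial 1 (\<lambda>y. v y $ 3) x,
      partial 1 (\<lambda>y. v y $ 2) x - partial 2 (\<lambda>y. v y $ 1) x]"

definition smooth_embedding :: "(real^3 \<Rightarrow> 'b::euclidean_space) \<Rightarrow> bool" where
  "smooth_embedding f \<longleftrightarrow>
     smooth f \<and> (\<forall>x. inj (frechet_derivative f (at x))) \<and>
     (\<exists>g. homeomorphism UNIV (range f) f g)"


section \<open>Matrix Lie groups\<close>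

definition matrix_lie_group :: "(real^'n^'n) set \<Rightarrow> bool" where
  "matrix_lie_group \<O> \<longleftrightarrow>
     \<O> \<subseteq> {A. invertible A} \<and> closedin (top_of_set {A. invertible A}) \<O> \<and>
     mat 1 \<in> \<O> \<and> (\<forall>A\<in>\<O>. \<forall>B\<in>\<O>. A ** B \<in> \<O>) \<and> (\<forall>A\<in>\<O>. matrix_inv A \<in> \<O>)"

text \<open>The Lie algebra is the tangent space at the identity.\<close>
definition lie_algebra :: "(real^'n^'n) set \<Rightarrow> (real^'n^'n) set" where
  "lie_algebra \<O> = {\<xi>. \<exists>c :: real \<Rightarrow> real^'n^'n.
     smooth c \<and> (\<forall>t. c t \<in> \<O>) \<and> c 0 = mat 1 \<and> (c has_vector_derivative \<xi>) (at 0)}"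

definition commutator :: "real^'n^'n \<Rightarrow> real^'n^'n \<Rightarrow> real^'n^'n" where
  "commutator A B = A ** B - B ** A"

definition tr_pair :: "real^'n^'n \<Rightarrow> real^'n^'n \<Rightarrow> real" where
  "tr_pair A B = trace (transpose A ** B)"

text \<open>The trace pairing is positive definite, hence perfect on the Lie algebra. The dual of the
  Lie algebra is therefore identified with the subspace \<open>lie_algebra \<O>\<close> itself,
  an element \<open>\<sigma>\<close> acting as \<open>tr_pair \<sigma>\<close>.\<close>
abbreviation lie_coalgebra :: "(real^'n^'n) set \<Rightarrow> (real^'n^'n) set" where
  "lie_coalgebra \<O> \<equiv> lie_algebra \<O>"

definition Ad :: "real^'n^'n \<Rightarrow> real^'n^'n \<Rightarrow> real^'n^'n" where
  "Ad \<theta> \<zeta> = \<theta> ** \<zeta> ** matrix_inv \<theta>"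

definition coAd :: "(real^'n^'n) set \<Rightarrow> real^'n^'n \<Rightarrow> real^'n^'n \<Rightarrow> real^'n^'n" where
  "coAd \<O> \<theta> \<sigma> = (THE \<tau>. \<tau> \<in> lie_coalgebra \<O> \<and>
     (\<forall>\<zeta>\<in>lie_algebra \<O>. tr_pair \<tau> \<zeta> = tr_pair \<sigma> (Ad \<theta> \<zeta>)))"


section \<open>The configuration space\<close>

text \<open>A quadruple \<open>(Q, P, \<sigma>, \<theta>)\<close> of fields is encoded as one map on \<open>\<real>\<^sup>3\<close>, valued in a product.
  Variations and functional derivatives have the same type.\<close>
type_synonym ('k, 'n) fields =
  "real^3 \<Rightarrow> (real^'k) \<times> (real^'k) \<times> (real^'n^'n) \<times> (real^'n^'n)"

definition Q_part :: "('k::finite, 'n::finite) fields \<Rightarrow> real^3 \<Rightarrow> real^'k" where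
  "Q_part z x = fst (z x)"

definition P_part :: "('k::finite, 'n::finite) fields \<Rightarrow> real^3 \<Rightarrow> real^'k" where
  "P_part z x = fst (snd (z x))"

definition \<sigma>_part :: "('k::finite, 'n::finite) fields \<Rightarrow> real^3 \<Rightarrow> real^'n^'n" where
  "\<sigma>_part z x = fst (snd (snd (z x)))"

definition \<theta>_part :: "('k::finite, 'n::finite) fields \<Rightarrow> real^3 \<Rightarrow> real^'n^'n" where
  "\<theta>_part z x = snd (snd (snd (z x)))"

definition config_space :: "(real^'n^'n) set \<Rightarrow> ('k::finite, 'n::finite) fields set" where
  "config_space \<O> = {z.
     smooth_embedding (\<lambda>x. (Q_part z x, P_part z x, \<sigma>_part z x)) \<and>
     (\<forall>x. \<sigma>_part z x \<in> lie_coalgebra \<O>) \<and>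
     smooth (\<theta>_part z) \<and> (\<forall>x. \<theta>_part z x \<in> \<O>)}"

text \<open>Smooth curves in the configuration space through \<open>z\<close>, constant in time outside a compact set.\<close>
definition variation ::
  "(real^'n^'n) set \<Rightarrow> ('k::finite, 'n::finite) fields \<Rightarrow> (real \<Rightarrow> ('k, 'n) fields) \<Rightarrow> bool" where
  "variation \<O> z c \<longleftrightarrow>
     smooth (\<lambda>(t, x). c t x) \<and> (\<forall>t. c t \<in> config_space \<O>) \<and> c 0 = z \<and>
     (\<exists>K. compact K \<and> (\<forall>t x. x \<notin> K \<longrightarrow> c t x = z x))"

definition velocity :: "(real \<Rightarrow> ('k::finite, 'n::finite) fields) \<Rightarrow> ('k, 'n) fields" where
  "velocity c x = vector_derivative (\<lambda>t. c t x) (at 0)"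

definition tangent_vectors ::
  "(real^'n^'n) set \<Rightarrow> ('k::finite, 'n::finite) fields \<Rightarrow> ('k, 'n) fields set" where
  "tangent_vectors \<O> z = {velocity c | c. variation \<O> z c}"

text \<open>The directional derivative \<open>\<^bold>dF(z) \<cdot> \<delta>z\<close>, computed along curves with velocity \<open>\<delta>z\<close>.\<close>
definition dF ::
  "(real^'n^'n) set \<Rightarrow> (('k::finite, 'n::finite) fields \<Rightarrow> real) \<Rightarrow> ('k, 'n) fields \<Rightarrow>
   ('k, 'n) fields \<Rightarrow> real" where
  "dF \<O> F z \<delta>z = (THE d. \<exists>c. variation \<O> z c \<and> velocity c = \<delta>z \<and>
     ((\<lambda>t. F (c t)) has_real_derivative d) (at 0))"


section \<open>Functional derivatives and the Poisson bracket\<close>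

definition field_pair :: "('k::finite, 'n::finite) fields \<Rightarrow> ('k, 'n) fields \<Rightarrow> real" where
  "field_pair D \<delta>z = (LBINT x.
     Q_part D x \<bullet> Q_part \<delta>z x + P_part D x \<bullet> P_part \<delta>z x +
     tr_pair (\<sigma>_part D x) (\<sigma>_part \<delta>z x) + tr_pair (\<theta>_part D x) (\<theta>_part \<delta>z x))"

text \<open>\<open>D\<close> collects the four functional derivatives of \<open>F\<close> at \<open>z\<close>. The covector
  \<open>\<delta>F/\<delta>\<theta>\<close> at \<open>\<theta>(x)\<close> is represented by an arbitrary matrix through the trace pairing, so it is
  determined only up to the annihilator of the tangent space \<open>\<oo> \<theta>(x)\<close> of the group. The bracket
  below pairs it with elements of that tangent space only, so it does not see the choice.\<close>
definition has_functional_derivative ::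
  "(real^'n^'n) set \<Rightarrow> (('k::finite, 'n::finite) fields \<Rightarrow> real) \<Rightarrow> ('k, 'n) fields \<Rightarrow>
   ('k, 'n) fields \<Rightarrow> bool" where
  "has_functional_derivative \<O> F z D \<longleftrightarrow>
     locally_integrable D \<and> (\<forall>x. \<sigma>_part D x \<in> lie_algebra \<O>) \<and>
     (\<forall>c. variation \<O> z c \<longrightarrow>
        ((\<lambda>t. F (c t)) has_real_derivative field_pair D (velocity c)) (at 0))"

definition functionally_differentiable ::
  "(real^'n^'n) set \<Rightarrow> (('k::finite, 'n::finite) fields \<Rightarrow> real) \<Rightarrow> ('k, 'n) fields \<Rightarrow> bool" where
  "functionally_differentiable \<O> F z \<longleftrightarrow> (\<exists>D. has_functional_derivative \<O> F z D)"

definition functional_derivative ::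
  "(real^'n^'n) set \<Rightarrow> (('k::finite, 'n::finite) fields \<Rightarrow> real) \<Rightarrow> ('k, 'n) fields \<Rightarrow>
   ('k, 'n) fields" where
  "functional_derivative \<O> F z = (SOME D. has_functional_derivative \<O> F z D)"

definition poisson_bracket ::
  "(real^'n^'n) set \<Rightarrow> (real^3 \<Rightarrow> real) \<Rightarrow> (('k::finite, 'n::finite) fields \<Rightarrow> real) \<Rightarrow>
   (('k, 'n) fields \<Rightarrow> real) \<Rightarrow> ('k, 'n) fields \<Rightarrow> real" where
  "poisson_bracket \<O> w F G z =
    (let DF = functional_derivative \<O> F z; DG = functional_derivative \<O> G z in
      (LBINT x. 1 / w x * (Q_part DF x \<bullet> P_part DG x - Q_part DG x \<bullet> P_part DF x)) +
      (LBINT x. 1 / w x *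
         (tr_pair (\<sigma>_part z x) (commutator (\<sigma>_part DF x) (\<sigma>_part DG x))
          + tr_pair (\<theta>_part DF x) (\<sigma>_part DG x ** \<theta>_part z x)
          - tr_pair (\<theta>_part DG x) (\<sigma>_part DF x ** \<theta>_part z x))))"


section \<open>Volume-preserving automorphisms, their dual, and the momentum map\<close>

definition volume_density :: "(real^3 \<Rightarrow> real) \<Rightarrow> bool" where
  "volume_density w \<longleftrightarrow> smooth w \<and> (\<forall>x. w x \<noteq> 0)"

definition X_vol :: "(real^3 \<Rightarrow> real) \<Rightarrow> (real^3 \<Rightarrow> real^3) set" where
  "X_vol w = {u. smooth u \<and> (\<forall>x. divergence (\<lambda>y. w y *\<^sub>R u y) x = 0)}"

definition gauge_algebra :: "(real^'n^'n) set \<Rightarrow> (real^3 \<Rightarrow> real^'n^'n) set" where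
  "gauge_algebra \<O> = {\<zeta>. smooth \<zeta> \<and> (\<forall>x. \<zeta> x \<in> lie_algebra \<O>)}"

definition aut_vol ::
  "(real^'n^'n) set \<Rightarrow> (real^3 \<Rightarrow> real) \<Rightarrow> ((real^3 \<Rightarrow> real^3) \<times> (real^3 \<Rightarrow> real^'n^'n)) set" where
  "aut_vol \<O> w = X_vol w \<times> gauge_algebra \<O>"

definition X_vol_dual :: "(real^3 \<Rightarrow> real^3) set" where
  "X_vol_dual = {curl v | v. smooth v}"

definition gauge_dual :: "(real^'n^'n) set \<Rightarrow> (real^3 \<Rightarrow> real^'n^'n) set" where
  "gauge_dual \<O> = {\<mu>. smooth \<mu> \<and> (\<forall>x. \<mu> x \<in> lie_coalgebra \<O>)}"

text \<open>The pairing of \<open>\<omega> = curl v\<close> with \<open>u\<close> is \<open>\<integral> (v \<cdot> u) w d\<^sup>3x\<close> for any smooth potential \<open>v\<close>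
  of \<open>\<omega>\<close>. Two potentials differ by a gradient, which integrates to zero against compactly
  supported elements of \<^term>\<open>X_vol w\<close>.\<close>
definition vorticity_pair ::
  "(real^3 \<Rightarrow> real) \<Rightarrow> (real^3 \<Rightarrow> real^3) \<Rightarrow> (real^3 \<Rightarrow> real^3) \<Rightarrow> real" where
  "vorticity_pair w \<omega> u =
     (THE r. \<exists>v. smooth v \<and> curl v = \<omega> \<and> r = (LBINT x. (v x \<bullet> u x) * w x))"

definition gauge_pair ::
  "(real^3 \<Rightarrow> real) \<Rightarrow> (real^3 \<Rightarrow> real^'n^'n) \<Rightarrow> (real^3 \<Rightarrow> real^'n^'n) \<Rightarrow> real" where
  "gauge_pair w \<mu> \<zeta> = (LBINT x. tr_pair (\<mu> x) (\<zeta> x) * w x)"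

definition aut_pair ::
  "(real^3 \<Rightarrow> real) \<Rightarrow> (real^3 \<Rightarrow> real^3) \<times> (real^3 \<Rightarrow> real^'n^'n) \<Rightarrow>
   (real^3 \<Rightarrow> real^3) \<times> (real^3 \<Rightarrow> real^'n^'n) \<Rightarrow> real" where
  "aut_pair w = (\<lambda>(\<omega>, \<mu>) (u, \<zeta>). vorticity_pair w \<omega> u + gauge_pair w \<mu> \<zeta>)"

definition inf_action ::
  "(real^3 \<Rightarrow> real^3) \<times> (real^3 \<Rightarrow> real^'n^'n) \<Rightarrow> ('k::finite, 'n::finite) fields \<Rightarrow>
   ('k, 'n) fields" where
  "inf_action = (\<lambda>(u, \<zeta>) z x.
     (advect u (Q_part z) x, advect u (P_part z) x, advect u (\<sigma>_part z) x,
      advect u (\<theta>_part z) x + \<theta>_part z x ** \<zeta> x))"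

definition J_R ::
  "(real^'n^'n) set \<Rightarrow> ('k::finite, 'n::finite) fields \<Rightarrow>
   (real^3 \<Rightarrow> real^3) \<times> (real^3 \<Rightarrow> real^'n^'n)" where
  "J_R \<O> z =
     (curl (\<lambda>x. (\<chi> i. \<Sum>a\<in>UNIV. P_part z x $ a * partial i (\<lambda>y. Q_part z y $ a) x)
              + (\<chi> i. tr_pair (\<sigma>_part z x) (partial i (\<theta>_part z) x ** matrix_inv (\<theta>_part z x)))),
      \<lambda>x. coAd \<O> (\<theta>_part z x) (\<sigma>_part z x))"

end

theory Submission
  imports Defs "HOL-Real_Asymp.Real_Asymp"
begin

text \<open>Write \<open>\<eta> = ((u \<cdot> \<nabla>) \<theta> + \<theta> \<zeta>) \<theta>\<^sup>-\<^sup>1\<close>, an \<open>\<oo>\<close>-valued function. The pairing of the momentum map with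
  \<open>(u, \<zeta>)\<close> is \<open>\<integral> w (P \<cdot> (u \<cdot> \<nabla>) Q + \<langle>\<sigma>, \<eta>\<rangle>)\<close>, independently of the chosen potential of the vorticity by the
  Poincare lemma. For a variation with \<open>\<alpha> = \<delta>\<theta> \<theta>\<^sup>-\<^sup>1\<close> one has \<open>\<delta>\<eta> = (u \<cdot> \<nabla>) \<alpha> + [\<alpha>, \<eta>]\<close>, so integrating by parts
  against \<open>div (w u) = 0\<close> gives the functional derivatives \<open>- w (u \<cdot> \<nabla>) P\<close>, \<open>w (u \<cdot> \<nabla>) Q\<close>, \<open>w \<eta>\<close> and, tested on
  \<open>\<xi> \<theta>\<close>, \<open>w (\<langle>\<sigma>, [\<xi>, \<eta>]\<rangle> - \<langle>(u \<cdot> \<nabla>) \<sigma>, \<xi>\<rangle>)\<close>. In the bracket with \<open>F\<close> the two terms containing \<open>\<sigma>\<close> undifferentiated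
  cancel and what remains is \<open>\<integral> \<langle>\<delta>F/\<delta>z, (u, \<zeta>)\<^sub>C z\<rangle>\<close>. Since functional derivatives are only determined weakly,
  the fundamental lemma of the calculus of variations is needed to replace an arbitrary functional derivative
  of the momentum functional by this explicit one almost everywhere; it requires enough variations, which
  exist because a compactly supported perturbation of an embedding is again an embedding for small times.\<close>


section \<open>Smooth maps\<close>

lemma C_k_SucI:
  assumes "\<And>x. (f has_derivative f' x) (at x)" "\<And>h. C_k m (\<lambda>x. f' x h)"
  shows "C_k (Suc m) f"
proof -
  have "frechet_derivative f (at x) = f' x" for x
    using frechet_derivative_at[OF assms(1)] by simp
  then show ?thesis
    using assms by (auto simp: differentiable_def)
qed

lemma C_k_Suc_has_derivative:
  "C_k (Suc m) f \<Longrightarrow> (f has_derivative frechet_derivative f (at x)) (at x)"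
  by (simp add: frechet_derivative_works)

lemma C_k_SucD: "C_k (Suc m) f \<Longrightarrow> C_k m f"
proof (induction m arbitrary: f)
  case 0
  then show ?case
    by (auto simp: continuous_on_eq_continuous_at intro: differentiable_imp_continuous_within)
next
  case (Suc m)
  from Suc.prems have "C_k (Suc m) (\<lambda>x. frechet_derivative f (at x) h)" for h
    by (subst (asm) C_k.simps(2)) blast
  then have "C_k m (\<lambda>x. frechet_derivative f (at x) h)" for h
    by (rule Suc.IH)
  moreover have "f differentiable (at x)" for x
    using Suc.prems by simp
  ultimately show ?case
    by simp
qed

lemma C_k_const: "C_k m (\<lambda>x. c)"
proof (induction m arbitrary: c)
  case (Suc m)
  show ?case by (rule C_k_SucI[where f' = "\<lambda>x h. 0"]) (auto simp: Suc)
qed simp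

lemma C_k_bounded_linear:
  assumes L: "bounded_linear L"
  shows "C_k m f \<Longrightarrow> C_k m (\<lambda>x. L (f x))"
proof (induction m arbitrary: f)
  case 0
  then show ?case
    by (simp add: bounded_linear.continuous_on[OF L])
next
  case (Suc m)
  show ?case
  proof (rule C_k_SucI)
    show "((\<lambda>x. L (f x)) has_derivative (\<lambda>h. L (frechet_derivative f (at x) h))) (at x)" for x
      using bounded_linear.has_derivative[OF L C_k_Suc_has_derivative[OF Suc.prems]] .
    show "C_k m (\<lambda>x. L (frechet_derivative f (at x) h))" for h
      using Suc.prems by (intro Suc.IH) simp
  qed
qed

lemma C_k_add: "C_k m f \<Longrightarrow> C_k m g \<Longrightarrow> C_k m (\<lambda>x. f x + g x)"
proof (induction m arbitrary: f g)
  case 0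
  then show ?case by (simp add: continuous_on_add)
next
  case (Suc m)
  show ?case
  proof (rule C_k_SucI)
    show "((\<lambda>x. f x + g x) has_derivative
        (\<lambda>h. frechet_derivative f (at x) h + frechet_derivative g (at x) h)) (at x)" for x
      by (intro has_derivative_add C_k_Suc_has_derivative[OF Suc.prems(1)]
          C_k_Suc_has_derivative[OF Suc.prems(2)])
    show "C_k m (\<lambda>x. frechet_derivative f (at x) h + frechet_derivative g (at x) h)" for h
      using Suc.prems by (intro Suc.IH) simp_all
  qed
qed

text \<open>By the Leibniz rule the derivative in a fixed direction is a sum of two values of
  \<open>B\<close>, each with one undifferentiated factor; \<open>C_k_SucD\<close> lowers the order
  of that factor so that the induction closes. Products, scalings, inner products and matrix
  products are all instances.\<close>

lemma C_k_bounded_bilinear: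
  assumes B: "bounded_bilinear B"
  shows "C_k m f \<Longrightarrow> C_k m g \<Longrightarrow> C_k m (\<lambda>x. B (f x) (g x))"
proof (induction m arbitrary: f g)
  case 0
  then show ?case
    by (simp add: bounded_bilinear.continuous_on[OF B])
next
  case (Suc m)
  show ?case
  proof (rule C_k_SucI)
    show "((\<lambda>x. B (f x) (g x)) has_derivative
        (\<lambda>h. B (f x) (frechet_derivative g (at x) h) + B (frechet_derivative f (at x) h) (g x))) (at x)" for x
      by (intro bounded_bilinear.FDERIV[OF B] C_k_Suc_has_derivative[OF Suc.prems(1)]
          C_k_Suc_has_derivative[OF Suc.prems(2)])
    show "C_k m (\<lambda>x. B (f x) (frechet_derivative g (at x) h) + B (frechet_derivative f (at x) h) (g x))" for h
      using Suc.prems C_k_SucD[OF Suc.prems(1)] C_k_SucD[OF Suc.prems(2)]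
      by (intro C_k_add Suc.IH) simp_all
  qed
qed

lemma C_k_sum: "(\<And>i. i \<in> I \<Longrightarrow> C_k m (f i)) \<Longrightarrow> C_k m (\<lambda>x. \<Sum>i\<in>I. f i x)"
  by (induction I rule: infinite_finite_induct) (auto intro: C_k_const C_k_add)

text \<open>The derivative contains the reciprocal itself, but only to order \<open>m\<close>, where
  the induction hypothesis supplies it.\<close>

lemma C_k_inverse:
  fixes f :: "'a::real_normed_vector \<Rightarrow> real"
  assumes nz: "\<And>x. f x \<noteq> 0"
  shows "C_k m f \<Longrightarrow> C_k m (\<lambda>x. inverse (f x))"
proof (induction m)
  case 0
  then show ?case using nz by (auto intro: continuous_on_inverse)
next
  case (Suc m)
  show ?case
  proof (rule C_k_SucI)
    show "((\<lambda>x. inverse (f x)) has_derivative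
        (\<lambda>h. - (inverse (f x) * frechet_derivative f (at x) h * inverse (f x)))) (at x)" for x
      by (intro Deriv.has_derivative_inverse nz C_k_Suc_has_derivative[OF Suc.prems])
    show "C_k m (\<lambda>x. - (inverse (f x) * frechet_derivative f (at x) h * inverse (f x)))" for h
      using Suc.prems C_k_SucD[OF Suc.prems]
      by (intro C_k_bounded_linear[OF bounded_linear_minus[OF bounded_linear_ident]]
          C_k_bounded_bilinear[OF bounded_bilinear_mult] Suc.IH) simp_all
  qed
qed

text \<open>\<open>C_k\<close> speaks only of derivatives in fixed directions. The expansion reduces
  a derivative in a varying direction to finitely many fixed ones with scalar coefficients, as the
  chain rule requires.\<close>

lemma has_derivative_Basis_expand:
  fixes g :: "'a::real_normed_vector \<Rightarrow> 'b::euclidean_space" and f :: "'b \<Rightarrow> 'c::real_normed_vector"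
  assumes "(f has_derivative f') F"
  shows "f' v = (\<Sum>b\<in>Basis. (v \<bullet> b) *\<^sub>R f' b)"
proof -
  have "f' v = f' (\<Sum>b\<in>Basis. (v \<bullet> b) *\<^sub>R b)"
    by (simp add: euclidean_representation)
  also have "\<dots> = (\<Sum>b\<in>Basis. (v \<bullet> b) *\<^sub>R f' b)"
    using has_derivative_bounded_linear[OF assms]
    by (simp add: linear_sum linear_cmul bounded_linear.linear)
  finally show ?thesis .
qed

lemma C_k_compose:
  fixes g :: "'a::real_normed_vector \<Rightarrow> 'b::euclidean_space" and f :: "'b \<Rightarrow> 'c::real_normed_vector"
  shows "C_k m f \<Longrightarrow> C_k m g \<Longrightarrow> C_k m (\<lambda>x. f (g x))"
proof (induction m arbitrary: f)
  case 0
  then show ?case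
    by (auto intro: continuous_on_compose2[where t = UNIV])
next
  case (Suc m)
  note df = C_k_Suc_has_derivative[OF Suc.prems(1)] and dg = C_k_Suc_has_derivative[OF Suc.prems(2)]
  show ?case
  proof (rule C_k_SucI)
    show "((\<lambda>x. f (g x)) has_derivative
        (\<lambda>h. \<Sum>b\<in>Basis. (frechet_derivative g (at x) h \<bullet> b) *\<^sub>R frechet_derivative f (at (g x)) b)) (at x)" for x
      using has_derivative_compose[OF dg df]
      by (rule has_derivative_eq_rhs) (rule ext, rule has_derivative_Basis_expand[OF df])
    show "C_k m (\<lambda>x. \<Sum>b\<in>Basis. (frechet_derivative g (at x) h \<bullet> b) *\<^sub>R frechet_derivative f (at (g x)) b)" for h
    proof (intro C_k_sum C_k_bounded_bilinear[OF bounded_bilinear_scaleR])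
      show "C_k m (\<lambda>x. frechet_derivative g (at x) h \<bullet> b)" for b
        using Suc.prems by (intro C_k_bounded_linear[OF bounded_linear_inner_left]) simp
      show "C_k m (\<lambda>x. frechet_derivative f (at (g x)) b)" for b
        using Suc.prems(1) C_k_SucD[OF Suc.prems(2)]
        by (intro Suc.IH[of "\<lambda>y. frechet_derivative f (at y) b"]) simp_all
    qed
  qed
qed

section \<open>Closure properties of smooth maps\<close>

named_theorems smooth_intros

lemma smooth_const [smooth_intros]: "smooth (\<lambda>x. c)"
  by (simp add: smooth_def C_k_const)

lemma smooth_bounded_linear: "bounded_linear L \<Longrightarrow> smooth f \<Longrightarrow> smooth (\<lambda>x. L (f x))"
  by (simp add: smooth_def C_k_bounded_linear)

lemma smooth_ident [smooth_intros]: "smooth (\<lambda>x. x)"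
  unfolding smooth_def
proof
  fix m show "C_k m (\<lambda>x::'a. x)"
    by (cases m) (auto intro!: C_k_SucI[where f' = "\<lambda>x h. h"] C_k_const has_derivative_ident)
qed

lemma smooth_add [smooth_intros]: "smooth f \<Longrightarrow> smooth g \<Longrightarrow> smooth (\<lambda>x. f x + g x)"
  by (simp add: smooth_def C_k_add)

lemma smooth_bounded_bilinear:
  "bounded_bilinear B \<Longrightarrow> smooth f \<Longrightarrow> smooth g \<Longrightarrow> smooth (\<lambda>x. B (f x) (g x))"
  by (simp add: smooth_def C_k_bounded_bilinear)

lemma smooth_sum [smooth_intros]: "(\<And>i. i \<in> I \<Longrightarrow> smooth (f i)) \<Longrightarrow> smooth (\<lambda>x. \<Sum>i\<in>I. f i x)"
  by (simp add: smooth_def C_k_sum)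

lemmas smooth_minus [smooth_intros] = smooth_bounded_linear[OF bounded_linear_minus[OF bounded_linear_ident]]
lemmas smooth_fst [smooth_intros] = smooth_bounded_linear[OF bounded_linear_fst]
lemmas smooth_snd [smooth_intros] = smooth_bounded_linear[OF bounded_linear_snd]
lemmas smooth_vec_nth [smooth_intros] = smooth_bounded_linear[OF bounded_linear_vec_nth]
lemmas smooth_mult [smooth_intros] = smooth_bounded_bilinear[OF bounded_bilinear_mult]
lemmas smooth_scaleR [smooth_intros] = smooth_bounded_bilinear[OF bounded_bilinear_scaleR]
lemmas smooth_inner [smooth_intros] = smooth_bounded_bilinear[OF bounded_bilinear_inner]

lemma smooth_diff [smooth_intros]: "smooth f \<Longrightarrow> smooth g \<Longrightarrow> smooth (\<lambda>x. f x - g x)"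
  unfolding diff_conv_add_uminus by (intro smooth_intros)

lemma smooth_Pair [smooth_intros]:
  assumes "smooth f" "smooth g" shows "smooth (\<lambda>x. (f x, g x))"
proof -
  have "smooth (\<lambda>x. (f x, 0) + (0, g x))"
    using assms
    by (intro smooth_add smooth_bounded_linear[of "\<lambda>y. (y, 0)"] smooth_bounded_linear[of "\<lambda>y. (0, y)"]
        bounded_linear_Pair bounded_linear_ident bounded_linear_zero)
  then show ?thesis by simp
qed

lemma bounded_linear_axis: "bounded_linear (axis i :: 'b::euclidean_space \<Rightarrow> 'b^'n)"
  by (intro linear_conv_bounded_linear[THEN iffD1] linearI) (simp_all add: axis_def vec_eq_iff)

lemma smooth_vec_lambda [smooth_intros]:
  fixes f :: "'a::real_normed_vector \<Rightarrow> 'n::finite \<Rightarrow> 'b::euclidean_space"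
  assumes "\<And>i. smooth (\<lambda>x. f x i)" shows "smooth (\<lambda>x. \<chi> i. f x i)"
proof -
  have "smooth (\<lambda>x. \<Sum>i\<in>UNIV. (axis i (f x i) :: 'b^'n))"
    using assms by (intro smooth_sum smooth_bounded_linear[OF bounded_linear_axis])
  also have "(\<lambda>x. \<Sum>i\<in>UNIV. (axis i (f x i) :: 'b^'n)) = (\<lambda>x. \<chi> i. f x i)"
    by (auto simp: vec_eq_iff axis_def sum.delta if_distrib cong: if_cong)
  finally show ?thesis .
qed

lemma smooth_inverse [smooth_intros]:
  fixes f :: "'a::real_normed_vector \<Rightarrow> real"
  shows "(\<And>x. f x \<noteq> 0) \<Longrightarrow> smooth f \<Longrightarrow> smooth (\<lambda>x. inverse (f x))"
  by (simp add: smooth_def C_k_inverse)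

lemma smooth_divide [smooth_intros]:
  fixes f g :: "'a::real_normed_vector \<Rightarrow> real"
  shows "smooth f \<Longrightarrow> (\<And>x. g x \<noteq> 0) \<Longrightarrow> smooth g \<Longrightarrow> smooth (\<lambda>x. f x / g x)"
  unfolding divide_inverse by (intro smooth_intros)

lemma smooth_prod [smooth_intros]:
  fixes f :: "'i \<Rightarrow> 'a::real_normed_vector \<Rightarrow> real"
  shows "(\<And>i. i \<in> I \<Longrightarrow> smooth (f i)) \<Longrightarrow> smooth (\<lambda>x. \<Prod>i\<in>I. f i x)"
  by (induction I rule: infinite_finite_induct) (auto intro!: smooth_intros)

lemma smooth_power [smooth_intros]:
  fixes f :: "'a::real_normed_vector \<Rightarrow> real"
  shows "smooth f \<Longrightarrow> smooth (\<lambda>x. f x ^ n)"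
  by (induction n) (auto intro!: smooth_intros)

lemma smooth_compose:
  fixes g :: "'a::real_normed_vector \<Rightarrow> 'b::euclidean_space" and f :: "'b \<Rightarrow> 'c::real_normed_vector"
  shows "smooth f \<Longrightarrow> smooth g \<Longrightarrow> smooth (\<lambda>x. f (g x))"
  by (simp add: smooth_def C_k_compose)

lemma smooth_C_k: "smooth f \<Longrightarrow> C_k m f"
  by (simp add: smooth_def)

lemma smooth_differentiable: "smooth f \<Longrightarrow> f differentiable (at x)"
  using smooth_C_k[of f "Suc 0"] by simp

lemma smooth_has_derivative:
  "smooth f \<Longrightarrow> (f has_derivative frechet_derivative f (at x)) (at x)"
  by (simp add: smooth_differentiable frechet_derivative_works[symmetric])

lemma smooth_continuous: "smooth f \<Longrightarrow> continuous_on UNIV f"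
  using smooth_C_k[of f 0] by simp

lemma smooth_continuous_on: "smooth f \<Longrightarrow> continuous_on S f"
  using smooth_continuous continuous_on_subset by blast

lemma smooth_frechet_derivative: "smooth f \<Longrightarrow> smooth (\<lambda>x. frechet_derivative f (at x) h)"
  unfolding smooth_def
proof
  fix m assume "\<forall>m. C_k m f"
  then have "C_k (Suc m) f" ..
  then show "C_k m (\<lambda>x. frechet_derivative f (at x) h)" by simp
qed

text \<open>Base point and direction both vary here, so the derivative is expanded over the basis,
  and each fixed directional derivative is a composition of smooth maps.\<close>

lemma smooth_frechet_derivative_compose [smooth_intros]:
  fixes f :: "'b::euclidean_space \<Rightarrow> 'c::real_normed_vector" and g h :: "'a::real_normed_vector \<Rightarrow> 'b"
  assumes "smooth f" "smooth g" "smooth h"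
  shows "smooth (\<lambda>x. frechet_derivative f (at (g x)) (h x))"
proof -
  have "smooth (\<lambda>x. \<Sum>b\<in>Basis. (h x \<bullet> b) *\<^sub>R frechet_derivative f (at (g x)) b)"
    using assms by (intro smooth_intros smooth_compose[OF smooth_frechet_derivative])
  then show ?thesis
    by (simp add: has_derivative_Basis_expand[OF smooth_has_derivative[OF assms(1)], symmetric])
qed

lemma smooth_partial [smooth_intros]: "smooth f \<Longrightarrow> smooth (partial i f)"
  unfolding partial_def[abs_def] by (rule smooth_frechet_derivative)

lemma smooth_advect [smooth_intros]: "smooth u \<Longrightarrow> smooth f \<Longrightarrow> smooth (advect u f)"
  unfolding advect_def[abs_def] by (intro smooth_intros)

section \<open>Matrices\<close>

lemma bounded_bilinear_matrix_mult:
  "bounded_bilinear ((**) :: real^'m^'n \<Rightarrow> real^'p^'m \<Rightarrow> real^'p^'n)"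
proof (rule bilinear_conv_bounded_bilinear[THEN iffD1], unfold bilinear_def, intro allI conjI)
  show "linear (\<lambda>B. A ** B)" for A :: "real^'m^'n"
    by (rule linearI)
      (simp_all add: matrix_add_ldistrib scalar_matrix_assoc matrix_scalar_ac)
  show "linear (\<lambda>A. A ** B)" for B :: "real^'p^'m"
    by (rule linearI)
      (simp_all add: matrix_matrix_mult_def vec_eq_iff distrib_right sum.distrib sum_distrib_left mult.assoc)
qed

lemmas smooth_matrix_mult [smooth_intros] = smooth_bounded_bilinear[OF bounded_bilinear_matrix_mult]

lemma smooth_transpose [smooth_intros]: "smooth f \<Longrightarrow> smooth (\<lambda>x. transpose (f x) :: real^'n^'m)"
  unfolding transpose_def by (intro smooth_intros)

lemma smooth_det [smooth_intros]: "smooth f \<Longrightarrow> smooth (\<lambda>x. det (f x :: real^'n^'n))"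
  unfolding det_def by (intro smooth_intros)

lemma
  assumes "invertible A"
  shows matrix_inv_right: "A ** matrix_inv A = mat 1"
    and matrix_inv_left: "matrix_inv A ** A = mat 1"
  using someI_ex[OF assms[unfolded invertible_def]] unfolding matrix_inv_def by auto

text \<open>Cramer's rule. It exhibits the entries of the inverse as quotients of determinants,
  which is how inversion is seen to be smooth.\<close>

lemma matrix_inv_nth:
  fixes A :: "real^'n^'n"
  assumes "invertible A"
  shows "matrix_inv A $ i $ j = det (\<chi> r s. if s = i then axis j 1 $ r else A $ r $ s) / det A"
proof -
  have "A ** matrix_inv A = mat 1"
    by (simp add: assms matrix_inv_right)
  then have "A *v (matrix_inv A *v axis j 1) = axis j 1"
    by (simp add: matrix_vector_mul_assoc)
  then have "matrix_inv A *v axis j 1 = (\<chi> k. det (\<chi> r s. if s = k then axis j 1 $ r else A $ r $ s) / det A)"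
    using cramer[of A] assms invertible_det_nz by blast
  moreover have "(matrix_inv A *v axis j 1) $ i = matrix_inv A $ i $ j"
    by (simp add: matrix_vector_mult_basis column_def)
  ultimately show ?thesis by simp
qed

lemma smooth_matrix_inv [smooth_intros]:
  fixes f :: "'a::real_normed_vector \<Rightarrow> real^'n^'n"
  assumes "\<And>x. invertible (f x)" "smooth f"
  shows "smooth (\<lambda>x. matrix_inv (f x))"
proof -
  have "smooth (\<lambda>x. \<chi> i j. det (\<chi> r s. if s = i then axis j 1 $ r else f x $ r $ s) / det (f x))"
  proof (intro smooth_intros)
    show "smooth (\<lambda>x. if s = i then axis j 1 $ r else f x $ r $ s)" for i j r s
      using assms(2) by (cases "s = i") (auto intro!: smooth_intros)
    show "det (f x) \<noteq> 0" for x
      using assms(1) by (simp add: invertible_det_nz[symmetric])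
  qed (use assms(2) in auto)
  also have "(\<lambda>x. \<chi> i j. det (\<chi> r s. if s = i then axis j 1 $ r else f x $ r $ s) / det (f x))
      = (\<lambda>x. matrix_inv (f x))"
    by (auto simp: vec_eq_iff matrix_inv_nth[OF assms(1)])
  finally show ?thesis .
qed

text \<open>Differentiability is already known from Cramer's rule, so the identity
  \<open>f x ** matrix_inv (f x) = mat 1\<close> may be differentiated and solved for the unknown
  derivative.\<close>

lemma has_derivative_matrix_inv:
  fixes f :: "'a::real_normed_vector \<Rightarrow> real^'n^'n"
  assumes inv: "\<And>x. invertible (f x)" and f: "smooth f"
  shows "((\<lambda>x. matrix_inv (f x)) has_derivative
    (\<lambda>h. - (matrix_inv (f x) ** frechet_derivative f (at x) h ** matrix_inv (f x)))) (at x)"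
proof -
  let ?g = "\<lambda>x. matrix_inv (f x)"
  let ?g' = "frechet_derivative ?g (at x)" and ?f' = "frechet_derivative f (at x)"
  have g: "(?g has_derivative ?g') (at x)"
    by (intro smooth_has_derivative smooth_intros inv f)
  have "((\<lambda>x. f x ** ?g x) has_derivative (\<lambda>h. f x ** ?g' h + ?f' h ** ?g x)) (at x)"
    by (intro bounded_bilinear.FDERIV[OF bounded_bilinear_matrix_mult] g smooth_has_derivative f)
  moreover have "((\<lambda>x. f x ** ?g x) has_derivative (\<lambda>h. 0)) (at x)"
    by (simp add: matrix_inv_right[OF inv])
  ultimately have "(\<lambda>h. f x ** ?g' h + ?f' h ** ?g x) = (\<lambda>h. 0)"
    by (rule has_derivative_unique)
  then have "f x ** ?g' h + ?f' h ** ?g x = 0" for h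
    by meson
  then have "f x ** ?g' h = - (?f' h ** ?g x)" for h
    by (simp add: eq_neg_iff_add_eq_0)
  then have "?g x ** (f x ** ?g' h) = ?g x ** - (?f' h ** ?g x)" for h
    by simp
  then have "?g' h = - (?g x ** ?f' h ** ?g x)" for h
    by (simp add: matrix_mul_assoc matrix_inv_left[OF inv] 
        bounded_bilinear.minus_right[OF bounded_bilinear_matrix_mult])
  then show ?thesis
    using g by (simp add: has_derivative_eq_rhs ext)
qed

text \<open>The Frobenius product is the Euclidean inner product of the matrix type, so orthonormal
  bases, Cauchy-Schwarz and inner product calculus apply to the trace pairing.\<close>

lemma tr_pair_eq_inner: "tr_pair A B = A \<bullet> B"
  by (subst inner_commute, simp add: tr_pair_def trace_def transpose_def matrix_matrix_mult_def inner_vec_def mult.commute)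
    (rule sum.swap)


section \<open>Differentiation under the integral and integration by parts\<close>

lemma compactly_supportedI: "compact K \<Longrightarrow> (\<And>x. x \<notin> K \<Longrightarrow> f x = 0) \<Longrightarrow> compactly_supported f"
  unfolding compactly_supported_def by blast

lemma compactly_supported_cbox:
  assumes "compactly_supported f"
  obtains a b :: "'a::euclidean_space" where "\<And>x. x \<notin> cbox a b \<Longrightarrow> f x = 0"
proof -
  from assms obtain K where "compact K" and K: "\<And>x. x \<notin> K \<Longrightarrow> f x = 0"
    unfolding compactly_supported_def by blast
  from \<open>compact K\<close> obtain a b where "K \<subseteq> cbox a b"
    using bounded_subset_cbox_symmetric compact_imp_bounded by metis
  with K show ?thesis by (intro that) blast
qed

text \<open>A bridge from the Lebesgue integral over the whole space to the gauge integral over a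
  box, for which the Leibniz rule is stated.\<close>

lemma integral_cbox_support:
  fixes f :: "'a::euclidean_space \<Rightarrow> 'b::euclidean_space"
  assumes f: "continuous_on UNIV f" and 0: "\<And>x. x \<notin> cbox a b \<Longrightarrow> f x = 0"
  shows "integrable lborel f" "(LBINT x. f x) = integral (cbox a b) f"
proof -
  have eq: "f = (\<lambda>x. indicator (cbox a b) x *\<^sub>R f x)"
    using 0 by (auto simp: indicator_def)
  have *: "set_integrable lborel (cbox a b) f"
    unfolding set_integrable_def
    by (intro borel_integrable_compact compact_cbox continuous_on_subset[OF f]) simp
  then show "integrable lborel f"
    using eq unfolding set_integrable_def by simp
  show "(LBINT x. f x) = integral (cbox a b) f"
    using set_borel_integral_eq_integral(2)[OF *] eq unfolding set_lebesgue_integral_def by simp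
qed

lemma integrable_compactly_supported:
  fixes f :: "'a::euclidean_space \<Rightarrow> 'b::euclidean_space"
  assumes "continuous_on UNIV f" and "compactly_supported f"
  shows "integrable lborel f"
proof -
  from assms(2) obtain a b where "\<And>x. x \<notin> cbox a b \<Longrightarrow> f x = 0"
    by (rule compactly_supported_cbox) blast
  then show ?thesis
    by (rule integral_cbox_support(1)[OF assms(1)])
qed

text \<open>The support is controlled only for times in [-1, 1], because the support of a translate
  moves with \<open>t\<close>. Near time 0 everything lives in one box, where the Leibniz rule
  applies.\<close>

lemma has_real_derivative_integral:
  fixes f f' :: "real \<Rightarrow> 'a::euclidean_space \<Rightarrow> real"
  assumes "compact K" and K: "\<And>t x. t \<in> {-1..1} \<Longrightarrow> x \<notin> K \<Longrightarrow> f t x = 0"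
    and f: "\<And>t. continuous_on UNIV (f t)"
    and f': "\<And>t x. ((\<lambda>t. f t x) has_real_derivative f' t x) (at t)"
    and cont: "continuous_on UNIV (\<lambda>(t, x). f' t x)"
  shows "((\<lambda>t. LBINT x. f t x) has_real_derivative (LBINT x. f' 0 x)) (at 0)"
proof -
  from \<open>compact K\<close> obtain a b where "K \<subseteq> cbox a b"
    using bounded_subset_cbox_symmetric compact_imp_bounded by metis
  with K have K': "f t x = 0" if "t \<in> {-1..1}" "x \<notin> cbox a b" for t x
    using that by blast
  have f'0: "f' 0 x = 0" if "x \<notin> cbox a b" for x
  proof (rule DERIV_unique[OF f'])
    have eq: "0 = f t x" if "dist t 0 < 1" for t
    proof -
      from that have "-1 \<le> t" "t \<le> 1"
        unfolding dist_real_def by linarith+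
      then show ?thesis
        using K'[of t x] \<open>x \<notin> cbox a b\<close> by simp
    qed
    show "((\<lambda>t. f t x) has_real_derivative 0) (at 0)"
      by (rule has_field_derivative_transform_within[where d = 1, OF _ _ _ eq]) simp_all
  qed
  have cont': "continuous_on UNIV (f' t)" for t
    using continuous_on_compose2[OF cont continuous_on_Pair[OF continuous_on_const continuous_on_id]] by simp
  have "((\<lambda>t. integral (cbox a b) (f t)) has_real_derivative integral (cbox a b) (f' 0)) (at 0 within {-1..1})"
  proof (rule leibniz_rule_field_derivative)
    show "((\<lambda>t. f t x) has_real_derivative f' t x) (at t within {-1..1})" for t x
      using f' has_field_derivative_at_within by blast
    show "f t integrable_on cbox a b" for t
      by (intro integrable_continuous continuous_on_subset[OF f]) simp
    show "continuous_on ({-1..1} \<times> cbox a b) (\<lambda>(t, x). f' t x)"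
      using cont continuous_on_subset by blast
  qed auto
  then have "((\<lambda>t. integral (cbox a b) (f t)) has_real_derivative integral (cbox a b) (f' 0)) (at 0)"
    by (simp add: at_within_Icc_at)
  moreover have eq: "integral (cbox a b) (f t) = (LBINT x. f t x)" if "dist t 0 < 1" for t
  proof -
    from that have "t \<in> {-1..1}"
      unfolding dist_real_def by simp linarith
    then show ?thesis
      using integral_cbox_support(2)[OF f, of a b t] K' by simp
  qed
  ultimately have "((\<lambda>t. LBINT x. f t x) has_real_derivative integral (cbox a b) (f' 0)) (at 0)"
    by (intro has_field_derivative_transform_within[where d = 1, OF _ _ _ eq]) auto
  then show ?thesis
    by (subst integral_cbox_support(2)[OF cont' f'0])
qed

lemma integral_translation:
  fixes f :: "'a::euclidean_space \<Rightarrow> real"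
  assumes "f \<in> borel_measurable borel"
  shows "(LBINT x. f (x + c)) = (LBINT x. f x)"
proof -
  have "(LBINT x. f x) = integral\<^sup>L (distr lborel borel ((+) c)) f"
    by (simp add: lborel_distr_plus)
  also have "\<dots> = (LBINT x. f (c + x))"
    using assms by (subst integral_distr) auto
  finally show ?thesis by (simp add: add.commute)
qed

lemma C_k_frechet_derivative_0:
  "C_k (Suc 0) f \<Longrightarrow> continuous_on UNIV (\<lambda>x. frechet_derivative f (at x) h)"
  by simp

text \<open>The integral of \<open>x \<mapsto> g (x + t h)\<close> does not depend on \<open>t\<close>.\<close>
lemma integral_frechet_derivative_eq_0:
  fixes g :: "'a::euclidean_space \<Rightarrow> real"
  assumes g: "C_k (Suc 0) g" and "compactly_supported g"
  shows "(LBINT x. frechet_derivative g (at x) h) = 0"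
proof -
  from assms obtain K where "compact K" and K: "\<And>x. x \<notin> K \<Longrightarrow> g x = 0"
    unfolding compactly_supported_def by blast
  have cg: "continuous_on UNIV g"
    using C_k_SucD[OF g] by simp
  \<comment> \<open>\<open>K'\<close> contains the supports of all translates of \<open>g\<close> by
    \<open>t *\<^sub>R h\<close> with \<open>t\<close> in [-1, 1].\<close>
  define K' where "K' = (\<lambda>(x, t). x - t *\<^sub>R h) ` (K \<times> {-1..1::real})"
  have "compact K'"
    unfolding K'_def case_prod_unfold
    by (intro compact_continuous_image compact_Times \<open>compact K\<close> compact_Icc continuous_intros)
  have "((\<lambda>t. LBINT x. g (x + t *\<^sub>R h)) has_real_derivative
      (LBINT x. frechet_derivative g (at (x + 0 *\<^sub>R h)) h)) (at 0)"
  proof (rule has_real_derivative_integral[OF \<open>compact K'\<close>])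
    show "g (x + t *\<^sub>R h) = 0" if "t \<in> {-1..1}" "x \<notin> K'" for t x
    proof (rule K)
      show "x + t *\<^sub>R h \<notin> K"
      proof
        assume "x + t *\<^sub>R h \<in> K"
        then have "(\<lambda>(x, t). x - t *\<^sub>R h) (x + t *\<^sub>R h, t) \<in> K'"
          unfolding K'_def using that(1) by (intro imageI) auto
        with that(2) show False by simp
      qed
    qed
    show "continuous_on UNIV (\<lambda>x. g (x + t *\<^sub>R h))" for t
      by (rule continuous_on_compose2[OF cg]) (auto intro: continuous_intros)
    show "((\<lambda>t. g (x + t *\<^sub>R h)) has_real_derivative frechet_derivative g (at (x + t *\<^sub>R h)) h) (at t)" for t x
    proof -
      let ?D = "frechet_derivative g (at (x + t *\<^sub>R h))"
      have "((\<lambda>t. x + t *\<^sub>R h) has_derivative (\<lambda>s. s *\<^sub>R h)) (at t)"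
        by (auto intro!: derivative_eq_intros)
      then have "((\<lambda>t. g (x + t *\<^sub>R h)) has_derivative (\<lambda>s. ?D (s *\<^sub>R h))) (at t)"
        by (rule has_derivative_compose[where g = g]) (rule C_k_Suc_has_derivative[OF g])
      moreover have "?D (s *\<^sub>R h) = ?D h * s" for s
        using linear_cmul[OF has_derivative_linear[OF C_k_Suc_has_derivative[OF g]]] by simp
      ultimately show ?thesis
        by (simp add: has_field_derivative_def)
    qed
    show "continuous_on UNIV (\<lambda>(t, x). frechet_derivative g (at (x + t *\<^sub>R h)) h)"
      unfolding case_prod_unfold
      by (rule continuous_on_compose2[OF C_k_frechet_derivative_0[OF g]]) (auto intro!: continuous_intros)
  qed
  moreover have "(LBINT x. g (x + t *\<^sub>R h)) = (LBINT x. g x)" for t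
    using cg by (intro integral_translation borel_measurable_continuous_onI)
  ultimately have "((\<lambda>t. LBINT x. g x) has_real_derivative (LBINT x. frechet_derivative g (at x) h)) (at (0::real))"
    by simp
  then show ?thesis
    using DERIV_const DERIV_unique by blast
qed

section \<open>The operator \<open>advect\<close> and integration by parts against a divergence-free
  field\<close>

lemma advect_eq_frechet_derivative:
  assumes "f differentiable (at x)"
  shows "advect u f x = frechet_derivative f (at x) (u x)"
proof -
  let ?D = "frechet_derivative f (at x)"
  have lin: "linear ?D"
    using assms by (simp add: linear_frechet_derivative)
  have "?D (u x) = ?D (\<Sum>i\<in>UNIV. u x $ i *\<^sub>R axis i 1)"
    using basis_expansion[of "u x"] by (simp add: scalar_mult_eq_scaleR)
  also have "\<dots> = (\<Sum>i\<in>UNIV. u x $ i *\<^sub>R ?D (axis i 1))"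
    using lin by (simp add: linear_sum linear_cmul)
  finally show ?thesis
    by (simp add: advect_def partial_def)
qed

lemma frechet_derivative_bounded_bilinear:
  assumes "bounded_bilinear B" "f differentiable (at x)" "g differentiable (at x)"
  shows "frechet_derivative (\<lambda>x. B (f x) (g x)) (at x) h =
    B (f x) (frechet_derivative g (at x) h) + B (frechet_derivative f (at x) h) (g x)"
proof -
  have "((\<lambda>x. B (f x) (g x)) has_derivative
      (\<lambda>h. B (f x) (frechet_derivative g (at x) h) + B (frechet_derivative f (at x) h) (g x))) (at x)"
    using assms by (intro bounded_bilinear.FDERIV) (simp_all add: frechet_derivative_works)
  from frechet_derivative_at[OF this] show ?thesis
    by metis
qed

lemma frechet_derivative_bounded_linear:
  assumes "bounded_linear L" "f differentiable (at x)"
  shows "frechet_derivative (\<lambda>x. L (f x)) (at x) h = L (frechet_derivative f (at x) h)"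
proof -
  have "((\<lambda>x. L (f x)) has_derivative (\<lambda>h. L (frechet_derivative f (at x) h))) (at x)"
    using assms by (intro bounded_linear.has_derivative[OF assms(1)]) (simp add: frechet_derivative_works)
  from frechet_derivative_at[OF this] show ?thesis
    by metis
qed

lemma advect_eq_0: "u x = 0 \<Longrightarrow> advect u f x = 0"
  by (simp add: advect_def)

lemma C_k_mult: "C_k m f \<Longrightarrow> C_k m g \<Longrightarrow> C_k m (\<lambda>x. f x * g x :: real)"
  by (rule C_k_bounded_bilinear[OF bounded_bilinear_mult])

text \<open>Since div (w u) = 0, the integrand is the divergence of f w u, each summand of which is
  a derivative of a compactly supported function. One continuous derivative of \<open>f\<close> is
  assumed because the potential from \<open>poincare_lemma\<close> is provided with just
  that.\<close>

lemma integral_advect_eq_0: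
  fixes f :: "real^3 \<Rightarrow> real"
  assumes w: "smooth w" and u: "u \<in> X_vol w" "compactly_supported u" and f: "C_k (Suc 0) f"
  shows "(LBINT x. w x * advect u f x) = 0"
proof -
  have su: "smooth u" and div: "divergence (\<lambda>y. w y *\<^sub>R u y) x = 0" for x
    using u by (auto simp: X_vol_def)
  from u(2) obtain K where K: "compact K" "\<And>x. x \<notin> K \<Longrightarrow> u x = 0"
    unfolding compactly_supported_def by blast
  define g where "g i x = w x * u x $ i" for i x
  have sg: "smooth (g i)" for i
    unfolding g_def[abs_def] by (intro smooth_intros w su)
  have gf: "C_k (Suc 0) (\<lambda>x. g i x * f x)" for i
    by (intro C_k_mult f smooth_C_k sg)
  have cs: "compactly_supported (\<lambda>x. g i x * f x)" for i
    unfolding compactly_supported_def using K by (auto simp: g_def)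
  have int0: "(LBINT x. partial i (\<lambda>x. g i x * f x) x) = 0" for i
    unfolding partial_def by (rule integral_frechet_derivative_eq_0[OF gf cs])
  have prod: "partial i (\<lambda>x. g i x * f x) x = g i x * partial i f x + partial i (g i) x * f x" for i x
    unfolding partial_def
    by (rule frechet_derivative_bounded_bilinear[OF bounded_bilinear_mult smooth_differentiable[OF sg]])
      (use f in simp)
  have "w x * advect u f x = (\<Sum>i\<in>UNIV. partial i (\<lambda>x. g i x * f x) x)" for x
  proof -
    have "(\<Sum>i\<in>UNIV. partial i (g i) x) = 0"
      using div[of x] by (simp add: divergence_def g_def[abs_def])
    then show ?thesis
      unfolding prod advect_def sum.distrib sum_distrib_right[symmetric]
      by (simp add: g_def sum_distrib_left mult_ac)
  qed
  moreover have "integrable lborel (\<lambda>x. partial i (\<lambda>x. g i x * f x) x)" for i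
  proof (rule integrable_compactly_supported)
    show "continuous_on UNIV (\<lambda>x. partial i (\<lambda>x. g i x * f x) x)"
      unfolding partial_def by (rule C_k_frechet_derivative_0[OF gf])
    have "partial i (\<lambda>x. g i x * f x) x = 0" if "x \<notin> K" for x
    proof -
      have "((\<lambda>x. 0) has_derivative (\<lambda>h. 0)) (at x)" by simp
      then have "((\<lambda>x. g i x * f x) has_derivative (\<lambda>h. 0)) (at x)"
        by (rule has_derivative_transform_within_open[of _ _ _ _ "- K"])
          (use K that in \<open>auto simp: g_def compact_imp_closed\<close>)
      from frechet_derivative_at[OF this] show ?thesis
        unfolding partial_def by metis
    qed
    then show "compactly_supported (\<lambda>x. partial i (\<lambda>x. g i x * f x) x)"
      using K(1) unfolding compactly_supported_def by blast
  qed
  ultimately show ?thesis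
    by (simp add: int0)
qed

text \<open>Leibniz rule for the scalar function \<open>f x \<bullet> g x\<close>, whose advection
  integrates to zero against \<open>w\<close>.\<close>

lemma integral_advect_by_parts:
  fixes f g :: "real^3 \<Rightarrow> 'b::euclidean_space"
  assumes w: "smooth w" and u: "u \<in> X_vol w" "compactly_supported u" and f: "smooth f" and g: "smooth g"
  shows "(LBINT x. w x * (f x \<bullet> advect u g x)) = - (LBINT x. w x * (advect u f x \<bullet> g x))"
proof -
  have su: "smooth u" using u by (auto simp: X_vol_def)
  have adv: "advect u (\<lambda>x. f x \<bullet> g x) x = f x \<bullet> advect u g x + advect u f x \<bullet> g x" for x
    using f g by (simp add: advect_eq_frechet_derivative smooth_differentiable smooth_intros
        frechet_derivative_bounded_bilinear[OF bounded_bilinear_inner])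
  from u(2) obtain K where K: "compact K" "\<And>x. x \<notin> K \<Longrightarrow> u x = 0"
    unfolding compactly_supported_def by blast
  have "integrable lborel (\<lambda>x. w x * (f x \<bullet> advect u g x))" "integrable lborel (\<lambda>x. w x * (advect u f x \<bullet> g x))"
    using K by (auto intro!: integrable_compactly_supported smooth_continuous smooth_intros w f g su
        compactly_supportedI[of K] simp: advect_eq_0)
  moreover have "(LBINT x. w x * advect u (\<lambda>x. f x \<bullet> g x) x) = 0"
    by (intro integral_advect_eq_0 w u smooth_C_k smooth_intros f g)
  ultimately show ?thesis
    by (simp add: adv distrib_left)
qed

section \<open>Symmetry of second derivatives, potentials of curl-free fields, and the vorticity
  pairing\<close>

lemma has_vector_derivative_line:
  assumes "(f has_derivative f') (at (x + t *\<^sub>R h))"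
  shows "((\<lambda>s. f (x + s *\<^sub>R h)) has_vector_derivative f' h) (at t within S)"
proof -
  have "((\<lambda>s. x + s *\<^sub>R h) has_derivative (\<lambda>s. s *\<^sub>R h)) (at t within S)"
    by (auto intro!: derivative_eq_intros)
  then have "((\<lambda>s. f (x + s *\<^sub>R h)) has_derivative (\<lambda>s. f' (s *\<^sub>R h))) (at t within S)"
    by (rule has_derivative_compose[where g = f]) (rule assms)
  then show ?thesis
    using linear_cmul[OF has_derivative_linear[OF assms]] by (simp add: has_vector_derivative_def)
qed

text \<open>Differentiate \<open>f (x + s h + t k) = f (x + s h) + \<integral>\<^sub>0\<^sup>t D f (x + s h + \<tau> k) k d\<tau>\<close> in \<open>s\<close> and then in \<open>t\<close>.\<close>
lemma frechet_derivative_commute: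
  fixes f :: "'a::euclidean_space \<Rightarrow> 'b::euclidean_space"
  assumes f: "smooth f"
  shows "frechet_derivative (\<lambda>y. frechet_derivative f (at y) h) (at x) k =
    frechet_derivative (\<lambda>y. frechet_derivative f (at y) k) (at x) h"
proof -
  let ?D = "\<lambda>y. frechet_derivative f (at y)"
  let ?E = "\<lambda>y. frechet_derivative (\<lambda>y. ?D y k) (at y) h"
  note fD = smooth_has_derivative[OF f]
  note sD = smooth_frechet_derivative[OF f, of k]
  note sE = smooth_frechet_derivative[OF sD, of h]
  have cont: "continuous_on S (\<lambda>\<tau>. G (x + s *\<^sub>R h + \<tau> *\<^sub>R k))" if "smooth G" for G :: "'a \<Rightarrow> 'b" and s S
    by (rule continuous_on_compose2[OF smooth_continuous[OF that]]) (auto intro!: continuous_intros)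
  have ftc: "integral {0..t} (\<lambda>\<tau>. ?D (x + s *\<^sub>R h + \<tau> *\<^sub>R k) k) = f (x + s *\<^sub>R h + t *\<^sub>R k) - f (x + s *\<^sub>R h)"
    if "t \<in> {0..1}" for s t :: real
    using fundamental_theorem_of_calculus[of 0 t "\<lambda>\<tau>. f (x + s *\<^sub>R h + \<tau> *\<^sub>R k)" "\<lambda>\<tau>. ?D (x + s *\<^sub>R h + \<tau> *\<^sub>R k) k"]
      that has_vector_derivative_line[OF fD] by (auto intro!: integral_unique)
  have eq: "?D (x + t *\<^sub>R k) h = ?D x h + integral {0..t} (\<lambda>\<tau>. ?E (x + \<tau> *\<^sub>R k))" if t: "t \<in> {0..1}" for t
  proof -
    have "((\<lambda>s. integral (cbox 0 t) (\<lambda>\<tau>. ?D (x + s *\<^sub>R h + \<tau> *\<^sub>R k) k)) has_vector_derivative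
        integral (cbox 0 t) (\<lambda>\<tau>. ?E (x + 0 *\<^sub>R h + \<tau> *\<^sub>R k))) (at 0 within UNIV)"
    proof (rule leibniz_rule_vector_derivative)
      show "((\<lambda>s. ?D (x + s *\<^sub>R h + \<tau> *\<^sub>R k) k) has_vector_derivative ?E (x + s *\<^sub>R h + \<tau> *\<^sub>R k)) (at s within UNIV)" for s \<tau>
        using has_vector_derivative_line[where x = "x + \<tau> *\<^sub>R k" and t = s and h = h, OF smooth_has_derivative[OF sD]]
        by (simp add: ac_simps)
      show "(\<lambda>\<tau>. ?D (x + s *\<^sub>R h + \<tau> *\<^sub>R k) k) integrable_on cbox 0 t" for s
        by (intro integrable_continuous cont sD)
      show "continuous_on (UNIV \<times> cbox 0 t) (\<lambda>(s, \<tau>). ?E (x + s *\<^sub>R h + \<tau> *\<^sub>R k))"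
        unfolding case_prod_unfold
        by (rule continuous_on_compose2[OF smooth_continuous[OF sE]]) (auto intro!: continuous_intros)
    qed auto
    then have "((\<lambda>s. f (x + s *\<^sub>R h + t *\<^sub>R k) - f (x + s *\<^sub>R h)) has_vector_derivative
        integral {0..t} (\<lambda>\<tau>. ?E (x + \<tau> *\<^sub>R k))) (at 0)"
      using ftc[OF t] by simp
    moreover have "((\<lambda>s. f (x + s *\<^sub>R h + t *\<^sub>R k) - f (x + s *\<^sub>R h)) has_vector_derivative ?D (x + t *\<^sub>R k) h - ?D x h) (at 0)"
      using has_vector_derivative_line[where x = "x + t *\<^sub>R k" and t = 0 and h = h, OF fD]
        has_vector_derivative_line[where x = x and t = 0 and h = h, OF fD]
      by (intro has_vector_derivative_diff) (simp_all add: ac_simps)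
    ultimately have "integral {0..t} (\<lambda>\<tau>. ?E (x + \<tau> *\<^sub>R k)) = ?D (x + t *\<^sub>R k) h - ?D x h"
      by (rule vector_derivative_unique_at)
    then show ?thesis by simp
  qed
  \<comment> \<open>The integral formula holds for \<open>t\<close> in [0, 1], so this is a
    one-sided derivative at 0. It still determines the value, as 0 is a limit point of the
    interval.\<close>
  have "((\<lambda>t. integral {0..t} (\<lambda>\<tau>. ?E (x + \<tau> *\<^sub>R k))) has_vector_derivative ?E (x + 0 *\<^sub>R k)) (at 0 within {0..1})"
    using cont[OF sE, of _ 0] by (intro integral_has_vector_derivative) auto
  then have "((\<lambda>t. ?D x h + integral {0..t} (\<lambda>\<tau>. ?E (x + \<tau> *\<^sub>R k))) has_vector_derivative 0 + ?E x) (at 0 within {0..1})"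
    by (intro has_vector_derivative_add) auto
  then have "((\<lambda>t. ?D (x + t *\<^sub>R k) h) has_vector_derivative 0 + ?E x) (at 0 within {0..1})"
    by (rule has_vector_derivative_transform[rotated 2]) (auto simp: eq)
  then have "((\<lambda>t. ?D (x + t *\<^sub>R k) h) has_vector_derivative ?E x) (at 0 within {0..1})"
    by simp
  moreover have "((\<lambda>t. ?D (x + t *\<^sub>R k) h) has_vector_derivative
      frechet_derivative (\<lambda>y. ?D y h) (at (x + 0 *\<^sub>R k)) k) (at 0 within {0..1})"
    by (rule has_vector_derivative_line[OF smooth_has_derivative[OF smooth_frechet_derivative[OF f]]])
  ultimately show ?thesis
    by (simp add: vector_derivative_unique_within[of 0 "{0..1::real}"] trivial_limit_within islimpt_Icc)
qed

text \<open>By the mean value theorem along segments.\<close>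
lemma has_derivative_directional:
  fixes f :: "'a::euclidean_space \<Rightarrow> real"
  assumes dir: "\<And>x h. ((\<lambda>s. f (x + s *\<^sub>R h)) has_real_derivative G x \<bullet> h) (at 0)"
    and G: "continuous_on UNIV G"
  shows "(f has_derivative (\<lambda>h. G x \<bullet> h)) (at x)"
  unfolding has_derivative_at_alt
proof (intro conjI allI impI)
  show "bounded_linear (\<lambda>h. G x \<bullet> h)"
    by (rule bounded_linear_inner_right)
  fix e :: real assume "0 < e"
  moreover have "isCont G x"
    using G by (simp add: continuous_on_eq_continuous_at)
  ultimately obtain d where "d > 0" and d: "\<And>y. dist y x < d \<Longrightarrow> dist (G y) (G x) < e"
    unfolding continuous_at_eps_delta dist_norm by blast
  have "norm (f y - f x - G x \<bullet> (y - x)) \<le> e * norm (y - x)" if y: "norm (y - x) < d" for y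
  proof -
    let ?h = "y - x"
    have der: "((\<lambda>s. f (x + s *\<^sub>R ?h)) has_real_derivative G (x + t *\<^sub>R ?h) \<bullet> ?h) (at t)" for t
      using DERIV_shift[of "\<lambda>s. f (x + s *\<^sub>R ?h)" _ 0 t] dir[of "x + t *\<^sub>R ?h" ?h]
      by (simp add: algebra_simps)
    obtain t where t: "0 < t" "t < 1" "f (x + 1 *\<^sub>R ?h) - f (x + 0 *\<^sub>R ?h) = (1 - 0) * (G (x + t *\<^sub>R ?h) \<bullet> ?h)"
      using MVT2[of 0 1, OF _ der] by auto
    have "dist (x + t *\<^sub>R ?h) x < d"
      using t(1,2) y by (simp add: dist_norm) (smt (verit) mult_left_le_one_le norm_ge_zero)
    then have "norm (G (x + t *\<^sub>R ?h) - G x) < e"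
      using d by (simp add: dist_norm)
    moreover have "f y - f x - G x \<bullet> ?h = (G (x + t *\<^sub>R ?h) - G x) \<bullet> ?h"
      using t(3) by (simp add: inner_diff_left)
    ultimately show ?thesis
      using Cauchy_Schwarz_ineq2[of "G (x + t *\<^sub>R ?h) - G x" ?h]
      by (smt (verit) mult_right_mono norm_ge_zero real_norm_def)
  qed
  then show "\<exists>d>0. \<forall>y. norm (y - x) < d \<longrightarrow> norm (f y - f x - G x \<bullet> (y - x)) \<le> e * norm (y - x)"
    using \<open>d > 0\<close> by blast
qed

text \<open>The components of the curl are, up to sign, the off-diagonal entries of the
  antisymmetric part of the Jacobian.\<close>

lemma curl_eq_0_symmetric:
  assumes v: "smooth v" and "curl v x = 0"
  shows "frechet_derivative v (at x) h \<bullet> k = frechet_derivative v (at x) k \<bullet> h"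
proof -
  define A where "A i j = partial i (\<lambda>y. v y $ j) x" for i j
  have A: "partial i v x $ j = A i j" for i j
    unfolding A_def partial_def using smooth_differentiable[OF v]
    by (simp add: frechet_derivative_bounded_linear[OF bounded_linear_vec_nth])
  have "curl v x $ 1 = 0" "curl v x $ 2 = 0" "curl v x $ 3 = 0"
    using assms(2) by simp_all
  then have sym: "A 2 3 = A 3 2" "A 3 1 = A 1 3" "A 1 2 = A 2 1"
    by (simp_all add: curl_def A_def vector_3)
  have D: "frechet_derivative v (at x) h = advect (\<lambda>x. h) v x" for h
    by (simp add: advect_eq_frechet_derivative smooth_differentiable v)
  show ?thesis
    unfolding D advect_def inner_vec_def
    by (simp add: A sum_3 sym inner_real_def algebra_simps)
qed

text \<open>The potential is the line integral of \<open>v\<close> along the segment from the origin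
  to \<open>x\<close>. Its directional derivatives are computed under the integral sign, and
  continuity of \<open>v\<close> upgrades them to a total derivative.\<close>

lemma poincare_lemma:
  assumes v: "smooth v" and curl: "\<And>x. curl v x = 0"
  obtains f where "C_k (Suc 0) f" "\<And>u x. advect u f x = v x \<bullet> u x"
proof -
  define f where "f x = integral (cbox 0 (1::real)) (\<lambda>t. v (t *\<^sub>R x) \<bullet> x)" for x
  let ?D = "\<lambda>x. frechet_derivative v (at x)"
  have cv: "continuous_on S (\<lambda>y. v (g y))" if "continuous_on S g" for g :: "'z::topological_space \<Rightarrow> real^3" and S
    using continuous_on_compose2[OF smooth_continuous[OF v] that] by simp
  have cD: "continuous_on S (\<lambda>y. ?D (g y) h)" if "continuous_on S g" for g :: "'z::topological_space \<Rightarrow> real^3" and S h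
    using continuous_on_compose2[OF smooth_continuous[OF smooth_frechet_derivative[OF v]] that] by simp
  have dir: "((\<lambda>s. f (x + s *\<^sub>R h)) has_real_derivative v x \<bullet> h) (at 0)" for x h
  proof -
    let ?g = "\<lambda>s t. t * (?D (t *\<^sub>R (x + s *\<^sub>R h)) h \<bullet> (x + s *\<^sub>R h)) + v (t *\<^sub>R (x + s *\<^sub>R h)) \<bullet> h"
    have "((\<lambda>s. integral (cbox 0 1) (\<lambda>t. v (t *\<^sub>R (x + s *\<^sub>R h)) \<bullet> (x + s *\<^sub>R h))) has_real_derivative
        integral (cbox 0 1) (?g 0)) (at 0 within UNIV)"
    proof (rule leibniz_rule_field_derivative)
      show "((\<lambda>s. v (t *\<^sub>R (x + s *\<^sub>R h)) \<bullet> (x + s *\<^sub>R h)) has_real_derivative ?g s t) (at s within UNIV)" for s t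
      proof -
        let ?y = "t *\<^sub>R (x + s *\<^sub>R h)"
        have 1: "((\<lambda>s. t *\<^sub>R (x + s *\<^sub>R h)) has_derivative (\<lambda>r. t *\<^sub>R (r *\<^sub>R h))) (at s)"
          "((\<lambda>s. x + s *\<^sub>R h) has_derivative (\<lambda>r. r *\<^sub>R h)) (at s)"
          by (auto intro!: derivative_eq_intros)
        have "((\<lambda>s. v (t *\<^sub>R (x + s *\<^sub>R h))) has_derivative (\<lambda>r. ?D ?y (t *\<^sub>R (r *\<^sub>R h)))) (at s)"
          by (rule has_derivative_compose[where g = v, OF 1(1) smooth_has_derivative[OF v]])
        from has_derivative_inner[OF this 1(2)]
        have "((\<lambda>s. v (t *\<^sub>R (x + s *\<^sub>R h)) \<bullet> (x + s *\<^sub>R h)) has_derivative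
            (\<lambda>r. v ?y \<bullet> r *\<^sub>R h + ?D ?y (t *\<^sub>R (r *\<^sub>R h)) \<bullet> (x + s *\<^sub>R h))) (at s)" .
        moreover have D: "?D ?y (t *\<^sub>R (r *\<^sub>R h)) = (t * r) *\<^sub>R ?D ?y h" for r
          using linear_cmul[OF has_derivative_linear[OF smooth_has_derivative[OF v]]] by (metis scaleR_scaleR)
        ultimately show ?thesis
          unfolding has_field_derivative_def
          by (elim has_derivative_eq_rhs) (simp add: fun_eq_iff D distrib_left distrib_right mult_ac)
      qed
      show "(\<lambda>t. v (t *\<^sub>R (x + s *\<^sub>R h)) \<bullet> (x + s *\<^sub>R h)) integrable_on cbox 0 1" for s
        by (intro integrable_continuous continuous_intros cv)
      show "continuous_on (UNIV \<times> cbox 0 1) (\<lambda>(s, t). ?g s t)"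
        unfolding case_prod_unfold by (intro continuous_intros cv cD)
    qed auto
    moreover have "integral (cbox 0 1) (?g 0) = v x \<bullet> h"
    proof (rule integral_unique)
      \<comment> \<open>By symmetry of the Jacobian of \<open>v\<close> the arguments
        \<open>h\<close> and \<open>x\<close> may be exchanged, which makes the integrand a total
        derivative in \<open>t\<close>; its primitive vanishes at 0 and equals
        \<open>v x \<bullet> h\<close> at 1.\<close>
      have "((\<lambda>t. t * (v (t *\<^sub>R x) \<bullet> h)) has_real_derivative ?g 0 t) (at t within {0..1})" for t
      proof -
        have "((\<lambda>t. v (0 + t *\<^sub>R x)) has_vector_derivative ?D (0 + t *\<^sub>R x) x) (at t within {0..1})"
          by (rule has_vector_derivative_line[OF smooth_has_derivative[OF v]])
        then have "((\<lambda>t. v (t *\<^sub>R x)) has_derivative (\<lambda>r. r *\<^sub>R ?D (t *\<^sub>R x) x)) (at t within {0..1})"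
          by (simp add: has_vector_derivative_def)
        from has_derivative_mult[OF has_derivative_ident has_derivative_inner_left[OF this, of h]]
        show ?thesis
          using curl_eq_0_symmetric[OF v curl, of "t *\<^sub>R x" h x]
          unfolding has_field_derivative_def
          by (elim has_derivative_eq_rhs) (simp add: fun_eq_iff distrib_left distrib_right mult_ac)
      qed
      then show "(?g 0 has_integral v x \<bullet> h) (cbox 0 1)"
        using fundamental_theorem_of_calculus[of 0 1 "\<lambda>t. t * (v (t *\<^sub>R x) \<bullet> h)" "?g 0"]
        by (simp add: has_real_derivative_iff_has_vector_derivative)
    qed
    ultimately show ?thesis
      by (simp add: f_def)
  qed
  have der: "(f has_derivative (\<lambda>h. v x \<bullet> h)) (at x)" for x
    by (rule has_derivative_directional[OF dir smooth_continuous[OF v]])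
  show ?thesis
  proof
    show "C_k (Suc 0) f"
      by (rule C_k_SucI[OF der]) (simp add: continuous_intros smooth_continuous[OF v])
    show "advect u f x = v x \<bullet> u x" for u x
      using der frechet_derivative_at[OF der] advect_eq_frechet_derivative[of f x u]
      by (metis differentiable_def)
  qed
qed

lemma curl_diff:
  assumes "smooth v" "smooth v'"
  shows "curl (\<lambda>x. v x - v' x) x = curl v x - curl v' x"
proof -
  have eq: "partial i (\<lambda>y. v y $ j - v' y $ j) x = partial i (\<lambda>y. v y $ j) x - partial i (\<lambda>y. v' y $ j) x" for i j
  proof -
    have "((\<lambda>y. v y $ j - v' y $ j) has_derivative
        (\<lambda>h. frechet_derivative (\<lambda>y. v y $ j) (at x) h - frechet_derivative (\<lambda>y. v' y $ j) (at x) h)) (at x)"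
      using assms by (intro has_derivative_diff smooth_has_derivative smooth_intros)
    from fun_cong[OF frechet_derivative_at[OF this], of "axis i 1"] show ?thesis
      unfolding partial_def by (rule sym)
  qed
  show ?thesis
    unfolding curl_def vec_eq_iff forall_3 vector_minus_component vector_3 eq by simp
qed

text \<open>This resolves the \<open>THE\<close> of \<open>vorticity_pair\<close>: the difference of
  two potentials is a gradient, hence integrates to zero against \<open>w\<close> and
  \<open>u\<close>.\<close>

lemma vorticity_pair_curl:
  assumes w: "smooth w" and u: "u \<in> X_vol w" "compactly_supported u" and v: "smooth v"
  shows "vorticity_pair w (curl v) u = (LBINT x. (v x \<bullet> u x) * w x)"
proof -
  have su: "smooth u" using u by (auto simp: X_vol_def)
  from u(2) obtain K where K: "compact K" "\<And>x. x \<notin> K \<Longrightarrow> u x = 0"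
    unfolding compactly_supported_def by blast
  have int: "integrable lborel (\<lambda>x. (v x \<bullet> u x) * w x)" if "smooth v" for v
    using K by (auto intro!: integrable_compactly_supported smooth_continuous smooth_intros w su that
        compactly_supportedI[of K])
  have "(LBINT x. (v' x \<bullet> u x) * w x) = (LBINT x. (v x \<bullet> u x) * w x)"
    if v': "smooth v'" "curl v' = curl v" for v'
  proof -
    have "curl (\<lambda>x. v' x - v x) x = 0" for x
      using v v' by (simp add: curl_diff)
    then obtain f where f: "C_k (Suc 0) f" "\<And>u x. advect u f x = (v' x - v x) \<bullet> u x"
      using poincare_lemma[OF smooth_diff[OF v'(1) v]] by blast
    have "(LBINT x. w x * ((v' x - v x) \<bullet> u x)) = 0"
      using integral_advect_eq_0[OF w u f(1)] by (simp add: f(2))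
    then have "(LBINT x. (v' x \<bullet> u x) * w x - (v x \<bullet> u x) * w x) = 0"
      by (simp add: inner_diff_left algebra_simps)
    then show ?thesis
      using int v v'(1) by simp
  qed
  then show ?thesis
    unfolding vorticity_pair_def using v by (intro the_equality) blast+
qed


section \<open>The fundamental lemma of the calculus of variations\<close>

text \<open>For \<open>p = 1\<close> this is the classical function exp(-1/x) extended by 0. The
  polynomial factor in 1/x is carried along to make the family closed under differentiation.\<close>

definition flat :: "real poly \<Rightarrow> real \<Rightarrow> real" where
  "flat p x = (if x > 0 then poly p (1 / x) * exp (- (1 / x)) else 0)"

lemma tendsto_poly_exp: "((\<lambda>y. poly p y * exp (- y)) \<longlongrightarrow> (0::real)) at_top"
proof -
  have "((\<lambda>y. \<Sum>i\<le>degree p. coeff p i * (y ^ i / exp y)) \<longlongrightarrow> (\<Sum>i\<le>degree p. coeff p i * 0)) at_top"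
    by (intro tendsto_intros tendsto_power_div_exp_0)
  then show ?thesis
    by (simp add: poly_altdef exp_minus divide_inverse sum_distrib_right mult.assoc)
qed

text \<open>With y = 1/x one has dy/dx = - y^2, so the derivative of p(y) exp(-y) is y^2 (p - p')(y)
  exp(-y), a member of the same family.\<close>

lemma has_real_derivative_flat:
  "(flat p has_real_derivative flat (monom 1 2 * (p - pderiv p)) x) (at x)"
proof -
  consider "x > 0" | "x < 0" | "x = 0" by linarith
  then show ?thesis
  proof cases
    case 1
    have "((\<lambda>x. poly p (1 / x) * exp (- (1 / x))) has_real_derivative
        flat (monom 1 2 * (p - pderiv p)) x) (at x)"
      using 1 by (auto intro!: derivative_eq_intros poly_DERIV[THEN DERIV_chain2]
          simp: flat_def poly_monom power2_eq_square field_simps)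
    then show ?thesis
      by (rule has_field_derivative_transform_within_open[of _ _ _ "{0<..}"]) (use 1 in \<open>auto simp: flat_def\<close>)
  next
    case 2
    have "((\<lambda>x. 0) has_real_derivative flat (monom 1 2 * (p - pderiv p)) x) (at x)"
      using 2 by (simp add: flat_def)
    then show ?thesis
      by (rule has_field_derivative_transform_within_open[of _ _ _ "{..<0}"]) (use 2 in \<open>auto simp: flat_def\<close>)
  next
    case 3
    \<comment> \<open>Dividing by \<open>h\<close> multiplies the polynomial in 1/h by one more
      power, and \<open>pCons 0 p\<close> is that multiple; the exponential still dominates
      it.\<close>
    have "((\<lambda>h. poly (pCons 0 p) (inverse h) * exp (- inverse h)) \<longlongrightarrow> 0) (at_right (0::real))"
      by (rule filterlim_compose[OF tendsto_poly_exp filterlim_inverse_at_top_right])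
    then have "((\<lambda>h. flat p h / h) \<longlongrightarrow> 0) (at_right 0)"
      by (rule Lim_transform_eventually)
        (auto simp: eventually_at_right_field flat_def field_simps intro!: exI[of _ 1])
    moreover have "((\<lambda>h. flat p h / h) \<longlongrightarrow> 0) (at_left 0)"
      by (rule Lim_transform_eventually[OF tendsto_const])
        (auto simp: eventually_at_left_field flat_def intro!: exI[of _ "-1"])
    ultimately have "((\<lambda>h. flat p h / h) \<longlongrightarrow> 0) (at 0)"
      by (simp add: filterlim_at_split)
    then show ?thesis
      using 3 by (simp add: DERIV_def flat_def)
  qed
qed

lemma smooth_flat: "smooth (flat p)"
proof -
  have "C_k m (flat p)" for m
  proof (induction m arbitrary: p)
    case 0
    then show ?case
      by (simp add: continuous_on_eq_continuous_at DERIV_isCont[OF has_real_derivative_flat])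
  next
    case (Suc m)
    show ?case
    proof (rule C_k_SucI)
      show "(flat p has_derivative (*) (flat (monom 1 2 * (p - pderiv p)) x)) (at x)" for x
        by (rule has_real_derivative_flat[unfolded has_field_derivative_def])
      show "C_k m (\<lambda>x. flat (monom 1 2 * (p - pderiv p)) x * h)" for h
        by (intro C_k_mult Suc C_k_const)
    qed
  qed
  then show ?thesis
    by (simp add: smooth_def)
qed

section \<open>Bump functions of open boxes\<close>

definition box_bump :: "'a::euclidean_space \<Rightarrow> 'a \<Rightarrow> 'a \<Rightarrow> real" where
  "box_bump a b x = (\<Prod>i\<in>Basis. flat 1 (x \<bullet> i - a \<bullet> i) * flat 1 (b \<bullet> i - x \<bullet> i))"

lemma smooth_box_bump: "smooth (box_bump a b)"
  unfolding box_bump_def[abs_def] by (intro smooth_intros smooth_compose[OF smooth_flat])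

lemma flat_1: "flat 1 x \<ge> 0" "flat 1 x > 0 \<longleftrightarrow> x > 0"
  by (auto simp: flat_def)

lemma box_bump_nonneg: "box_bump a b x \<ge> 0"
  unfolding box_bump_def by (intro prod_nonneg mult_nonneg_nonneg flat_1)

lemma box_bump_pos: "x \<in> box a b \<Longrightarrow> box_bump a b x > 0"
  unfolding box_bump_def by (intro prod_pos mult_pos_pos flat_1(2)[THEN iffD2]) (auto simp: box_def)

lemma box_bump_eq_0: "x \<notin> box a b \<Longrightarrow> box_bump a b x = 0"
  unfolding box_bump_def by (intro prod_zero) (force simp: box_def flat_def not_less)+

text \<open>With b the box bump, the smooth functions n b / (1 + n b) take values in [0, 1], vanish
  off the box and converge to its indicator, so dominated convergence passes from test functions to
  the indicator.\<close>

lemma integral_box_eq_0: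
  fixes d :: "'a::euclidean_space \<Rightarrow> real"
  assumes d: "locally_integrable d"
    and test: "\<And>\<phi>. smooth \<phi> \<Longrightarrow> compactly_supported \<phi> \<Longrightarrow> (LBINT x. d x * \<phi> x) = 0"
  shows "(LBINT x. indicator (box a b) x * d x) = 0"
proof -
  define \<phi> where "\<phi> n x = real n * box_bump a b x / (1 + real n * box_bump a b x)" for n x
  have pos: "1 + real n * box_bump a b x > 0" for n x
    using box_bump_nonneg[of a b x] by (simp add: add_pos_nonneg)
  have \<phi>0: "\<phi> n x = 0" if "x \<notin> box a b" for n x
    using that by (simp add: \<phi>_def box_bump_eq_0)
  have \<phi>1: "\<bar>\<phi> n x\<bar> \<le> 1" for n x
    using pos[of n x] box_bump_nonneg[of a b x] by (simp add: \<phi>_def)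
  have s\<phi>: "smooth (\<phi> n)" for n
    unfolding \<phi>_def[abs_def] using pos by (intro smooth_intros smooth_box_bump) (metis less_irrefl)
  have int: "integrable lborel (\<lambda>x. indicator (cbox a b) x *\<^sub>R d x)"
    using d unfolding locally_integrable_def set_integrable_def by auto
  have eq: "d x * \<phi> n x = (indicator (cbox a b) x *\<^sub>R d x) * \<phi> n x" for n x
    using \<phi>0[of x n] box_subset_cbox by (auto simp: indicator_def)
  have eq': "indicator (box a b) x * d x = (indicator (cbox a b) x *\<^sub>R d x) * indicator (box a b) x" for x
    using box_subset_cbox by (auto simp: indicator_def)
  have "(\<lambda>n. LBINT x. d x * \<phi> n x) \<longlonglongrightarrow> (LBINT x. indicator (box a b) x * d x)"
  proof (rule integral_dominated_convergence)
    show "(\<lambda>x. indicator (box a b) x * d x) \<in> borel_measurable lborel"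
      unfolding eq' using borel_measurable_integrable[OF int] by measurable
    show "(\<lambda>x. d x * \<phi> n x) \<in> borel_measurable lborel" for n
      unfolding eq using borel_measurable_integrable[OF int]
        borel_measurable_continuous_onI[OF smooth_continuous[OF s\<phi>]] by measurable
    show "integrable lborel (\<lambda>x. norm (indicator (cbox a b) x *\<^sub>R d x))"
      using int by (rule integrable_norm)
    show "AE x in lborel. norm (d x * \<phi> n x) \<le> norm (indicator (cbox a b) x *\<^sub>R d x)" for n
      unfolding eq using \<phi>1 by (auto simp: abs_mult mult_left_le)
    have "(\<lambda>n. \<phi> n x) \<longlonglongrightarrow> indicator (box a b) x" for x
    proof (cases "x \<in> box a b")
      case True
      then have "box_bump a b x > 0" by (rule box_bump_pos)
      then have "(\<lambda>n. real n * box_bump a b x / (1 + real n * box_bump a b x)) \<longlonglongrightarrow> 1"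
        by real_asymp
      then show ?thesis using True by (simp add: \<phi>_def)
    qed (simp add: \<phi>0)
    then show "AE x in lborel. (\<lambda>n. d x * \<phi> n x) \<longlonglongrightarrow> indicator (box a b) x * d x"
      by (auto intro!: tendsto_intros simp: mult.commute[of "indicator _ _"])
  qed
  moreover have "(LBINT x. d x * \<phi> n x) = 0" for n
    using \<phi>0 box_subset_cbox by (intro test s\<phi> compactly_supportedI[OF compact_cbox[of a b]]) blast
  ultimately show ?thesis
    by (simp add: LIMSEQ_const_iff)
qed

text \<open>The positive and the negative part of \<open>f\<close> are densities of two measures
  that agree on open boxes. Boxes are stable under intersection and generate the Borel sets, so the
  measures coincide, and so do their densities almost everywhere.\<close>

lemma AE_eq_0_if_box_integrals_eq_0:
  fixes f :: "'a::euclidean_space \<Rightarrow> real"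
  assumes f: "integrable lborel f" and box: "\<And>a b. (LBINT x. indicator (box a b) x * f x) = 0"
  shows "AE x in lborel. f x = 0"
proof -
  have [measurable]: "f \<in> borel_measurable borel"
    using borel_measurable_integrable[OF f] by simp
  let ?M = "density lborel (\<lambda>x. ennreal (f x))" and ?N = "density lborel (\<lambda>x. ennreal (- f x))"
  let ?E = "range (\<lambda>(a, b). box a b :: 'a set)"
  have fin: "emeasure ?M X \<noteq> \<infinity>" "emeasure ?N X \<noteq> \<infinity>"
    and eq: "emeasure ?M X = emeasure ?N X" if X: "X \<in> ?E" for X
  proof -
    from X obtain a b where ab: "X = box a b" by auto
    let ?g = "\<lambda>x. indicator (box a b) x * f x"
    have g: "integrable lborel ?g"
      using integrable_mult_indicator[OF _ f, of "box a b"] by simp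
    have MN: "emeasure ?M X = (\<integral>\<^sup>+x. ennreal (?g x) \<partial>lborel)"
      "emeasure ?N X = (\<integral>\<^sup>+x. ennreal (- ?g x) \<partial>lborel)"
      unfolding ab by (auto simp: emeasure_density indicator_def intro!: nn_integral_cong)
    then show fin: "emeasure ?M X \<noteq> \<infinity>" "emeasure ?N X \<noteq> \<infinity>"
      using g by (simp_all add: real_integrable_def)
    have "enn2real (emeasure ?M X) - enn2real (emeasure ?N X) = 0"
      using real_lebesgue_integral_def[OF g] box[of a b] by (simp only: MN)
    then show "emeasure ?M X = emeasure ?N X"
      using fin by (metis eq_iff_diff_eq_0 ennreal_enn2real_if infinity_ennreal_def)
  qed
  have "?M = ?N"
  proof (rule measure_eqI_generator_eq)
    show "Int_stable ?E"
      by (auto simp: Int_stable_def Int_interval box_Int_box)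
    show "sets ?M = sigma_sets UNIV ?E" "sets ?N = sigma_sets UNIV ?E"
      by (simp_all add: borel_eq_box)
    show "range (\<lambda>i::nat. box (- (real i *\<^sub>R One)) (real i *\<^sub>R One) :: 'a set) \<subseteq> ?E"
      by auto
    show "(\<Union>i::nat. box (- (real i *\<^sub>R One)) (real i *\<^sub>R One) :: 'a set) = UNIV"
      by (rule UN_box_eq_UNIV)
    show "emeasure ?M (box (- (real i *\<^sub>R One)) (real i *\<^sub>R One)) \<noteq> \<infinity>" for i :: nat
      by (rule fin) auto
  qed (use eq in auto)
  then have "AE x in lborel. ennreal (f x) = ennreal (- f x)"
    by (intro sigma_finite_measure.density_unique[OF sigma_finite_lborel]) auto
  \<comment> \<open>\<open>ennreal\<close> truncates negative values to 0, so at each such point one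
    side is 0 and the equation makes the other one 0.\<close>
  then show ?thesis
  proof eventually_elim
    case (elim x)
    then show "f x = 0"
      by (cases "f x \<ge> 0") (simp_all add: ennreal_neg ennreal_eq_0_iff)
  qed
qed

text \<open>As \<open>d\<close> is only locally integrable, it is first cut off by a large box. The
  cut-off function again has vanishing box integrals because two boxes meet in a box, and countably
  many boxes exhaust the space.\<close>

lemma fundamental_lemma_calculus_of_variations:
  fixes d :: "'a::euclidean_space \<Rightarrow> real"
  assumes d: "locally_integrable d"
    and test: "\<And>\<phi>. smooth \<phi> \<Longrightarrow> compactly_supported \<phi> \<Longrightarrow> (LBINT x. d x * \<phi> x) = 0"
  shows "AE x in lborel. d x = 0"
proof -
  let ?B = "\<lambda>n. box (- (real n *\<^sub>R One)) (real n *\<^sub>R One) :: 'a set"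
  have "AE x in lborel. indicator (?B n) x * d x = 0" for n
  proof (rule AE_eq_0_if_box_integrals_eq_0)
    have "integrable lborel (\<lambda>x. indicator (cbox (- (real n *\<^sub>R One)) (real n *\<^sub>R One)) x *\<^sub>R d x)"
      using d unfolding locally_integrable_def set_integrable_def by auto
    from integrable_mult_indicator[OF _ this, of "?B n"]
    have "integrable lborel (\<lambda>x. indicator (?B n) x *\<^sub>R indicator (cbox (- (real n *\<^sub>R One)) (real n *\<^sub>R One)) x *\<^sub>R d x)"
      by simp
    also have "(\<lambda>x. indicator (?B n) x *\<^sub>R indicator (cbox (- (real n *\<^sub>R One)) (real n *\<^sub>R One)) x *\<^sub>R d x) =
        (\<lambda>x. indicator (?B n) x * d x)"
      using box_subset_cbox by (fastforce simp: indicator_def)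
    finally show "integrable lborel (\<lambda>x. indicator (?B n) x * d x)" .
    show "(LBINT x. indicator (box a b) x * (indicator (?B n) x * d x)) = 0" for a b
    proof -
      obtain a' b' where "box a b \<inter> ?B n = box a' b'"
        by (rule that) (rule box_Int_box)
      then have eq: "indicator (box a b) x * (indicator (?B n) x * d x) = indicator (box a' b') x * d x" for x
        by (metis (no_types) indicator_inter_arith mult.assoc)
      show ?thesis
        unfolding eq by (rule integral_box_eq_0[OF assms])
    qed
  qed
  then have "AE x in lborel. \<forall>n. indicator (?B n) x * d x = 0"
    unfolding AE_all_countable ..
  then show ?thesis
  proof eventually_elim
    case (elim x)
    have "x \<in> (\<Union>n. ?B n)" by (simp add: UN_box_eq_UNIV)
    then obtain n where "x \<in> ?B n" by blast
    with elim[rule_format, of n] show ?case by simp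
  qed
qed


section \<open>Matrix Lie groups\<close>

lemma matrix_lie_groupD:
  assumes "matrix_lie_group \<O>"
  shows "mat 1 \<in> \<O>" "A \<in> \<O> \<Longrightarrow> invertible A" "A \<in> \<O> \<Longrightarrow> B \<in> \<O> \<Longrightarrow> A ** B \<in> \<O>"
    "A \<in> \<O> \<Longrightarrow> matrix_inv A \<in> \<O>"
  using assms by (auto simp: matrix_lie_group_def)

lemma lie_algebraI:
  "smooth c \<Longrightarrow> (\<And>t. c t \<in> \<O>) \<Longrightarrow> c 0 = mat 1 \<Longrightarrow> (c has_vector_derivative \<xi>) (at 0) \<Longrightarrow> \<xi> \<in> lie_algebra \<O>"
  unfolding lie_algebra_def by blast

lemma lie_algebraE:
  assumes "\<xi> \<in> lie_algebra \<O>"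
  obtains c where "smooth c" "\<And>t. c t \<in> \<O>" "c 0 = mat 1" "(c has_vector_derivative \<xi>) (at 0)"
  using assms unfolding lie_algebra_def by blast

lemma has_vector_derivative_matrix_mult:
  fixes f :: "real \<Rightarrow> real^'m^'n" and g :: "real \<Rightarrow> real^'p^'m"
  assumes "(f has_vector_derivative f') (at t)" "(g has_vector_derivative g') (at t)"
  shows "((\<lambda>t. f t ** g t) has_vector_derivative f t ** g' + f' ** g t) (at t)"
  by (rule bounded_bilinear.has_vector_derivative[OF bounded_bilinear_matrix_mult assms])

lemma has_vector_derivative_matrix_mult_const:
  fixes A :: "real^'m^'n" and B :: "real^'q^'p"
  assumes "(c has_vector_derivative \<xi>) (at t)"
  shows "((\<lambda>t. A ** c t) has_vector_derivative A ** \<xi>) (at t)"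
    and "((\<lambda>t. c t ** B) has_vector_derivative \<xi> ** B) (at t)"
  using has_vector_derivative_matrix_mult[OF has_vector_derivative_const[of A] assms]
    has_vector_derivative_matrix_mult[OF assms has_vector_derivative_const[of B]] by simp_all

lemma has_vector_derivative_rescale:
  assumes "(c has_vector_derivative \<xi>) (at 0)"
  shows "((\<lambda>t. c (t * r)) has_vector_derivative r *\<^sub>R \<xi>) (at 0)"
proof -
  have "((\<lambda>t. t * r) has_vector_derivative r) (at 0)"
    by (auto intro!: derivative_eq_intros)
  from vector_diff_chain_at[OF this, of c \<xi>] assms show ?thesis
    by (simp add: o_def)
qed

text \<open>The pointwise product of two curves through the identity has the sum of their velocities
  there, and a linear change of time scales the velocity.\<close>

lemma subspace_lie_algebra:
  assumes "matrix_lie_group \<O>"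
  shows "subspace (lie_algebra \<O>)"
  unfolding subspace_def
proof (intro conjI ballI allI)
  note \<O> = matrix_lie_groupD[OF assms]
  show "0 \<in> lie_algebra \<O>"
    by (rule lie_algebraI[of "\<lambda>_. mat 1"]) (simp_all add: \<O> smooth_intros)
next
  note \<O> = matrix_lie_groupD[OF assms]
  fix x y assume "x \<in> lie_algebra \<O>" "y \<in> lie_algebra \<O>"
  then obtain c d where c: "smooth c" "\<And>t. c t \<in> \<O>" "c 0 = mat 1" "(c has_vector_derivative x) (at 0)"
    and d: "smooth d" "\<And>t. d t \<in> \<O>" "d 0 = mat 1" "(d has_vector_derivative y) (at 0)"
    by (metis lie_algebraE)
  have "((\<lambda>t. c t ** d t) has_vector_derivative x + y) (at 0)"
    using has_vector_derivative_matrix_mult[OF c(4) d(4)] by (simp add: c d add.commute)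
  then show "x + y \<in> lie_algebra \<O>"
    by (rule lie_algebraI[rotated 3]) (use c d \<O> in \<open>auto intro!: smooth_intros\<close>)
next
  fix r x assume "x \<in> lie_algebra \<O>"
  then obtain c where c: "smooth c" "\<And>t. c t \<in> \<O>" "c 0 = mat 1" "(c has_vector_derivative x) (at 0)"
    by (rule lie_algebraE) blast
  from has_vector_derivative_rescale[OF c(4)] show "r *\<^sub>R x \<in> lie_algebra \<O>"
    by (rule lie_algebraI[rotated 3]) (use c in \<open>auto intro!: smooth_intros smooth_compose[OF c(1)]\<close>)
qed

lemma Ad_in_lie_algebra:
  assumes "matrix_lie_group \<O>" "\<theta> \<in> \<O>" "\<xi> \<in> lie_algebra \<O>"
  shows "Ad \<theta> \<xi> \<in> lie_algebra \<O>"
proof -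
  note \<O> = matrix_lie_groupD[OF assms(1)]
  from assms(3) obtain c where c: "smooth c" "\<And>t. c t \<in> \<O>" "c 0 = mat 1" "(c has_vector_derivative \<xi>) (at 0)"
    by (rule lie_algebraE) blast
  have "((\<lambda>t. \<theta> ** c t ** matrix_inv \<theta>) has_vector_derivative Ad \<theta> \<xi>) (at 0)"
    unfolding Ad_def by (intro has_vector_derivative_matrix_mult_const c(4))
  then show ?thesis
    by (rule lie_algebraI[rotated 3])
      (use c \<O> assms(2) in \<open>auto intro!: smooth_intros simp: matrix_inv_right\<close>)
qed

text \<open>Moving along a line through \<open>x\<close> and translating back by the inverse of
  \<theta> x from the right gives a curve in the group through the identity.\<close>

lemma logarithmic_derivative_in_lie_algebra:
  fixes \<theta> :: "'a::euclidean_space \<Rightarrow> real^'n^'n"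
  assumes "matrix_lie_group \<O>" and \<theta>: "smooth \<theta>" "\<And>x. \<theta> x \<in> \<O>"
  shows "frechet_derivative \<theta> (at x) h ** matrix_inv (\<theta> x) \<in> lie_algebra \<O>"
proof -
  note \<O> = matrix_lie_groupD[OF assms(1)]
  have "((\<lambda>t. \<theta> (x + t *\<^sub>R h)) has_vector_derivative frechet_derivative \<theta> (at (x + 0 *\<^sub>R h)) h) (at 0)"
    by (rule has_vector_derivative_line[OF smooth_has_derivative[OF \<theta>(1)]])
  then have "((\<lambda>t. \<theta> (x + t *\<^sub>R h) ** matrix_inv (\<theta> x)) has_vector_derivative
      frechet_derivative \<theta> (at x) h ** matrix_inv (\<theta> x)) (at 0)"
    using has_vector_derivative_matrix_mult_const(2) by fastforce
  then show ?thesis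
    by (rule lie_algebraI[rotated 3])
      (use \<O> \<theta>(2) in \<open>auto intro!: smooth_intros smooth_compose[OF \<theta>(1)] simp: matrix_inv_right\<close>)
qed

section \<open>Orthonormal bases of subspaces\<close>

definition orthonormal_basis :: "'a::euclidean_space set \<Rightarrow> 'a set \<Rightarrow> bool" where
  "orthonormal_basis B S \<longleftrightarrow>
     finite B \<and> span B = S \<and> (\<forall>b\<in>B. \<forall>b'\<in>B. b \<bullet> b' = (if b = b' then 1 else 0))"

lemma orthonormal_basis_exists:
  assumes "subspace S"
  obtains B where "orthonormal_basis B S"
proof -
  obtain B where B: "B \<subseteq> S" "pairwise orthogonal B" "\<And>x. x \<in> B \<Longrightarrow> norm x = 1" "independent B"
      "card B = dim S" "span B = S"
    using orthonormal_basis_subspace[OF assms] by blast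
  have "b \<bullet> b' = (if b = b' then 1 else 0)" if "b \<in> B" "b' \<in> B" for b b'
  proof (cases "b = b'")
    case True
    then show ?thesis using B(3)[OF that(1)] by (simp add: norm_eq_1)
  next
    case False
    then show ?thesis using B(2) that by (simp add: pairwise_def orthogonal_def)
  qed
  then show ?thesis
    using B(4,6) by (intro that[of B]) (simp add: orthonormal_basis_def independent_imp_finite)
qed

text \<open>Riesz representation on the subspace: the sum is the vector that represents
  \<open>L\<close> there.\<close>

lemma orthonormal_expansion:
  assumes B: "orthonormal_basis B S" and x: "x \<in> S" and L: "linear L"
  shows "(\<Sum>b\<in>B. L b *\<^sub>R b) \<bullet> x = L x"
proof (rule linear_eq_on_span[OF _ L])
  show "linear ((\<bullet>) (\<Sum>b\<in>B. L b *\<^sub>R b))"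
    by (rule bounded_linear.linear[OF bounded_linear_inner_right])
  show "x \<in> span B"
    using B x by (simp add: orthonormal_basis_def)
  show "(\<Sum>b\<in>B. L b *\<^sub>R b) \<bullet> b' = L b'" if "b' \<in> B" for b'
  proof -
    have "(\<Sum>b\<in>B. L b *\<^sub>R b) \<bullet> b' = (\<Sum>b\<in>B. if b = b' then L b else 0)"
      unfolding inner_sum_left using B that by (intro sum.cong) (auto simp: orthonormal_basis_def)
    also have "\<dots> = L b'"
      using B that by (simp add: orthonormal_basis_def)
    finally show ?thesis .
  qed
qed

lemma eq_if_inner_eq_on_subspace:
  assumes "subspace S" "x \<in> S" "y \<in> S" "\<And>v. v \<in> S \<Longrightarrow> x \<bullet> v = y \<bullet> v"
  shows "x = y"
proof -
  have "(x - y) \<bullet> (x - y) = 0"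
    using assms(4)[OF subspace_diff[OF assms(1-3)]] by (simp add: inner_diff_left)
  then show ?thesis by simp
qed

lemma orthonormal_basis_sum_in:
  assumes "orthonormal_basis B S"
  shows "(\<Sum>b\<in>B. f b *\<^sub>R b) \<in> S"
proof -
  have "(\<Sum>b\<in>B. f b *\<^sub>R b) \<in> span B"
    by (intro span_sum span_scale span_base)
  then show ?thesis
    using assms by (simp add: orthonormal_basis_def)
qed

lemma orthonormal_representation:
  assumes B: "orthonormal_basis B S" and x: "x \<in> S"
  shows "(\<Sum>b\<in>B. (x \<bullet> b) *\<^sub>R b) = x"
proof (rule eq_if_inner_eq_on_subspace[OF _ orthonormal_basis_sum_in[OF B] x])
  show "subspace S"
    using B subspace_span unfolding orthonormal_basis_def by blast
  show "(\<Sum>b\<in>B. (x \<bullet> b) *\<^sub>R b) \<bullet> v = x \<bullet> v" if "v \<in> S" for v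
    by (rule orthonormal_expansion[OF B that bounded_linear.linear[OF bounded_linear_inner_right]])
qed

section \<open>The adjoint and coadjoint actions\<close>

lemma linear_Ad: "linear (Ad \<theta>)"
  unfolding Ad_def
  by (intro bounded_linear.linear bounded_linear_compose[OF
        bounded_bilinear.bounded_linear_left[OF bounded_bilinear_matrix_mult]
        bounded_bilinear.bounded_linear_right[OF bounded_bilinear_matrix_mult]])

text \<open>The sum is the Riesz representative of the functional defining \<open>coAd\<close>; it
  is the only one in the Lie algebra because the inner product is definite there, which resolves the
  \<open>THE\<close>. The explicit sum later shows that \<open>coAd\<close> depends smoothly on
  \<theta> and \<sigma>.\<close>

lemma
  fixes \<O> :: "(real^'n^'n) set"
  assumes \<O>: "matrix_lie_group \<O>" and B: "orthonormal_basis B (lie_algebra \<O>)"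
  shows coAd_eq_sum: "coAd \<O> \<theta> \<sigma> = (\<Sum>b\<in>B. (\<sigma> \<bullet> Ad \<theta> b) *\<^sub>R b)"
    and coAd_inner_basis: "\<xi> \<in> lie_algebra \<O> \<Longrightarrow> coAd \<O> \<theta> \<sigma> \<bullet> \<xi> = \<sigma> \<bullet> Ad \<theta> \<xi>"
proof -
  let ?\<tau> = "\<Sum>b\<in>B. (\<sigma> \<bullet> Ad \<theta> b) *\<^sub>R b"
  have \<tau>: "?\<tau> \<in> lie_algebra \<O>"
    by (rule orthonormal_basis_sum_in[OF B])
  have lin: "linear (\<lambda>\<xi>. \<sigma> \<bullet> Ad \<theta> \<xi>)"
    using linear_compose[OF linear_Ad bounded_linear.linear[OF bounded_linear_inner_right]] by (simp add: o_def)
  have eq: "?\<tau> \<bullet> \<xi> = \<sigma> \<bullet> Ad \<theta> \<xi>" if "\<xi> \<in> lie_algebra \<O>" for \<xi>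
    by (rule orthonormal_expansion[OF B that lin])
  show *: "coAd \<O> \<theta> \<sigma> = ?\<tau>"
    unfolding coAd_def tr_pair_eq_inner
  proof (rule the_equality)
    show "?\<tau> \<in> lie_algebra \<O> \<and> (\<forall>\<zeta>\<in>lie_algebra \<O>. ?\<tau> \<bullet> \<zeta> = \<sigma> \<bullet> Ad \<theta> \<zeta>)"
      using \<tau> eq by blast
    show "\<tau>' = ?\<tau>" if "\<tau>' \<in> lie_algebra \<O> \<and> (\<forall>\<zeta>\<in>lie_algebra \<O>. \<tau>' \<bullet> \<zeta> = \<sigma> \<bullet> Ad \<theta> \<zeta>)" for \<tau>'
      using that eq by (intro eq_if_inner_eq_on_subspace[OF subspace_lie_algebra[OF \<O>] _ \<tau>]) auto
  qed
  show "coAd \<O> \<theta> \<sigma> \<bullet> \<xi> = \<sigma> \<bullet> Ad \<theta> \<xi>" if "\<xi> \<in> lie_algebra \<O>" for \<xi>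
    unfolding * by (rule eq[OF that])
qed

lemma coAd_inner:
  fixes \<O> :: "(real^'n^'n) set"
  assumes "matrix_lie_group \<O>" "\<xi> \<in> lie_algebra \<O>"
  shows "coAd \<O> \<theta> \<sigma> \<bullet> \<xi> = \<sigma> \<bullet> Ad \<theta> \<xi>"
  using orthonormal_basis_exists[OF subspace_lie_algebra[OF assms(1)]]
    coAd_inner_basis[OF assms(1) _ assms(2)] by blast

lemma coAd_in_lie_algebra:
  fixes \<O> :: "(real^'n^'n) set"
  assumes "matrix_lie_group \<O>"
  shows "coAd \<O> \<theta> \<sigma> \<in> lie_algebra \<O>"
proof -
  obtain B where B: "orthonormal_basis B (lie_algebra \<O>)"
    using orthonormal_basis_exists[OF subspace_lie_algebra[OF assms]] .
  show ?thesis
    unfolding coAd_eq_sum[OF assms B] by (rule orthonormal_basis_sum_in[OF B])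
qed

lemma smooth_coAd:
  fixes \<O> :: "(real^'n^'n) set"
  assumes \<O>: "matrix_lie_group \<O>" and \<theta>: "smooth \<theta>" "\<And>x. \<theta> x \<in> \<O>" and \<sigma>: "smooth \<sigma>"
  shows "smooth (\<lambda>x. coAd \<O> (\<theta> x) (\<sigma> x))"
proof -
  obtain B where B: "orthonormal_basis B (lie_algebra \<O>)"
    using orthonormal_basis_exists[OF subspace_lie_algebra[OF \<O>]] .
  have "smooth (\<lambda>x. \<Sum>b\<in>B. (\<sigma> x \<bullet> Ad (\<theta> x) b) *\<^sub>R b)"
    unfolding Ad_def using matrix_lie_groupD(2)[OF \<O>] \<theta>(2) by (intro smooth_intros \<sigma> \<theta>(1)) auto
  then show ?thesis
    by (simp add: coAd_eq_sum[OF \<O> B])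
qed

text \<open>A product of the curves \<open>c\<^sub>b\<close> through the identity with velocities \<open>b\<close>, run with speeds \<open>\<zeta> x \<bullet> b\<close>,
  replaces the exponential map.\<close>
lemma group_curve_exists:
  fixes \<O> :: "(real^'n^'n) set" and \<zeta> :: "'a::euclidean_space \<Rightarrow> real^'n^'n"
  assumes \<O>: "matrix_lie_group \<O>" and \<zeta>: "smooth \<zeta>" "\<And>x. \<zeta> x \<in> lie_algebra \<O>"
  obtains g :: "real \<Rightarrow> 'a \<Rightarrow> real^'n^'n" where "smooth (\<lambda>p. g (fst p) (snd p))" "\<And>t x. g t x \<in> \<O>" "\<And>x. g 0 x = mat 1"
    "\<And>x. ((\<lambda>t. g t x) has_vector_derivative \<zeta> x) (at 0)" "\<And>t x. \<zeta> x = 0 \<Longrightarrow> g t x = mat 1"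
proof -
  note G = matrix_lie_groupD[OF \<O>]
  obtain B where B: "orthonormal_basis B (lie_algebra \<O>)"
    using orthonormal_basis_exists[OF subspace_lie_algebra[OF \<O>]] .
  have "\<exists>g. smooth (\<lambda>p. g (fst p) (snd p)) \<and> (\<forall>t x. g t x \<in> \<O>) \<and> (\<forall>x. g 0 x = mat 1) \<and>
      (\<forall>x. ((\<lambda>t. g t x) has_vector_derivative (\<Sum>b\<in>A. (\<zeta> x \<bullet> b) *\<^sub>R b)) (at 0)) \<and>
      (\<forall>t x. \<zeta> x = 0 \<longrightarrow> g t x = mat 1)" if "finite A" "A \<subseteq> lie_algebra \<O>" for A
    using that
  proof (induction A)
    case empty
    show ?case
      by (rule exI[of _ "\<lambda>t x. mat 1"]) (auto intro: smooth_intros G)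
  next
    case (insert b A)
    then obtain g where g: "smooth (\<lambda>p. g (fst p) (snd p))" "\<And>t x. g t x \<in> \<O>" "\<And>x. g 0 x = mat 1"
      "\<And>x. ((\<lambda>t. g t x) has_vector_derivative (\<Sum>b\<in>A. (\<zeta> x \<bullet> b) *\<^sub>R b)) (at 0)"
      "\<And>t x. \<zeta> x = 0 \<Longrightarrow> g t x = mat 1" by auto
    have "b \<in> lie_algebra \<O>" using insert.prems by simp
    then obtain c where c: "smooth c" "\<And>t. c t \<in> \<O>" "c 0 = mat 1" "(c has_vector_derivative b) (at 0)"
      by (rule lie_algebraE) blast
    \<comment> \<open>Where \<zeta> vanishes, the new factor stays at \<open>c 0\<close> for all
      times, so the curve is trivial off the support of \<zeta>.\<close>
    let ?g = "\<lambda>t x. c (t * (\<zeta> x \<bullet> b)) ** g t x"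
    show ?case
    proof (rule exI[of _ ?g], intro conjI allI impI)
      show "smooth (\<lambda>p. ?g (fst p) (snd p))"
        by (intro smooth_intros smooth_compose[OF c(1)] smooth_compose[OF \<zeta>(1)] g(1))
      show "?g t x \<in> \<O>" for t x by (intro G(3) c g)
      show "?g 0 x = mat 1" for x by (simp add: c g)
      show "?g t x = mat 1" if "\<zeta> x = 0" for t x using that by (simp add: c g)
      have "((\<lambda>t. ?g t x) has_vector_derivative
          c (0 * (\<zeta> x \<bullet> b)) ** (\<Sum>b\<in>A. (\<zeta> x \<bullet> b) *\<^sub>R b) + ((\<zeta> x \<bullet> b) *\<^sub>R b) ** g 0 x) (at 0)" for x
        by (intro has_vector_derivative_matrix_mult has_vector_derivative_rescale c(4) g(4))
      then show "((\<lambda>t. ?g t x) has_vector_derivative (\<Sum>b\<in>insert b A. (\<zeta> x \<bullet> b) *\<^sub>R b)) (at 0)" for x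
        using insert.hyps by (simp add: c g add.commute)
    qed
  qed
  moreover have "finite B" "B \<subseteq> lie_algebra \<O>"
    using B span_superset unfolding orthonormal_basis_def by auto
  ultimately obtain g where g: "smooth (\<lambda>p. g (fst p) (snd p))" "\<And>t x. g t x \<in> \<O>" "\<And>x. g 0 x = mat 1"
      "\<And>x. ((\<lambda>t. g t x) has_vector_derivative (\<Sum>b\<in>B. (\<zeta> x \<bullet> b) *\<^sub>R b)) (at 0)"
      "\<And>t x. \<zeta> x = 0 \<Longrightarrow> g t x = mat 1" by meson
  moreover have "(\<Sum>b\<in>B. (\<zeta> x \<bullet> b) *\<^sub>R b) = \<zeta> x" for x
    by (rule orthonormal_representation[OF B \<zeta>(2)])
  ultimately show ?thesis
    by (intro that[of g]) auto
qed


section \<open>Perturbations of embeddings\<close>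

text \<open>The mean value inequality is applied to \<open>f\<close> minus its linearisation at
  \<open>x\<close>, whose derivative is small near \<open>x\<close> by continuity of the derivative.
  Both end points may vary, as needed for the sequences of pairs in
  \<open>embedding_dominates\<close>.\<close>

lemma smooth_strictly_differentiable:
  fixes f :: "'a::euclidean_space \<Rightarrow> 'b::euclidean_space"
  assumes f: "smooth f" and "e > 0"
  obtains d where "d > 0" "\<And>a b. a \<in> ball x d \<Longrightarrow> b \<in> ball x d \<Longrightarrow>
    norm (f a - f b - frechet_derivative f (at x) (a - b)) \<le> e * norm (a - b)"
proof -
  let ?D = "\<lambda>y. frechet_derivative f (at y)"
  \<comment> \<open>Smoothness gives continuity of each directional derivative. \<open>S y\<close>
    collects the finitely many basis directions and bounds the operator norm of the difference of
    the derivatives at \<open>y\<close> and \<open>x\<close>.\<close>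
  define S where "S y = (\<Sum>i\<in>Basis. norm (?D y i - ?D x i))" for y
  note fD = smooth_has_derivative[OF f]
  have "isCont S x"
    unfolding S_def[abs_def] using smooth_continuous[OF smooth_frechet_derivative[OF f]]
    by (auto simp: continuous_on_eq_continuous_at intro!: continuous_intros)
  moreover have "S x = 0" by (simp add: S_def)
  ultimately obtain d where "d > 0" and d: "\<And>y. dist y x < d \<Longrightarrow> S y < e"
    using \<open>e > 0\<close> unfolding continuous_at_eps_delta by (metis abs_ge_self dist_real_def diff_zero le_less_trans)
  have "norm ((f a - ?D x a) - (f b - ?D x b)) \<le> e * norm (a - b)" if ab: "a \<in> ball x d" "b \<in> ball x d" for a b
  proof (rule differentiable_bound[of "ball x d" "\<lambda>y. f y - ?D x y" "\<lambda>y h. ?D y h - ?D x h"])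
    show "((\<lambda>y. f y - ?D x y) has_derivative (\<lambda>h. ?D y h - ?D x h)) (at y within ball x d)" for y
      by (intro has_derivative_diff has_derivative_at_withinI[OF fD]
          bounded_linear_imp_has_derivative has_derivative_bounded_linear[OF fD])
    fix y assume y: "y \<in> ball x d"
    show "onorm (\<lambda>h. ?D y h - ?D x h) \<le> e"
    proof (rule onorm_le)
      fix h
      have "?D y h - ?D x h = (\<Sum>i\<in>Basis. (h \<bullet> i) *\<^sub>R (?D y i - ?D x i))"
        unfolding scaleR_diff_right sum_subtractf has_derivative_Basis_expand[OF fD, symmetric] ..
      also have "norm \<dots> \<le> (\<Sum>i\<in>Basis. norm h * norm (?D y i - ?D x i))"
        by (rule sum_norm_le) (simp add: Basis_le_norm mult_right_mono)
      also have "\<dots> = norm h * S y"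
        by (simp add: S_def sum_distrib_left)
      also have "\<dots> \<le> e * norm h"
        using mult_right_mono[of "S y" e "norm h"] d[of y] y by (simp add: dist_commute mult.commute)
      finally show "norm (?D y h - ?D x h) \<le> e * norm h" .
    qed
  qed (use ab in auto)
  moreover have "(f a - ?D x a) - (f b - ?D x b) = f a - f b - ?D x (a - b)" for a b
    using linear_diff[OF has_derivative_linear[OF fD]] by simp
  ultimately show ?thesis
    using that[OF \<open>d > 0\<close>] by simp
qed

lemma smooth_locally_lipschitz:
  fixes f :: "'a::euclidean_space \<Rightarrow> 'b::euclidean_space"
  assumes f: "smooth f"
  obtains d L where "d > 0" "L > 0" "\<And>a b. a \<in> ball x d \<Longrightarrow> b \<in> ball x d \<Longrightarrow> norm (f a - f b) \<le> L * norm (a - b)"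
proof -
  let ?D = "frechet_derivative f (at x)"
  obtain d where d: "d > 0" "\<And>a b. a \<in> ball x d \<Longrightarrow> b \<in> ball x d \<Longrightarrow> norm (f a - f b - ?D (a - b)) \<le> 1 * norm (a - b)"
    using smooth_strictly_differentiable[OF f zero_less_one] by metis
  obtain B where B: "B > 0" "\<And>h. norm (?D h) \<le> B * norm h"
    using linear_bounded_pos[OF has_derivative_linear[OF smooth_has_derivative[OF f]]] by metis
  show ?thesis
  proof (rule that[of d "1 + B"])
    fix a b assume "a \<in> ball x d" "b \<in> ball x d"
    then have "norm (f a - f b - ?D (a - b)) \<le> 1 * norm (a - b)" by (rule d(2))
    then show "norm (f a - f b) \<le> (1 + B) * norm (a - b)"
      using B(2)[of "a - b"] norm_triangle_sub[of "f a - f b" "?D (a - b)"] by (simp add: distrib_right)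
  qed (use d B in auto)
qed

text \<open>An injective linear map on a finite-dimensional space expands lengths by at least some B
  > 0; a linearisation error of at most B/2 leaves B/2.\<close>

lemma immersion_locally_bounded_below:
  fixes f :: "'a::euclidean_space \<Rightarrow> 'b::euclidean_space"
  assumes f: "smooth f" and inj: "inj (frechet_derivative f (at x))"
  obtains d m where "d > 0" "m > 0" "\<And>a b. a \<in> ball x d \<Longrightarrow> b \<in> ball x d \<Longrightarrow> m * norm (a - b) \<le> norm (f a - f b)"
proof -
  let ?D = "frechet_derivative f (at x)"
  obtain B where B: "B > 0" "\<And>h. B * norm h \<le> norm (?D h)"
    using linear_inj_bounded_below_pos[OF has_derivative_linear[OF smooth_has_derivative[OF f]] inj] by metis
  then have "B / 2 > 0" by simp
  from smooth_strictly_differentiable[OF f this, of x] obtain d where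
    d: "d > 0" "\<And>a b. a \<in> ball x d \<Longrightarrow> b \<in> ball x d \<Longrightarrow> norm (f a - f b - ?D (a - b)) \<le> B / 2 * norm (a - b)"
    by metis
  show ?thesis
  proof (rule that[of d "B / 2"])
    fix a b assume "a \<in> ball x d" "b \<in> ball x d"
    then have "norm (f a - f b - ?D (a - b)) \<le> B / 2 * norm (a - b)" by (rule d(2))
    moreover have "norm (?D (a - b)) \<le> norm (f a - f b) + norm (f a - f b - ?D (a - b))"
      using norm_triangle_sub[of "?D (a - b)" "f a - f b"] by (simp add: norm_minus_commute)
    ultimately show "B / 2 * norm (a - b) \<le> norm (f a - f b)"
      using B(2)[of "a - b"] by simp
  qed (use d B in auto)
qed

text \<open>If the bound failed, a sequence of bad pairs would accumulate at a point of the diagonal, since the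
  inverse of \<open>f\<close> is continuous; there \<open>f\<close> is bounded below because it is an immersion.\<close>
lemma embedding_dominates:
  fixes f :: "real^3 \<Rightarrow> 'b::euclidean_space" and p :: "real^3 \<Rightarrow> 'c::euclidean_space"
  assumes f: "smooth_embedding f" and p: "smooth p" "compactly_supported p"
  obtains C where "C > 0" "\<And>x y. norm (p x - p y) \<le> C * norm (f x - f y)"
proof (rule ccontr)
  assume "\<not> thesis"
  with that have neg: "\<exists>x y. norm (p x - p y) > C * norm (f x - f y)" if "C > 0" for C
    using \<open>C > 0\<close> not_le by blast
  from f obtain g where sf: "smooth f" and inj: "\<And>x. inj (frechet_derivative f (at x))"
    and g: "homeomorphism UNIV (range f) f g"
    unfolding smooth_embedding_def by blast
  from p(2) obtain K where K: "compact K" "\<And>x. x \<notin> K \<Longrightarrow> p x = 0"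
    unfolding compactly_supported_def by blast
  \<comment> \<open>Off \<open>K\<close> the map \<open>p\<close> vanishes, so at least one point of
    a bad pair lies in \<open>K\<close>; the inequality is symmetric, so it may be taken as the
    first one.\<close>
  have "\<exists>x y. x \<in> K \<and> norm (p x - p y) > real (Suc n) * norm (f x - f y)" for n
  proof -
    from neg[of "real (Suc n)"] obtain x y where xy: "norm (p x - p y) > real (Suc n) * norm (f x - f y)"
      by auto
    show ?thesis
    proof (cases "x \<in> K")
      case False
      have "y \<in> K"
      proof (rule ccontr)
        assume "y \<notin> K"
        with False K(2) have "norm (p x - p y) = 0" by simp
        with xy have "real (Suc n) * norm (f x - f y) < 0" by linarith
        then show False by (simp add: mult_less_0_iff)
      qed
      with xy show ?thesis by (metis norm_minus_commute)
    qed (use xy in blast)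
  qed
  then obtain X Y where X: "\<And>n. X n \<in> K" and XY: "\<And>n. norm (p (X n) - p (Y n)) > real (Suc n) * norm (f (X n) - f (Y n))"
    by metis
  obtain l r where "l \<in> K" and r: "strict_mono r" and l: "(X \<circ> r) \<longlonglongrightarrow> l"
    using K(1) X unfolding compact_def by blast
  obtain M where M: "\<And>x. norm (p x) \<le> M"
  proof -
    have "bounded (p ` K)"
      by (intro compact_imp_bounded compact_continuous_image smooth_continuous_on p(1) K(1))
    then obtain M where "\<And>x. x \<in> K \<Longrightarrow> norm (p x) \<le> M" "M > 0"
      by (metis bounded_pos imageI)
    then show ?thesis
      using K(2) by (intro that[of M]) (metis less_imp_le norm_zero)
  qed
  have fX: "(\<lambda>n. f (X (r n))) \<longlonglongrightarrow> f l"
    using l continuous_on_tendsto_compose[OF smooth_continuous[OF sf] l] by (simp add: o_def)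
  \<comment> \<open>The left side of the bad inequality is at most 2 M, so its growing factor forces
    the images under \<open>f\<close> together. Continuity of the inverse then makes the second
    points converge to \<open>l\<close> as well.\<close>
  have "(\<lambda>n. norm (f (Y (r n)) - f (X (r n)))) \<longlonglongrightarrow> 0"
  proof (rule tendsto_sandwich[OF _ _ tendsto_const])
    have "(\<lambda>n. 2 * M * inverse (real (Suc n))) \<longlonglongrightarrow> 2 * M * 0"
      by (intro tendsto_intros LIMSEQ_inverse_real_of_nat)
    then show "(\<lambda>n. 2 * M * inverse (real (Suc n))) \<longlonglongrightarrow> 0" by simp
    show "eventually (\<lambda>n. norm (f (Y (r n)) - f (X (r n))) \<le> 2 * M * inverse (real (Suc n))) sequentially"
    proof (rule always_eventually, rule allI)
      fix n
      have "real (Suc n) * norm (f (Y (r n)) - f (X (r n))) \<le> real (Suc (r n)) * norm (f (X (r n)) - f (Y (r n)))"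
        using seq_suble[OF r, of n] by (simp add: norm_minus_commute mult_right_mono)
      also have "\<dots> \<le> norm (p (X (r n)) - p (Y (r n)))"
        using XY[of "r n"] by linarith
      also have "\<dots> \<le> 2 * M"
        using M[of "X (r n)"] M[of "Y (r n)"] norm_triangle_ineq4[of "p (X (r n))" "p (Y (r n))"] by linarith
      finally show "norm (f (Y (r n)) - f (X (r n))) \<le> 2 * M * inverse (real (Suc n))"
        by (simp add: field_simps)
    qed
  qed simp
  then have "(\<lambda>n. f (Y (r n)) - f (X (r n))) \<longlonglongrightarrow> 0"
    by (rule tendsto_norm_zero_cancel)
  from tendsto_add[OF this fX] have fY: "(\<lambda>n. f (Y (r n))) \<longlonglongrightarrow> f l"
    by simp
  have "(\<lambda>n. g (f (Y (r n)))) \<longlonglongrightarrow> g (f l)"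
    using g by (intro continuous_on_tendsto_compose[OF _ fY]) (auto simp: homeomorphism_def)
  then have Y: "(\<lambda>n. Y (r n)) \<longlonglongrightarrow> l"
    using g by (simp add: homeomorphism_def)
  obtain d1 m where d1: "d1 > 0" "m > 0" "\<And>a b. a \<in> ball l d1 \<Longrightarrow> b \<in> ball l d1 \<Longrightarrow> m * norm (a - b) \<le> norm (f a - f b)"
    using immersion_locally_bounded_below[OF sf inj[of l]] by metis
  obtain d2 L where d2: "d2 > 0" "L > 0" "\<And>a b. a \<in> ball l d2 \<Longrightarrow> b \<in> ball l d2 \<Longrightarrow> norm (p a - p b) \<le> L * norm (a - b)"
    using smooth_locally_lipschitz[OF p(1), of l] by metis
  have "eventually (\<lambda>n. dist (X (r n)) l < min d1 d2) sequentially" "eventually (\<lambda>n. dist (Y (r n)) l < min d1 d2) sequentially"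
    using tendstoD[OF l, of "min d1 d2"] tendstoD[OF Y, of "min d1 d2"] d1(1) d2(1) by (simp_all add: o_def)
  \<comment> \<open>Beyond this index the factor \<open>real (Suc (r n))\<close> times the lower
    constant \<open>m\<close> of \<open>f\<close> exceeds or equals the Lipschitz constant
    \<open>L\<close> of \<open>p\<close>, against the choice of the pairs.\<close>
  moreover have "eventually (\<lambda>n. n \<ge> nat \<lceil>L / m\<rceil>) sequentially"
    by (rule eventually_ge_at_top)
  ultimately have "eventually (\<lambda>n. False) sequentially"
  proof eventually_elim
    case (elim n)
    let ?x = "X (r n)" and ?y = "Y (r n)"
    have xy: "?x \<in> ball l d1" "?y \<in> ball l d1" "?x \<in> ball l d2" "?y \<in> ball l d2"
      using elim(1,2) by (auto simp: dist_commute)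
    have "L / m \<le> real n"
      using elim(3) by linarith
    also have "\<dots> \<le> real (Suc (r n))"
      using seq_suble[OF r, of n] by simp
    finally have "L \<le> real (Suc (r n)) * m"
      using d1(2) by (simp add: field_simps)
    then have "L * norm (?x - ?y) \<le> real (Suc (r n)) * m * norm (?x - ?y)"
      by (rule mult_right_mono) simp
    also have "\<dots> \<le> real (Suc (r n)) * norm (f ?x - f ?y)"
      using d1(3)[OF xy(1,2)] by (simp add: mult.assoc mult_left_mono)
    also have "\<dots> < norm (p ?x - p ?y)" by (rule XY)
    also have "\<dots> \<le> L * norm (?x - ?y)" by (rule d2(3)[OF xy(3,4)])
    finally show False by simp
  qed
  then show False by simp
qed

text \<open>Divide the inequality between increments by \<open>s\<close> and let \<open>s\<close>
  tend to 0. It carries the domination over to the derivatives, as needed for the immersion property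
  of a perturbed embedding.\<close>

lemma norm_frechet_derivative_le:
  fixes f :: "'a::euclidean_space \<Rightarrow> 'b::euclidean_space" and p :: "'a \<Rightarrow> 'c::euclidean_space"
  assumes f: "smooth f" and p: "smooth p" and le: "\<And>x y. norm (p x - p y) \<le> C * norm (f x - f y)"
  shows "norm (frechet_derivative p (at x) h) \<le> C * norm (frechet_derivative f (at x) h)"
proof -
  have lim: "((\<lambda>s. (q (x + s *\<^sub>R h) - q x) /\<^sub>R s) \<longlongrightarrow> frechet_derivative q (at x) h) (at 0)"
    if "smooth q" for q :: "'a \<Rightarrow> 'd::euclidean_space"
  proof -
    have "((\<lambda>s. q (x + s *\<^sub>R h)) has_vector_derivative frechet_derivative q (at (x + 0 *\<^sub>R h)) h) (at 0)"
      by (rule has_vector_derivative_line[OF smooth_has_derivative[OF that]])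
    then have lim0: "((\<lambda>s. norm (q (x + s *\<^sub>R h) - q x - s *\<^sub>R frechet_derivative q (at x) h) / norm s) \<longlongrightarrow> 0) (at 0)"
      by (simp add: has_vector_derivative_def has_derivative_at)
    have eq: "norm ((q (x + s *\<^sub>R h) - q x) /\<^sub>R s - frechet_derivative q (at x) h) =
        norm (q (x + s *\<^sub>R h) - q x - s *\<^sub>R frechet_derivative q (at x) h) / norm s" if "s \<noteq> 0" for s
    proof -
      have "(q (x + s *\<^sub>R h) - q x) /\<^sub>R s - frechet_derivative q (at x) h =
          (q (x + s *\<^sub>R h) - q x - s *\<^sub>R frechet_derivative q (at x) h) /\<^sub>R s"
        using that by (simp add: scaleR_diff_right)
      then show ?thesis
        by (simp add: divide_inverse mult.commute)
    qed
    have "((\<lambda>s. (q (x + s *\<^sub>R h) - q x) /\<^sub>R s - frechet_derivative q (at x) h) \<longlongrightarrow> 0) (at 0)"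
      by (rule Lim_null_comparison[OF eventually_mono[OF eventually_neq_at_within eq_refl[OF eq]] lim0])
    then show ?thesis
      by (simp add: LIM_zero_iff)
  qed
  have "norm ((p (x + s *\<^sub>R h) - p x) /\<^sub>R s) \<le> C * norm ((f (x + s *\<^sub>R h) - f x) /\<^sub>R s)" for s
    using mult_left_mono[OF le, of "\<bar>inverse s\<bar>"] by (simp add: mult_ac)
  then show ?thesis
    by (intro tendsto_le[OF _ tendsto_mult[OF tendsto_const tendsto_norm[OF lim[OF f]]] tendsto_norm[OF lim[OF p]]])
      auto
qed

text \<open>Increments of the sum are at least (1 - c) times those of \<open>f\<close>, so the sum
  is injective; the infinitesimal version of the bound makes it an immersion.\<close>

lemma smooth_embedding_add:
  fixes f p :: "real^3 \<Rightarrow> 'b::euclidean_space"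
  assumes f: "smooth_embedding f" and p: "smooth p"
    and le: "\<And>x y. norm (p x - p y) \<le> c * norm (f x - f y)" and "c < 1"
  shows "smooth_embedding (\<lambda>x. f x + p x)"
proof -
  let ?G = "\<lambda>x. f x + p x"
  from f obtain g where sf: "smooth f" and inj: "\<And>x. inj (frechet_derivative f (at x))"
    and g: "homeomorphism UNIV (range f) f g"
    unfolding smooth_embedding_def by blast
  have gf: "g (f x) = x" and cg: "continuous_on (range f) g" for x
    using g by (auto simp: homeomorphism_def)
  have lower: "(1 - c) * norm (f x - f y) \<le> norm (?G x - ?G y)" for x y
    using le[of x y] norm_triangle_ineq4[of "?G x - ?G y" "p x - p y"] by (simp add: algebra_simps)
  have injG: "inj ?G"
  proof (rule injI)
    fix x y assume "?G x = ?G y"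
    with lower[of x y] \<open>c < 1\<close> have "f x = f y"
      by (simp add: mult_le_0_iff)
    then show "x = y" by (metis gf)
  qed
  have "inj (frechet_derivative ?G (at x))" for x
  proof -
    let ?D = "frechet_derivative f (at x)" and ?E = "frechet_derivative p (at x)"
    have "(?G has_derivative (\<lambda>h. ?D h + ?E h)) (at x)"
      by (intro has_derivative_add smooth_has_derivative sf p)
    note der = this frechet_derivative_at[OF this]
    have "h = 0" if "?D h + ?E h = 0" for h
    proof -
      from that have "norm (?D h) = norm (?E h)"
        by (metis add_eq_0_iff norm_minus_cancel)
      also have "\<dots> \<le> c * norm (?D h)"
        by (rule norm_frechet_derivative_le[OF sf p le])
      finally have "(1 - c) * norm (?D h) \<le> 0" by (simp add: algebra_simps)
      then have "?D h = 0"
        using \<open>c < 1\<close> by (simp add: mult_le_0_iff)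
      then show "h = 0"
        using inj[of x] has_derivative_linear[OF smooth_has_derivative[OF sf]] linear_injective_0 by blast
    qed
    then show ?thesis
      using linear_injective_0[OF has_derivative_linear[OF der(1)]] unfolding der(2)[symmetric] by blast
  qed
  moreover have "homeomorphism UNIV (range ?G) ?G (inv ?G)"
  proof -
    \<comment> \<open>The inverse of the sum is factored through \<open>f\<close>: passing from
      values of the sum to values of \<open>f\<close> is Lipschitz with constant 1/(1 - c), and
      \<open>g\<close> then recovers the point.\<close>
    have k: "continuous_on (range ?G) (\<lambda>y. f (inv ?G y))"
    proof (rule continuous_onI)
      fix y e :: "'b" and \<epsilon> :: real
      assume y: "y \<in> range ?G" and "\<epsilon> > 0"
      have "dist (f (inv ?G y')) (f (inv ?G y)) \<le> \<epsilon>" if y': "y' \<in> range ?G" "dist y' y < (1 - c) * \<epsilon>" for y'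
      proof -
        have "(1 - c) * norm (f (inv ?G y') - f (inv ?G y)) \<le> norm (y' - y)"
          using lower[of "inv ?G y'" "inv ?G y"] f_inv_into_f[OF y'(1)] f_inv_into_f[OF y] by simp
        also have "\<dots> \<le> (1 - c) * \<epsilon>"
          using y'(2) by (simp add: dist_norm)
        finally show ?thesis
          using \<open>c < 1\<close> by (simp add: dist_norm)
      qed
      then show "\<exists>d>0. \<forall>y'\<in>range ?G. dist y' y < d \<longrightarrow> dist (f (inv ?G y')) (f (inv ?G y)) \<le> \<epsilon>"
        using \<open>c < 1\<close> \<open>\<epsilon> > 0\<close> by (intro exI[of _ "(1 - c) * \<epsilon>"]) auto
    qed
    have "continuous_on (range ?G) (\<lambda>y. g (f (inv ?G y)))"
      by (rule continuous_on_compose2[OF cg k]) auto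
    then have "continuous_on (range ?G) (inv ?G)"
      by (simp add: gf)
    moreover have "inv ?G (f x + p x) = x" for x
      using inv_f_f[OF injG, of x] .
    ultimately show ?thesis
      using smooth_continuous[OF smooth_add[OF sf p]]
      by (auto simp: homeomorphism_def image_image)
  qed
  ultimately show ?thesis
    unfolding smooth_embedding_def using smooth_add[OF sf p] by blast
qed

lemma smooth_embedding_compose:
  fixes f :: "real^3 \<Rightarrow> 'b::euclidean_space" and \<phi> :: "real^3 \<Rightarrow> real^3"
  assumes f: "smooth_embedding f" and \<phi>: "smooth_embedding \<phi>"
  shows "smooth_embedding (\<lambda>x. f (\<phi> x))"
proof -
  from f obtain g where sf: "smooth f" and inj: "\<And>x. inj (frechet_derivative f (at x))"
    and g: "homeomorphism UNIV (range f) f g"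
    unfolding smooth_embedding_def by blast
  from \<phi> obtain \<psi> where s\<phi>: "smooth \<phi>" and inj\<phi>: "\<And>x. inj (frechet_derivative \<phi> (at x))"
    and \<psi>: "homeomorphism UNIV (range \<phi>) \<phi> \<psi>"
    unfolding smooth_embedding_def by blast
  have "inj (frechet_derivative (\<lambda>x. f (\<phi> x)) (at x))" for x
  proof -
    have "((\<lambda>x. f (\<phi> x)) has_derivative (\<lambda>h. frechet_derivative f (at (\<phi> x)) (frechet_derivative \<phi> (at x) h))) (at x)"
      by (rule has_derivative_compose[where g = f, OF smooth_has_derivative[OF s\<phi>] smooth_has_derivative[OF sf]])
    from frechet_derivative_at[OF this] show ?thesis
      using inj_compose[OF inj[of "\<phi> x"] inj\<phi>[of x]] by (simp add: o_def)
  qed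
  moreover have "homeomorphism UNIV (range (\<lambda>x. f (\<phi> x))) (\<lambda>x. f (\<phi> x)) (\<lambda>y. \<psi> (g y))"
  proof -
    have 1: "continuous_on (range (\<lambda>x. f (\<phi> x))) g"
      using g by (auto simp: homeomorphism_def intro: continuous_on_subset)
    have 2: "continuous_on (range \<phi>) \<psi>"
      using \<psi> by (auto simp: homeomorphism_def)
    have inv: "g (f x) = x" "\<psi> (\<phi> x) = x" for x
      using g \<psi> by (auto simp: homeomorphism_def)
    have "continuous_on (range (\<lambda>x. f (\<phi> x))) (\<lambda>y. \<psi> (g y))"
      by (rule continuous_on_compose2[OF 2 1]) (auto simp: inv)
    then show ?thesis
      using smooth_continuous[OF smooth_compose[OF sf s\<phi>]] inv
      by (auto simp: homeomorphism_def image_image)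
  qed
  ultimately show ?thesis
    unfolding smooth_embedding_def using smooth_compose[OF sf s\<phi>] by blast
qed

lemma smooth_embedding_ident: "smooth_embedding (\<lambda>x::real^3. x)"
proof -
  have "frechet_derivative (\<lambda>x::real^3. x) (at x) = (\<lambda>h. h)" for x
    using frechet_derivative_at[OF has_derivative_ident] by metis
  then show ?thesis
    unfolding smooth_embedding_def
    by (auto intro!: smooth_intros exI[of _ "\<lambda>x. x"] simp: homeomorphism_def)
qed

text \<open>Replacing \<open>t\<close> by \<open>h t\<close> keeps the velocity at time 0, while the
  perturbation stays below the threshold of \<open>smooth_embedding_add\<close> for all times. The
  function t / (1 + C^2 t^2) is scaled so that its modulus never exceeds 1/(2 C).\<close>

lemma bounded_time_change:
  fixes C :: real
  assumes "C > 0"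
  obtains h :: "real \<Rightarrow> real" where "smooth h" "h 0 = 0" "(h has_real_derivative 1) (at 0)" "\<And>t. \<bar>h t\<bar> * C < 1"
proof
  let ?h = "\<lambda>t. t / (1 + C\<^sup>2 * t\<^sup>2)"
  have pos: "1 + C\<^sup>2 * t\<^sup>2 > 0" for t :: real
    by (simp add: add_pos_nonneg)
  then have nz: "1 + C\<^sup>2 * t\<^sup>2 \<noteq> 0" for t :: real
    by (metis less_irrefl)
  show "smooth ?h"
    by (intro smooth_intros nz)
  show "(?h has_real_derivative 1) (at 0)"
    by (auto intro!: derivative_eq_intros)
  show "\<bar>?h t\<bar> * C < 1" for t
  proof -
    \<comment> \<open>Expanding the square bounds |t| C by C^2 t^2 + 1/4, hence strictly by the
      denominator.\<close>
    have "0 \<le> (\<bar>t\<bar> * C - 1 / 2)\<^sup>2"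
      by simp
    also have "\<dots> = C\<^sup>2 * t\<^sup>2 - \<bar>t\<bar> * C + 1 / 4"
      by (simp add: power2_diff power_mult_distrib power_divide)
    finally have "\<bar>t\<bar> * C < 1 + C\<^sup>2 * t\<^sup>2"
      by linarith
    then show ?thesis
      using pos[of t] by (simp add: abs_divide field_simps)
  qed
qed simp


section \<open>Variations of fields\<close>

lemma config_spaceD:
  assumes "z \<in> config_space \<O>"
  shows "smooth_embedding (\<lambda>x. (Q_part z x, P_part z x, \<sigma>_part z x))"
    "\<sigma>_part z x \<in> lie_algebra \<O>" "smooth (\<theta>_part z)" "\<theta>_part z x \<in> \<O>"
    "smooth (Q_part z)" "smooth (P_part z)" "smooth (\<sigma>_part z)"
proof -
  show emb: "smooth_embedding (\<lambda>x. (Q_part z x, P_part z x, \<sigma>_part z x))"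
    and "\<sigma>_part z x \<in> lie_algebra \<O>" "smooth (\<theta>_part z)" "\<theta>_part z x \<in> \<O>"
    using assms by (auto simp: config_space_def)
  have sm: "smooth (\<lambda>x. (Q_part z x, P_part z x, \<sigma>_part z x))"
    using emb by (simp add: smooth_embedding_def)
  show "smooth (Q_part z)" "smooth (P_part z)" "smooth (\<sigma>_part z)"
    using smooth_fst[OF sm] smooth_fst[OF smooth_snd[OF sm]] smooth_snd[OF smooth_snd[OF sm]] by simp_all
qed

lemma field_parts [simp]:
  "Q_part (\<lambda>x. (q x, p x, s x, \<theta> x)) = q" "P_part (\<lambda>x. (q x, p x, s x, \<theta> x)) = p"
  "\<sigma>_part (\<lambda>x. (q x, p x, s x, \<theta> x)) = s" "\<theta>_part (\<lambda>x. (q x, p x, s x, \<theta> x)) = \<theta>"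
  by (simp_all add: fun_eq_iff Q_part_def P_part_def \<sigma>_part_def \<theta>_part_def)

lemma field_collapse: "(Q_part z x, P_part z x, \<sigma>_part z x, \<theta>_part z x) = z x"
  by (simp add: Q_part_def P_part_def \<sigma>_part_def \<theta>_part_def)

lemma config_spaceI:
  assumes "smooth_embedding (\<lambda>x. (q x, p x, s x))" "\<And>x. s x \<in> lie_algebra \<O>" "smooth \<theta>" "\<And>x. \<theta> x \<in> \<O>"
  shows "(\<lambda>x. (q x, p x, s x, \<theta> x)) \<in> config_space \<O>"
  using assms by (simp add: config_space_def)

lemma velocity_eqI:
  assumes "\<And>x. ((\<lambda>t. c t x) has_vector_derivative v x) (at 0)"
  shows "velocity c = v"
  using vector_derivative_at[OF assms] by (simp add: fun_eq_iff velocity_def)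

lemma time_change_has_vector_derivative:
  fixes h :: "real \<Rightarrow> real"
  assumes "h 0 = 0" "(h has_real_derivative 1) (at 0)"
  shows "((\<lambda>t. a + h t *\<^sub>R b) has_vector_derivative b) (at 0)"
proof -
  have "((\<lambda>t. h t *\<^sub>R b) has_vector_derivative h 0 *\<^sub>R 0 + 1 *\<^sub>R b) (at 0)"
    by (rule has_vector_derivative_scaleR[OF assms(2) has_vector_derivative_const])
  then have "((\<lambda>t. a + h t *\<^sub>R b) has_vector_derivative 0 + (h 0 *\<^sub>R 0 + 1 *\<^sub>R b)) (at 0)"
    by (rule has_vector_derivative_add[OF has_vector_derivative_const])
  then show ?thesis by simp
qed

lemma advect_has_vector_derivative:
  fixes f :: "real^3 \<Rightarrow> 'b::real_normed_vector" and h :: "real \<Rightarrow> real"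
  assumes f: "smooth f" and h: "h 0 = 0" "(h has_real_derivative 1) (at 0)"
  shows "((\<lambda>t. f (x + h t *\<^sub>R u x)) has_vector_derivative advect u f x) (at 0)"
proof -
  have "((\<lambda>t. x + h t *\<^sub>R u x) has_derivative (\<lambda>t. t *\<^sub>R u x)) (at 0)"
    using time_change_has_vector_derivative[OF h] by (simp add: has_vector_derivative_def)
  moreover have "(f has_derivative frechet_derivative f (at x)) (at (x + h 0 *\<^sub>R u x))"
    using smooth_has_derivative[OF f] h by simp
  ultimately have "((\<lambda>t. f (x + h t *\<^sub>R u x)) has_derivative (\<lambda>t. frechet_derivative f (at x) (t *\<^sub>R u x))) (at 0)"
    by (rule has_derivative_compose[where g = f])
  then show ?thesis
    using linear_cmul[OF has_derivative_linear[OF smooth_has_derivative[OF f]]]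
    by (simp add: has_vector_derivative_def advect_eq_frechet_derivative smooth_differentiable f)
qed

text \<open>The flow of \<open>u\<close> is replaced by the explicit diffeomorphisms \<open>x \<mapsto> x + h t u x\<close>, which have the same
  velocity at time \<open>0\<close> and stay close to the identity for all times.\<close>
lemma inf_action_variation:
  fixes z :: "('k::finite, 'n::finite) fields"
  assumes \<O>: "matrix_lie_group \<O>" and z: "z \<in> config_space \<O>"
    and u: "smooth u" "compactly_supported u" and \<zeta>: "\<zeta> \<in> gauge_algebra \<O>" "compactly_supported \<zeta>"
  obtains c where "variation \<O> z c" "velocity c = inf_action (u, \<zeta>) z"
proof -
  note G = matrix_lie_groupD[OF \<O>] and z' = config_spaceD[OF z]
  have s\<zeta>: "smooth \<zeta>" "\<And>x. \<zeta> x \<in> lie_algebra \<O>"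
    using \<zeta>(1) by (auto simp: gauge_algebra_def)
  \<comment> \<open>For the identity embedding, domination is a global Lipschitz bound for
    \<open>u\<close>.\<close>
  obtain C where C: "C > 0" "\<And>x y. norm (u x - u y) \<le> C * norm (x - y)"
    using embedding_dominates[OF smooth_embedding_ident u] by metis
  obtain h where h: "smooth h" "h 0 = 0" "(h has_real_derivative 1) (at 0)" "\<And>t. \<bar>h t\<bar> * C < 1"
    using bounded_time_change[OF C(1)] by metis
  obtain g :: "real \<Rightarrow> real^3 \<Rightarrow> real^'n^'n" where g: "smooth (\<lambda>p. g (fst p) (snd p))" "\<And>t x. g t x \<in> \<O>"
    "\<And>x. g 0 x = mat 1" "\<And>x. ((\<lambda>t. g t x) has_vector_derivative \<zeta> x) (at 0)" "\<And>t x. \<zeta> x = 0 \<Longrightarrow> g t x = mat 1"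
    by (rule group_curve_exists[OF \<O> s\<zeta>]) blast
  from u(2) obtain K1 where K1: "compact K1" "\<And>x. x \<notin> K1 \<Longrightarrow> u x = 0"
    unfolding compactly_supported_def by blast
  from \<zeta>(2) obtain K2 where K2: "compact K2" "\<And>x. x \<notin> K2 \<Longrightarrow> \<zeta> x = 0"
    unfolding compactly_supported_def by blast
  define c where "c t = (\<lambda>x. (Q_part z (x + h t *\<^sub>R u x), P_part z (x + h t *\<^sub>R u x), \<sigma>_part z (x + h t *\<^sub>R u x),
    \<theta>_part z (x + h t *\<^sub>R u x) ** g t x))" for t
  have diffeo: "smooth_embedding (\<lambda>x. x + h t *\<^sub>R u x)" for t
  proof (rule smooth_embedding_add[OF smooth_embedding_ident _ _ h(4)[of t]])
    show "smooth (\<lambda>x. h t *\<^sub>R u x)" by (intro smooth_intros u(1))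
    show "norm (h t *\<^sub>R u x - h t *\<^sub>R u y) \<le> \<bar>h t\<bar> * C * norm (x - y)" for x y
      using mult_left_mono[OF C(2)[of x y], of "\<bar>h t\<bar>"] by (simp add: scaleR_diff_right[symmetric] mult.assoc)
  qed
  show ?thesis
  proof
    show "variation \<O> z c"
      unfolding variation_def
    proof (intro conjI allI)
      show "smooth (\<lambda>(t, x). c t x)"
        unfolding c_def case_prod_unfold
        by (intro smooth_intros smooth_compose[OF z'(5)] smooth_compose[OF z'(6)] smooth_compose[OF z'(7)]
            smooth_compose[OF z'(3)] smooth_compose[OF h(1)] smooth_compose[OF u(1)] g(1))
      show "c t \<in> config_space \<O>" for t
        unfolding c_def
      proof (rule config_spaceI)
        show "smooth_embedding (\<lambda>x. (Q_part z (x + h t *\<^sub>R u x), P_part z (x + h t *\<^sub>R u x), \<sigma>_part z (x + h t *\<^sub>R u x)))"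
          by (rule smooth_embedding_compose[OF z'(1) diffeo])
        have "smooth (\<lambda>x. g (fst (t, x)) (snd (t, x)))"
          by (rule smooth_compose[OF g(1)]) (intro smooth_intros)
        then show "smooth (\<lambda>x. \<theta>_part z (x + h t *\<^sub>R u x) ** g t x)"
          by (intro smooth_intros smooth_compose[OF z'(3)] u(1)) simp
      qed (auto intro: z' G g)
      show "c 0 = z"
        by (simp add: c_def h g field_collapse)
      show "\<exists>K. compact K \<and> (\<forall>t x. x \<notin> K \<longrightarrow> c t x = z x)"
        by (rule exI[of _ "K1 \<union> K2"]) (use K1 K2 in \<open>auto simp: c_def g field_collapse\<close>)
    qed
    show "velocity c = inf_action (u, \<zeta>) z"
    proof (rule velocity_eqI)
      fix x
      note a = advect_has_vector_derivative[OF _ h(2,3)]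
      have "((\<lambda>t. c t x) has_vector_derivative (advect u (Q_part z) x, advect u (P_part z) x, advect u (\<sigma>_part z) x,
          \<theta>_part z (x + h 0 *\<^sub>R u x) ** \<zeta> x + advect u (\<theta>_part z) x ** g 0 x)) (at 0)"
        unfolding c_def
        by (intro has_vector_derivative_Pair has_vector_derivative_matrix_mult a z' g(4))
      then show "((\<lambda>t. c t x) has_vector_derivative inf_action (u, \<zeta>) z x) (at 0)"
        by (simp add: inf_action_def h g add.commute)
    qed
  qed
qed

text \<open>These affine curves supply the test variations of the embedding.
  \<open>embedding_dominates\<close> provides the constant for the change of time, and \<sigma>
  stays in the Lie algebra because that is a linear subspace.\<close>

lemma linear_variation:
  fixes z :: "('k::finite, 'n::finite) fields"
  assumes \<O>: "matrix_lie_group \<O>" and z: "z \<in> config_space \<O>"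
    and p: "smooth p" "compactly_supported p" and s: "\<And>x. snd (snd (p x)) \<in> lie_algebra \<O>"
  obtains c where "variation \<O> z c" "velocity c = (\<lambda>x. (fst (p x), fst (snd (p x)), snd (snd (p x)), 0))"
proof -
  note z' = config_spaceD[OF z]
  obtain C where C: "C > 0" "\<And>x y. norm (p x - p y) \<le> C * norm ((Q_part z x, P_part z x, \<sigma>_part z x) - (Q_part z y, P_part z y, \<sigma>_part z y))"
    using embedding_dominates[OF z'(1) p] by metis
  obtain h where h: "smooth h" "h 0 = 0" "(h has_real_derivative 1) (at 0)" "\<And>t. \<bar>h t\<bar> * C < 1"
    using bounded_time_change[OF C(1)] by metis
  from p(2) obtain K where K: "compact K" "\<And>x. x \<notin> K \<Longrightarrow> p x = 0"
    unfolding compactly_supported_def by blast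
  define c where "c t = (\<lambda>x. (Q_part z x + h t *\<^sub>R fst (p x), P_part z x + h t *\<^sub>R fst (snd (p x)),
    \<sigma>_part z x + h t *\<^sub>R snd (snd (p x)), \<theta>_part z x))" for t
  show ?thesis
  proof
    show "variation \<O> z c"
      unfolding variation_def
    proof (intro conjI allI)
      show "smooth (\<lambda>(t, x). c t x)"
        unfolding c_def case_prod_unfold
        by (intro smooth_intros smooth_compose[OF z'(5)] smooth_compose[OF z'(6)] smooth_compose[OF z'(7)]
            smooth_compose[OF z'(3)] smooth_compose[OF h(1)] smooth_compose[OF p(1)])
      show "c t \<in> config_space \<O>" for t
        unfolding c_def
      proof (rule config_spaceI)
        have "smooth_embedding (\<lambda>x. (Q_part z x, P_part z x, \<sigma>_part z x) + h t *\<^sub>R p x)"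
        proof (rule smooth_embedding_add[OF z'(1) _ _ h(4)[of t]])
          show "smooth (\<lambda>x. h t *\<^sub>R p x)" by (intro smooth_intros p(1))
          show "norm (h t *\<^sub>R p x - h t *\<^sub>R p y) \<le> \<bar>h t\<bar> * C *
              norm ((Q_part z x, P_part z x, \<sigma>_part z x) - (Q_part z y, P_part z y, \<sigma>_part z y))" for x y
            using mult_left_mono[OF C(2)[of x y], of "\<bar>h t\<bar>"]
            unfolding scaleR_diff_right[symmetric] norm_scaleR mult.assoc by simp
        qed
        also have "(\<lambda>x. (Q_part z x, P_part z x, \<sigma>_part z x) + h t *\<^sub>R p x) =
            (\<lambda>x. (Q_part z x + h t *\<^sub>R fst (p x), P_part z x + h t *\<^sub>R fst (snd (p x)), \<sigma>_part z x + h t *\<^sub>R snd (snd (p x))))"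
          by (simp add: fun_eq_iff prod_eq_iff)
        finally show "smooth_embedding \<dots>" .
        show "\<sigma>_part z x + h t *\<^sub>R snd (snd (p x)) \<in> lie_algebra \<O>" for x
          by (intro subspace_add[OF subspace_lie_algebra[OF \<O>]] subspace_scale[OF subspace_lie_algebra[OF \<O>]] z' s)
      qed (auto intro: z')
      show "c 0 = z"
        by (simp add: c_def h field_collapse)
      show "\<exists>K. compact K \<and> (\<forall>t x. x \<notin> K \<longrightarrow> c t x = z x)"
        by (rule exI[of _ K]) (use K in \<open>auto simp: c_def field_collapse\<close>)
    qed
    show "velocity c = (\<lambda>x. (fst (p x), fst (snd (p x)), snd (snd (p x)), 0))"
      unfolding c_def
      by (rule velocity_eqI) (intro has_vector_derivative_Pair time_change_has_vector_derivative[OF h(2,3)] has_vector_derivative_const)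
  qed
qed

text \<open>Left multiplication by a group-valued curve changes \<theta> alone. It yields the test
  directions \<zeta> \<theta>, on which the \<theta>-derivative is determined.\<close>

lemma group_variation:
  fixes z :: "('k::finite, 'n::finite) fields"
  assumes \<O>: "matrix_lie_group \<O>" and z: "z \<in> config_space \<O>"
    and \<zeta>: "smooth \<zeta>" "\<And>x. \<zeta> x \<in> lie_algebra \<O>" "compactly_supported \<zeta>"
  obtains c where "variation \<O> z c" "velocity c = (\<lambda>x. (0, 0, 0, \<zeta> x ** \<theta>_part z x))"
proof -
  note G = matrix_lie_groupD[OF \<O>] and z' = config_spaceD[OF z]
  obtain g :: "real \<Rightarrow> real^3 \<Rightarrow> real^'n^'n" where g: "smooth (\<lambda>p. g (fst p) (snd p))" "\<And>t x. g t x \<in> \<O>"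
    "\<And>x. g 0 x = mat 1" "\<And>x. ((\<lambda>t. g t x) has_vector_derivative \<zeta> x) (at 0)" "\<And>t x. \<zeta> x = 0 \<Longrightarrow> g t x = mat 1"
    by (rule group_curve_exists[OF \<O> \<zeta>(1,2)]) blast
  from \<zeta>(3) obtain K where K: "compact K" "\<And>x. x \<notin> K \<Longrightarrow> \<zeta> x = 0"
    unfolding compactly_supported_def by blast
  define c where "c t = (\<lambda>x. (Q_part z x, P_part z x, \<sigma>_part z x, g t x ** \<theta>_part z x))" for t
  show ?thesis
  proof
    show "variation \<O> z c"
      unfolding variation_def
    proof (intro conjI allI)
      show "smooth (\<lambda>(t, x). c t x)"
        unfolding c_def case_prod_unfold
        by (intro smooth_intros smooth_compose[OF z'(5)] smooth_compose[OF z'(6)] smooth_compose[OF z'(7)]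
            smooth_compose[OF z'(3)] g(1))
      show "c t \<in> config_space \<O>" for t
        unfolding c_def
      proof (rule config_spaceI)
        have "smooth (\<lambda>x. g (fst (t, x)) (snd (t, x)))"
          by (rule smooth_compose[OF g(1)]) (intro smooth_intros)
        then show "smooth (\<lambda>x. g t x ** \<theta>_part z x)"
          by (intro smooth_intros z'(3)) simp
      qed (auto intro: z' G g)
      show "c 0 = z"
        by (simp add: c_def g field_collapse)
      show "\<exists>K. compact K \<and> (\<forall>t x. x \<notin> K \<longrightarrow> c t x = z x)"
        by (rule exI[of _ K]) (use K in \<open>auto simp: c_def g field_collapse\<close>)
    qed
    show "velocity c = (\<lambda>x. (0, 0, 0, \<zeta> x ** \<theta>_part z x))"
      unfolding c_def
      by (rule velocity_eqI) (intro has_vector_derivative_Pair has_vector_derivative_const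
          has_vector_derivative_matrix_mult_const g(4))
  qed
qed

subsection \<open>Uniqueness of functional derivatives\<close>

lemma field_pair_eq_inner: "field_pair D v = (LBINT x. D x \<bullet> v x)"
  unfolding field_pair_def tr_pair_eq_inner Q_part_def P_part_def \<sigma>_part_def \<theta>_part_def
  by (simp add: inner_prod_def add.assoc)

text \<open>The function is the pointwise limit of its truncations to balls, each of which is
  integrable.\<close>

lemma locally_integrable_measurable:
  fixes D :: "'a::euclidean_space \<Rightarrow> 'b::euclidean_space"
  assumes "locally_integrable D"
  shows "D \<in> borel_measurable borel"
proof (rule borel_measurable_LIMSEQ_metric)
  show "(\<lambda>x. indicator (cball 0 (real n)) x *\<^sub>R D x) \<in> borel_measurable borel" for n
  proof -
    have "integrable lborel (\<lambda>x. indicator (cball 0 (real n)) x *\<^sub>R D x)"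
      using assms unfolding locally_integrable_def set_integrable_def by simp
    from borel_measurable_integrable[OF this] show ?thesis by simp
  qed
  show "(\<lambda>n. indicator (cball 0 (real n)) x *\<^sub>R D x) \<longlonglongrightarrow> D x" for x
  proof (rule tendsto_eventually)
    show "eventually (\<lambda>n. indicator (cball 0 (real n)) x *\<^sub>R D x = D x) sequentially"
      using eventually_ge_at_top[of "nat \<lceil>norm x\<rceil>"]
      by eventually_elim (auto simp: indicator_def dist_norm nat_le_iff ceiling_le_iff)
  qed
qed

lemma locally_integrable_inner:
  fixes D V :: "'a::euclidean_space \<Rightarrow> 'b::euclidean_space"
  assumes D: "locally_integrable D" and V: "continuous_on UNIV V"
  shows "locally_integrable (\<lambda>x. D x \<bullet> V x)"
  unfolding locally_integrable_def
proof (intro allI impI)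
  fix K :: "'a set" assume K: "compact K"
  have int: "integrable lborel (\<lambda>x. indicator K x *\<^sub>R D x)"
    using D K unfolding locally_integrable_def set_integrable_def by blast
  have "bounded (V ` K)"
    by (intro compact_imp_bounded compact_continuous_image K continuous_on_subset[OF V]) auto
  then obtain M where "M > 0" and M: "\<And>x. x \<in> K \<Longrightarrow> norm (V x) \<le> M"
    by (metis bounded_pos imageI)
  show "set_integrable lborel K (\<lambda>x. D x \<bullet> V x)"
    unfolding set_integrable_def
  proof (rule Bochner_Integration.integrable_bound[OF integrable_mult_right[OF integrable_norm[OF int], of M]])
    have [measurable]: "D \<in> borel_measurable borel" "V \<in> borel_measurable borel"
      using locally_integrable_measurable[OF D] borel_measurable_continuous_onI[OF V] .
    have [measurable]: "K \<in> sets borel"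
      using K by (simp add: borel_compact)
    show "(\<lambda>x. indicator K x *\<^sub>R (D x \<bullet> V x)) \<in> borel_measurable lborel"
      by measurable
    have "norm (indicator K x *\<^sub>R (D x \<bullet> V x)) \<le> norm (M * norm (indicator K x *\<^sub>R D x))" for x
    proof (cases "x \<in> K")
      case True
      have "\<bar>D x \<bullet> V x\<bar> \<le> norm (D x) * norm (V x)"
        by (rule Cauchy_Schwarz_ineq2)
      also have "\<dots> \<le> norm (D x) * M"
        by (intro mult_left_mono M True) simp
      finally show ?thesis
        using True \<open>M > 0\<close> by (simp add: abs_mult mult.commute)
    qed simp
    then show "AE x in lborel. norm (indicator K x *\<^sub>R (D x \<bullet> V x)) \<le> norm (M * norm (indicator K x *\<^sub>R D x))"
      by simp
  qed
qed

lemma integrable_inner_compactly_supported: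
  fixes D V :: "'a::euclidean_space \<Rightarrow> 'b::euclidean_space"
  assumes "locally_integrable D" "continuous_on UNIV V" "compactly_supported V"
  shows "integrable lborel (\<lambda>x. D x \<bullet> V x)"
proof -
  from assms(3) obtain K where K: "compact K" "\<And>x. x \<notin> K \<Longrightarrow> V x = 0"
    unfolding compactly_supported_def by blast
  then have "(\<lambda>x. D x \<bullet> V x) = (\<lambda>x. indicator K x *\<^sub>R (D x \<bullet> V x))"
    by (auto simp: fun_eq_iff indicator_def)
  then show ?thesis
    using locally_integrable_inner[OF assms(1,2)] K(1)
    unfolding locally_integrable_def set_integrable_def by simp
qed

lemma compactly_supported_scaleR:
  "compactly_supported \<phi> \<Longrightarrow> compactly_supported (\<lambda>x. \<phi> x *\<^sub>R (V x :: 'b::real_vector))"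
  unfolding compactly_supported_def by fastforce

text \<open>Localising a direction field \<open>V\<close> by scalar test functions reduces the
  vector-valued uniqueness question to the scalar fundamental lemma. \<open>V\<close> may vary with
  \<open>x\<close> so that it can be \<xi> \<theta> x.\<close>

lemma field_pair_eq_imp_AE:
  fixes D D' V :: "('k::finite, 'n::finite) fields"
  assumes D: "locally_integrable D" "locally_integrable D'" and V: "smooth V"
    and eq: "\<And>\<phi>. smooth \<phi> \<Longrightarrow> compactly_supported \<phi> \<Longrightarrow>
      field_pair D (\<lambda>x. \<phi> x *\<^sub>R V x) = field_pair D' (\<lambda>x. \<phi> x *\<^sub>R V x)"
  shows "AE x in lborel. D x \<bullet> V x = D' x \<bullet> V x"
proof -
  have "AE x in lborel. D x \<bullet> V x - D' x \<bullet> V x = 0"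
  proof (rule fundamental_lemma_calculus_of_variations)
    show "locally_integrable (\<lambda>x. D x \<bullet> V x - D' x \<bullet> V x)"
      using locally_integrable_inner[OF D(1) smooth_continuous[OF V]] locally_integrable_inner[OF D(2) smooth_continuous[OF V]]
      unfolding locally_integrable_def by (auto intro: set_integral_diff)
    fix \<phi> :: "real^3 \<Rightarrow> real" assume \<phi>: "smooth \<phi>" "compactly_supported \<phi>"
    have cont: "continuous_on UNIV (\<lambda>x. \<phi> x *\<^sub>R V x)"
      by (intro smooth_continuous smooth_intros \<phi> V)
    have "(LBINT x. (D x \<bullet> V x - D' x \<bullet> V x) * \<phi> x) = (LBINT x. D x \<bullet> \<phi> x *\<^sub>R V x - D' x \<bullet> \<phi> x *\<^sub>R V x)"
      by (simp add: algebra_simps)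
    also have "\<dots> = 0"
      using eq[OF \<phi>] integrable_inner_compactly_supported[OF _ cont compactly_supported_scaleR[OF \<phi>(2)]] D
      by (simp add: field_pair_eq_inner)
    finally show "(LBINT x. (D x \<bullet> V x - D' x \<bullet> V x) * \<phi> x) = 0" .
  qed
  then show ?thesis by simp
qed

text \<open>The \<sigma>-components are tested only in Lie algebra directions, which suffices
  because they lie in the Lie algebra themselves. The \<theta>-components carry no such
  normalisation, so they are compared only on the tangent space of the group.\<close>

lemma functional_derivative_unique:
  fixes z :: "('k::finite, 'n::finite) fields"
  assumes \<O>: "matrix_lie_group \<O>" and z: "z \<in> config_space \<O>"
    and D: "has_functional_derivative \<O> F z D" and D': "has_functional_derivative \<O> F z D'"
  shows "AE x in lborel. Q_part D x = Q_part D' x \<and> P_part D x = P_part D' x \<and> \<sigma>_part D x = \<sigma>_part D' x \<and>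
    (\<forall>\<xi>\<in>lie_algebra \<O>. \<theta>_part D x \<bullet> (\<xi> ** \<theta>_part z x) = \<theta>_part D' x \<bullet> (\<xi> ** \<theta>_part z x))"
proof -
  have li: "locally_integrable D" "locally_integrable D'"
    and \<sigma>: "\<And>x. \<sigma>_part D x \<in> lie_algebra \<O>" "\<And>x. \<sigma>_part D' x \<in> lie_algebra \<O>"
    using D D' by (auto simp: has_functional_derivative_def)
  have eq: "field_pair D (velocity c) = field_pair D' (velocity c)" if "variation \<O> z c" for c
    using D D' that DERIV_unique unfolding has_functional_derivative_def by blast
  have lin: "AE x in lborel. D x \<bullet> (q, p, s, 0) = D' x \<bullet> (q, p, s, 0)" if s: "s \<in> lie_algebra \<O>" for q p s
  proof (rule field_pair_eq_imp_AE[OF li smooth_const])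
    fix \<phi> :: "real^3 \<Rightarrow> real" assume \<phi>: "smooth \<phi>" "compactly_supported \<phi>"
    have 1: "smooth (\<lambda>x. \<phi> x *\<^sub>R (q, p, s))" "compactly_supported (\<lambda>x. \<phi> x *\<^sub>R (q, p, s))"
      by (intro smooth_intros compactly_supported_scaleR \<phi>)+
    have 2: "snd (snd (\<phi> x *\<^sub>R (q, p, s))) \<in> lie_algebra \<O>" for x
      by (simp add: s subspace_scale subspace_lie_algebra \<O>)
    obtain c where "variation \<O> z c" "velocity c = (\<lambda>x. \<phi> x *\<^sub>R (q, p, s, 0))"
      by (rule linear_variation[OF \<O> z 1 2]) simp
    then show "field_pair D (\<lambda>x. \<phi> x *\<^sub>R (q, p, s, 0)) = field_pair D' (\<lambda>x. \<phi> x *\<^sub>R (q, p, s, 0))"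
      using eq by metis
  qed
  have grp: "AE x in lborel. D x \<bullet> (0, 0, 0, \<xi> ** \<theta>_part z x) = D' x \<bullet> (0, 0, 0, \<xi> ** \<theta>_part z x)"
    if \<xi>: "\<xi> \<in> lie_algebra \<O>" for \<xi>
  proof (rule field_pair_eq_imp_AE[OF li])
    show "smooth (\<lambda>x. (0::real^'k, 0::real^'k, 0::real^'n^'n, \<xi> ** \<theta>_part z x))"
      by (intro smooth_intros config_spaceD[OF z])
    fix \<phi> :: "real^3 \<Rightarrow> real" assume \<phi>: "smooth \<phi>" "compactly_supported \<phi>"
    have 1: "smooth (\<lambda>x. \<phi> x *\<^sub>R \<xi>)" "compactly_supported (\<lambda>x. \<phi> x *\<^sub>R \<xi>)"
      by (intro smooth_intros compactly_supported_scaleR \<phi>)+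
    have 2: "\<phi> x *\<^sub>R \<xi> \<in> lie_algebra \<O>" for x
      by (simp add: \<xi> subspace_scale subspace_lie_algebra \<O>)
    obtain c where "variation \<O> z c" "velocity c = (\<lambda>x. \<phi> x *\<^sub>R (0, 0, 0, \<xi> ** \<theta>_part z x))"
      by (rule group_variation[OF \<O> z 1(1) 2 1(2)]) (simp add: scalar_matrix_assoc)
    then show "field_pair D (\<lambda>x. \<phi> x *\<^sub>R (0, 0, 0, \<xi> ** \<theta>_part z x)) = field_pair D' (\<lambda>x. \<phi> x *\<^sub>R (0, 0, 0, \<xi> ** \<theta>_part z x))"
      using eq by metis
  qed
  obtain B where B: "orthonormal_basis B (lie_algebra \<O>)"
    using orthonormal_basis_exists[OF subspace_lie_algebra[OF \<O>]] .
  then have finB: "finite B" and BL: "B \<subseteq> lie_algebra \<O>" and spanB: "span B = lie_algebra \<O>"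
    using span_superset by (auto simp: orthonormal_basis_def)
  \<comment> \<open>Each direction has its own exceptional null set. Restricting to finitely many
    basis directions gives a common one, and linearity recovers the rest.\<close>
  have "AE x in lborel. \<forall>b\<in>Basis. D x \<bullet> (b, 0, 0, 0) = D' x \<bullet> (b, 0, 0, 0)"
    by (intro AE_finite_allI lin subspace_0[OF subspace_lie_algebra[OF \<O>]]) simp
  moreover have "AE x in lborel. \<forall>b\<in>Basis. D x \<bullet> (0, b, 0, 0) = D' x \<bullet> (0, b, 0, 0)"
    by (intro AE_finite_allI lin subspace_0[OF subspace_lie_algebra[OF \<O>]]) simp
  moreover have "AE x in lborel. \<forall>b\<in>B. D x \<bullet> (0, 0, b, 0) = D' x \<bullet> (0, 0, b, 0)"
    using BL by (intro AE_finite_allI lin finB) auto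
  moreover have "AE x in lborel. \<forall>b\<in>B. D x \<bullet> (0, 0, 0, b ** \<theta>_part z x) = D' x \<bullet> (0, 0, 0, b ** \<theta>_part z x)"
    using BL by (intro AE_finite_allI grp finB) auto
  ultimately show ?thesis
  proof eventually_elim
    case (elim x)
    have qp: "Q_part D x \<bullet> b = Q_part D' x \<bullet> b" "P_part D x \<bullet> b = P_part D' x \<bullet> b" if "b \<in> Basis" for b
      using bspec[OF elim(1) that] bspec[OF elim(2) that] by (simp_all add: Q_part_def P_part_def inner_prod_def)
    have "Q_part D x = Q_part D' x" "P_part D x = P_part D' x"
      by (rule euclidean_eqI, erule qp)+
    moreover have "\<sigma>_part D x \<bullet> b = \<sigma>_part D' x \<bullet> b" if "b \<in> B" for b
      using bspec[OF elim(3) that] by (simp add: \<sigma>_part_def inner_prod_def)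
    then have "(\<Sum>b\<in>B. (\<sigma>_part D x \<bullet> b) *\<^sub>R b) = (\<Sum>b\<in>B. (\<sigma>_part D' x \<bullet> b) *\<^sub>R b)"
      by simp
    then have "\<sigma>_part D x = \<sigma>_part D' x"
      by (simp only: orthonormal_representation[OF B \<sigma>(1)] orthonormal_representation[OF B \<sigma>(2)])
    moreover have "\<theta>_part D x \<bullet> (\<xi> ** \<theta>_part z x) = \<theta>_part D' x \<bullet> (\<xi> ** \<theta>_part z x)" if "\<xi> \<in> lie_algebra \<O>" for \<xi>
    proof (rule linear_eq_on_span[of "\<lambda>\<xi>. \<theta>_part D x \<bullet> (\<xi> ** \<theta>_part z x)" "\<lambda>\<xi>. \<theta>_part D' x \<bullet> (\<xi> ** \<theta>_part z x)" B])
      show "linear (\<lambda>\<xi>. \<theta>_part D x \<bullet> (\<xi> ** \<theta>_part z x))" "linear (\<lambda>\<xi>. \<theta>_part D' x \<bullet> (\<xi> ** \<theta>_part z x))"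
        by (intro bounded_linear.linear bounded_linear_compose[OF bounded_linear_inner_right]
            bounded_bilinear.bounded_linear_left[OF bounded_bilinear_matrix_mult])+
      show "\<theta>_part D x \<bullet> (b ** \<theta>_part z x) = \<theta>_part D' x \<bullet> (b ** \<theta>_part z x)" if "b \<in> B" for b
        using bspec[OF elim(4) that] by (simp add: \<theta>_part_def inner_prod_def)
      show "\<xi> \<in> span B"
        using that spanB by simp
    qed
    ultimately show ?case by blast
  qed
qed


section \<open>The functional derivative of the momentum map\<close>

lemma has_real_derivative_integral_smooth:
  fixes \<Phi> :: "real \<times> 'a::euclidean_space \<Rightarrow> real"
  assumes \<Phi>: "smooth \<Phi>" and K: "compact K" "\<And>t x. x \<notin> K \<Longrightarrow> \<Phi> (t, x) = 0"
    and \<phi>: "\<And>x. ((\<lambda>t. \<Phi> (t, x)) has_real_derivative \<phi> x) (at 0)"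
  shows "((\<lambda>t. LBINT x. \<Phi> (t, x)) has_real_derivative (LBINT x. \<phi> x)) (at 0)"
proof -
  let ?D = "\<lambda>t x. frechet_derivative \<Phi> (at (t, x)) (1, 0)"
  have D: "((\<lambda>t. \<Phi> (t, x)) has_real_derivative ?D t x) (at t)" for t x
    using has_vector_derivative_line[where x = "(0, x)" and h = "(1, 0)" and t = t, OF smooth_has_derivative[OF \<Phi>]]
    by (simp add: has_real_derivative_iff_has_vector_derivative)
  have "((\<lambda>t. LBINT x. \<Phi> (t, x)) has_real_derivative (LBINT x. ?D 0 x)) (at 0)"
  proof (rule has_real_derivative_integral[OF K(1) _ _ D])
    show "continuous_on UNIV (\<lambda>x. \<Phi> (t, x))" for t
      by (intro smooth_continuous smooth_compose[OF \<Phi>] smooth_intros)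
    show "continuous_on UNIV (\<lambda>(t, x). ?D t x)"
      using smooth_continuous[OF smooth_frechet_derivative[OF \<Phi>, of "(1, 0)"]] by (simp add: case_prod_unfold)
  qed (use K in auto)
  moreover have "?D 0 = \<phi>"
    using DERIV_unique[OF D \<phi>] by (rule ext)
  ultimately show ?thesis by simp
qed

lemma frechet_derivative_slice:
  fixes C :: "real \<times> 'a::euclidean_space \<Rightarrow> 'b::real_normed_vector"
  assumes "smooth C"
  shows "frechet_derivative (\<lambda>x. C (t, x)) (at x) h = frechet_derivative C (at (t, x)) (0, h)"
proof -
  have "((\<lambda>x. (t, x)) has_derivative (\<lambda>h. (0, h))) (at x)"
    by (intro has_derivative_Pair has_derivative_const has_derivative_ident)
  from has_derivative_compose[where g = C, OF this smooth_has_derivative[OF assms]]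
  have "((\<lambda>x. C (t, x)) has_derivative (\<lambda>h. frechet_derivative C (at (t, x)) (0, h))) (at x)" .
  from fun_cong[OF frechet_derivative_at[OF this]] show ?thesis
    by (rule sym)
qed

lemma has_vector_derivative_slice:
  fixes C :: "real \<times> 'a::euclidean_space \<Rightarrow> 'b::real_normed_vector"
  assumes "smooth C"
  shows "((\<lambda>t. C (t, x)) has_vector_derivative frechet_derivative C (at (t, x)) (1, 0)) (at t)"
  using has_vector_derivative_line[where x = "(0, x)" and h = "(1, 0)" and t = t, OF smooth_has_derivative[OF assms]]
  by simp

text \<open>The time derivative commutes with advection by symmetry of the second derivative of
  \<open>C\<close> on the product of time and space, in the directions (1, 0) and (0, u x).\<close>

lemma advect_slice_has_vector_derivative:
  fixes C :: "real \<times> (real^3) \<Rightarrow> 'b::euclidean_space"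
  assumes C: "smooth C"
  shows "((\<lambda>t. advect u (\<lambda>x. C (t, x)) x) has_vector_derivative
    advect u (\<lambda>x. frechet_derivative C (at (0, x)) (1, 0)) x) (at 0)"
proof -
  have slice: "smooth (\<lambda>x. C' (t, x))" if "smooth C'" for C' :: "real \<times> (real^3) \<Rightarrow> 'b" and t
    by (intro smooth_compose[OF that] smooth_intros)
  let ?E = "\<lambda>p. frechet_derivative C (at p) (1, 0)" and ?F = "\<lambda>p. frechet_derivative C (at p) (0, u x)"
  have E: "smooth ?E" by (rule smooth_frechet_derivative[OF C])
  have "advect u (\<lambda>x. C (t, x)) x = ?F (t, x)" for t
    using slice[OF C] by (simp add: advect_eq_frechet_derivative smooth_differentiable frechet_derivative_slice[OF C])
  moreover have "((\<lambda>t. ?F (t, x)) has_vector_derivative frechet_derivative ?F (at (0, x)) (1, 0)) (at 0)"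
    by (rule has_vector_derivative_slice[OF smooth_frechet_derivative[OF C]])
  moreover have "frechet_derivative ?F (at (0, x)) (1, 0) = frechet_derivative ?E (at (0, x)) (0, u x)"
    by (rule frechet_derivative_commute[OF C])
  moreover have "\<dots> = advect u (\<lambda>x. ?E (0, x)) x"
    using slice[OF E, of 0]
    by (simp add: advect_eq_frechet_derivative smooth_differentiable frechet_derivative_slice[OF E])
  ultimately show ?thesis by simp
qed

lemma has_vector_derivative_matrix_inv:
  fixes f :: "real \<Rightarrow> real^'n^'n"
  assumes inv: "\<And>t. invertible (f t)" and f: "smooth f" and f': "(f has_vector_derivative f') (at t)"
  shows "((\<lambda>t. matrix_inv (f t)) has_vector_derivative - (matrix_inv (f t) ** f' ** matrix_inv (f t))) (at t)"
proof -
  have "frechet_derivative f (at t) = (\<lambda>r. r *\<^sub>R f')"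
    using frechet_derivative_at[OF f'[unfolded has_vector_derivative_def]] by (rule sym)
  with has_derivative_matrix_inv[OF inv f, of t] show ?thesis
    by (simp add: has_vector_derivative_def scalar_matrix_assoc[symmetric] matrix_scalar_ac)
qed

text \<open>The first identity rests on cyclicity of the trace. Both serve to strip a variation of
  the matrix factors around it, as in the last component of
  \<open>momentum_derivative\<close>.\<close>

lemma inner_matrix_mult_transpose:
  fixes A B C :: "real^'n^'n"
  shows "(A ** transpose B) \<bullet> C = A \<bullet> (C ** B)" and "(transpose B ** A) \<bullet> C = A \<bullet> (B ** C)"
proof -
  have "trace (B ** (transpose A ** C)) = trace (transpose A ** C ** B)"
    by (rule trace_mul_sym)
  then show "(A ** transpose B) \<bullet> C = A \<bullet> (C ** B)"
    unfolding tr_pair_eq_inner[symmetric] tr_pair_def by (simp add: matrix_transpose_mul matrix_mul_assoc)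
  show "(transpose B ** A) \<bullet> C = A \<bullet> (B ** C)"
    unfolding tr_pair_eq_inner[symmetric] tr_pair_def by (simp add: matrix_transpose_mul matrix_mul_assoc)
qed

lemmas matrix_mult_minus = bounded_bilinear.minus_left[OF bounded_bilinear_matrix_mult]
  bounded_bilinear.minus_right[OF bounded_bilinear_matrix_mult]
lemmas matrix_mult_add = bounded_bilinear.add_left[OF bounded_bilinear_matrix_mult]
  bounded_bilinear.add_right[OF bounded_bilinear_matrix_mult]

text \<open>This is \<eta> of the overview: the velocity of \<theta> under the infinitesimal action,
  translated to the identity from the right.\<close>

definition log_velocity :: "(real^3 \<Rightarrow> real^3) \<Rightarrow> (real^3 \<Rightarrow> real^'n^'n) \<Rightarrow> (real^3 \<Rightarrow> real^'n^'n) \<Rightarrow> real^3 \<Rightarrow> real^'n^'n" where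
  "log_velocity u \<zeta> \<theta> x = (advect u \<theta> x + \<theta> x ** \<zeta> x) ** matrix_inv (\<theta> x)"

text \<open>The integrand of the momentum pairing with the coadjoint action moved onto \<zeta>,
  where it becomes the second half of \<open>log_velocity\<close>.\<close>

definition momentum_density ::
  "(real^3 \<Rightarrow> real) \<Rightarrow> (real^3 \<Rightarrow> real^3) \<Rightarrow> (real^3 \<Rightarrow> real^'n^'n) \<Rightarrow> ('k::finite, 'n::finite) fields \<Rightarrow> real^3 \<Rightarrow> real" where
  "momentum_density w u \<zeta> z x = w x * (P_part z x \<bullet> advect u (Q_part z) x +
     \<sigma>_part z x \<bullet> log_velocity u \<zeta> (\<theta>_part z) x)"

text \<open>In the last component, the transposed inverse of \<theta> undoes the factor \<theta> of
  a tangent vector \<xi> \<theta>, and the transposes of \<eta> are adjoint multiplications. Paired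
  with \<xi> \<theta> it thus gives w times the pairing of \<sigma> with the commutator of \<xi> and
  \<eta>, minus w times that of the advected \<sigma> with \<xi>.\<close>

definition momentum_derivative ::
  "(real^3 \<Rightarrow> real) \<Rightarrow> (real^3 \<Rightarrow> real^3) \<Rightarrow> (real^3 \<Rightarrow> real^'n^'n) \<Rightarrow> ('k::finite, 'n::finite) fields \<Rightarrow> ('k, 'n) fields" where
  "momentum_derivative w u \<zeta> z x =
     (- (w x *\<^sub>R advect u (P_part z) x), w x *\<^sub>R advect u (Q_part z) x, w x *\<^sub>R log_velocity u \<zeta> (\<theta>_part z) x,
      w x *\<^sub>R ((\<sigma>_part z x ** transpose (log_velocity u \<zeta> (\<theta>_part z) x)
        - transpose (log_velocity u \<zeta> (\<theta>_part z) x) ** \<sigma>_part z x - advect u (\<sigma>_part z) x)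
        ** transpose (matrix_inv (\<theta>_part z x))))"

section \<open>The momentum functional of a fixed automorphism\<close>

context
  fixes \<O> :: "(real^'n^'n) set" and w :: "real^3 \<Rightarrow> real"
    and u :: "real^3 \<Rightarrow> real^3" and \<zeta> :: "real^3 \<Rightarrow> real^'n^'n"
  assumes \<O>: "matrix_lie_group \<O>" and w: "smooth w"
    and u: "u \<in> X_vol w" "compactly_supported u" and \<zeta>: "\<zeta> \<in> gauge_algebra \<O>" "compactly_supported \<zeta>"
begin

lemma smooth_u: "smooth u"
  using u by (simp add: X_vol_def)

lemma smooth_\<zeta>: "smooth \<zeta>"
  using \<zeta> by (simp add: gauge_algebra_def)

lemma \<zeta>_in: "\<zeta> x \<in> lie_algebra \<O>"
  using \<zeta> by (simp add: gauge_algebra_def)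

lemma invertible_\<theta>: "z \<in> config_space \<O> \<Longrightarrow> invertible (\<theta>_part z x)"
  using config_spaceD(4) matrix_lie_groupD(2)[OF \<O>] by blast

text \<open>\<eta> is the logarithmic derivative of \<theta> along \<open>u\<close> plus the adjoint
  image of \<zeta>. Membership is required of the \<sigma>-component of a functional
  derivative.\<close>

lemma log_velocity_in:
  assumes z: "z \<in> config_space \<O>"
  shows "log_velocity u \<zeta> (\<theta>_part z) x \<in> lie_algebra \<O>"
proof -
  note z' = config_spaceD[OF z]
  have "frechet_derivative (\<theta>_part z) (at x) (u x) ** matrix_inv (\<theta>_part z x) + Ad (\<theta>_part z x) (\<zeta> x) \<in> lie_algebra \<O>"
    by (intro subspace_add[OF subspace_lie_algebra[OF \<O>]] logarithmic_derivative_in_lie_algebra[OF \<O>]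
        Ad_in_lie_algebra[OF \<O>] z' \<zeta>_in)
  then show ?thesis
    by (simp add: log_velocity_def Ad_def matrix_mult_add advect_eq_frechet_derivative smooth_differentiable z'(3))
qed

text \<open>One compact set serves all \<theta> at once, so it can be kept while \<theta> moves
  along a variation.\<close>

lemma momentum_support:
  obtains K where "compact K" "\<And>\<theta> x. x \<notin> K \<Longrightarrow> log_velocity u \<zeta> \<theta> x = 0" "\<And>x. x \<notin> K \<Longrightarrow> u x = 0" "\<And>x. x \<notin> K \<Longrightarrow> \<zeta> x = 0"
proof -
  from u(2) obtain K1 where K1: "compact K1" "\<And>x. x \<notin> K1 \<Longrightarrow> u x = 0"
    unfolding compactly_supported_def by blast
  from \<zeta>(2) obtain K2 where K2: "compact K2" "\<And>x. x \<notin> K2 \<Longrightarrow> \<zeta> x = 0"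
    unfolding compactly_supported_def by blast
  show ?thesis
    by (rule that[of "K1 \<union> K2"])
      (use K1 K2 in \<open>auto simp: log_velocity_def advect_eq_0 bounded_bilinear.zero_left[OF bounded_bilinear_matrix_mult]
        bounded_bilinear.zero_right[OF bounded_bilinear_matrix_mult]\<close>)
qed

lemma smooth_momentum_potential:
  fixes z :: "('k::finite, 'n::finite) fields"
  assumes z: "z \<in> config_space \<O>"
  shows "smooth (\<lambda>x. (\<chi> i. \<Sum>a\<in>UNIV. P_part z x $ a * partial i (\<lambda>y. Q_part z y $ a) x)
    + (\<chi> i. tr_pair (\<sigma>_part z x) (partial i (\<theta>_part z) x ** matrix_inv (\<theta>_part z x))))"
  unfolding tr_pair_eq_inner
  by (intro smooth_intros config_spaceD[OF z] invertible_\<theta>[OF z])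

lemma J_R_in_dual:
  fixes z :: "('k::finite, 'n::finite) fields"
  assumes z: "z \<in> config_space \<O>"
  shows "J_R \<O> z \<in> X_vol_dual \<times> gauge_dual \<O>"
  unfolding J_R_def X_vol_dual_def gauge_dual_def
  using smooth_momentum_potential[OF z] smooth_coAd[OF \<O> config_spaceD(3,4,7)[OF z]] coAd_in_lie_algebra[OF \<O>]
  by blast

text \<open>Contracting the potential with \<open>u\<close> assembles the partial derivatives into
  advections, and the gauge part contributes \<theta> \<zeta> times the inverse of \<theta>; the two
  \<sigma>-terms add up to the pairing with \<eta>.\<close>

lemma aut_pair_J_R:
  fixes z :: "('k::finite, 'n::finite) fields"
  assumes z: "z \<in> config_space \<O>"
  shows "aut_pair w (J_R \<O> z) (u, \<zeta>) = (LBINT x. momentum_density w u \<zeta> z x)"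
proof -
  note z' = config_spaceD[OF z]
  define v where "v x = (\<chi> i. \<Sum>a\<in>UNIV. P_part z x $ a * partial i (\<lambda>y. Q_part z y $ a) x)
    + (\<chi> i. tr_pair (\<sigma>_part z x) (partial i (\<theta>_part z) x ** matrix_inv (\<theta>_part z x)))" for x
  have v: "smooth v"
    unfolding v_def[abs_def] by (rule smooth_momentum_potential[OF z])
  have vi: "v x $ i = P_part z x \<bullet> partial i (Q_part z) x + \<sigma>_part z x \<bullet> (partial i (\<theta>_part z) x ** matrix_inv (\<theta>_part z x))" for x i
  proof -
    have "partial i (\<lambda>y. Q_part z y $ a) x = partial i (Q_part z) x $ a" for a
      unfolding partial_def
      by (rule frechet_derivative_bounded_linear[OF bounded_linear_vec_nth smooth_differentiable[OF z'(5)]])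
    then show ?thesis
      by (simp add: v_def tr_pair_eq_inner inner_vec_def[of "P_part z x"])
  qed
  have vu: "v x \<bullet> u x = P_part z x \<bullet> advect u (Q_part z) x + \<sigma>_part z x \<bullet> (advect u (\<theta>_part z) x ** matrix_inv (\<theta>_part z x))" for x
  proof -
    have "advect u (\<theta>_part z) x ** matrix_inv (\<theta>_part z x) = (\<Sum>i\<in>UNIV. u x $ i *\<^sub>R (partial i (\<theta>_part z) x ** matrix_inv (\<theta>_part z x)))"
      unfolding advect_def bounded_bilinear.sum_left[OF bounded_bilinear_matrix_mult] scalar_matrix_assoc ..
    then show ?thesis
      unfolding advect_def inner_vec_def[of "v x"]
      by (simp add: vi inner_sum_right sum.distrib[symmetric] algebra_simps)
  qed
  obtain K where K: "compact K" "\<And>x. x \<notin> K \<Longrightarrow> u x = 0" "\<And>x. x \<notin> K \<Longrightarrow> \<zeta> x = 0"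
    using momentum_support by metis
  have "vorticity_pair w (curl v) u = (LBINT x. (v x \<bullet> u x) * w x)"
    by (rule vorticity_pair_curl[OF w u v])
  moreover have "gauge_pair w (\<lambda>x. coAd \<O> (\<theta>_part z x) (\<sigma>_part z x)) \<zeta> =
      (LBINT x. (\<sigma>_part z x \<bullet> Ad (\<theta>_part z x) (\<zeta> x)) * w x)"
    unfolding gauge_pair_def tr_pair_eq_inner by (simp add: coAd_inner[OF \<O> \<zeta>_in])
  moreover have "integrable lborel (\<lambda>x. (v x \<bullet> u x) * w x)"
    using K by (auto intro!: integrable_compactly_supported smooth_continuous smooth_intros compactly_supportedI[of K] v smooth_u w)
  moreover have "integrable lborel (\<lambda>x. (\<sigma>_part z x \<bullet> Ad (\<theta>_part z x) (\<zeta> x)) * w x)"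
  proof (rule integrable_compactly_supported)
    show "continuous_on UNIV (\<lambda>x. (\<sigma>_part z x \<bullet> Ad (\<theta>_part z x) (\<zeta> x)) * w x)"
      unfolding Ad_def by (intro smooth_continuous smooth_intros z' invertible_\<theta>[OF z] smooth_\<zeta> w)
    show "compactly_supported (\<lambda>x. (\<sigma>_part z x \<bullet> Ad (\<theta>_part z x) (\<zeta> x)) * w x)"
      using K by (intro compactly_supportedI[of K]) (auto simp: linear_0[OF linear_Ad])
  qed
  moreover have "(v x \<bullet> u x) * w x + (\<sigma>_part z x \<bullet> Ad (\<theta>_part z x) (\<zeta> x)) * w x = momentum_density w u \<zeta> z x" for x
    by (simp add: momentum_density_def log_velocity_def vu Ad_def matrix_mult_add inner_add_right algebra_simps)
  ultimately show ?thesis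
    unfolding J_R_def v_def[abs_def, symmetric] by (simp add: aut_pair_def flip: Bochner_Integration.integral_add)
qed

lemma momentum_derivative_smooth:
  fixes z :: "('k::finite, 'n::finite) fields"
  assumes z: "z \<in> config_space \<O>"
  shows "smooth (log_velocity u \<zeta> (\<theta>_part z))" "smooth (momentum_derivative w u \<zeta> z)"
proof -
  show "smooth (log_velocity u \<zeta> (\<theta>_part z))"
    unfolding log_velocity_def[abs_def]
    by (intro smooth_intros config_spaceD[OF z] invertible_\<theta>[OF z] smooth_u smooth_\<zeta>)
  then show "smooth (momentum_derivative w u \<zeta> z)"
    unfolding momentum_derivative_def[abs_def]
    by (intro smooth_intros config_spaceD[OF z] invertible_\<theta>[OF z] smooth_u smooth_\<zeta> w)
qed

text \<open>With \<open>\<alpha> = \<delta>\<theta> \<theta>\<^sup>-\<^sup>1\<close> and \<open>\<eta>\<close> the logarithmic velocity, \<open>\<delta>\<eta> = (u \<cdot> \<nabla>) \<alpha> + [\<alpha>, \<eta>]\<close>.\<close>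
lemma integral_momentum_variation:
  fixes z :: "('k::finite, 'n::finite) fields"
    and dQ dP :: "real^3 \<Rightarrow> real^'k" and d\<sigma> d\<theta> :: "real^3 \<Rightarrow> real^'n^'n"
  assumes z: "z \<in> config_space \<O>" and d: "smooth dQ" "smooth dP" "smooth d\<sigma>" "smooth d\<theta>"
  defines "\<eta> \<equiv> log_velocity u \<zeta> (\<theta>_part z)" and "\<theta>i \<equiv> \<lambda>x. matrix_inv (\<theta>_part z x)"
  shows "(LBINT x. w x * ((P_part z x \<bullet> advect u dQ x + dP x \<bullet> advect u (Q_part z) x) +
      (\<sigma>_part z x \<bullet> ((advect u (\<theta>_part z) x + \<theta>_part z x ** \<zeta> x) ** - (\<theta>i x ** d\<theta> x ** \<theta>i x)
         + (advect u d\<theta> x + d\<theta> x ** \<zeta> x) ** \<theta>i x) + d\<sigma> x \<bullet> \<eta> x))) =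
    (LBINT x. momentum_derivative w u \<zeta> z x \<bullet> (dQ x, dP x, d\<sigma> x, d\<theta> x))" (is "(LBINT x. ?l x) = (LBINT x. ?r x)")
proof -
  note z' = config_spaceD[OF z] and inv = invertible_\<theta>[OF z]
  obtain K where K: "compact K" "\<And>x. x \<notin> K \<Longrightarrow> \<eta> x = 0" "\<And>x. x \<notin> K \<Longrightarrow> u x = 0" "\<And>x. x \<notin> K \<Longrightarrow> \<zeta> x = 0"
    unfolding \<eta>_def using momentum_support by metis
  have s\<eta>: "smooth \<eta>"
    unfolding \<eta>_def by (rule momentum_derivative_smooth[OF z])
  have s\<theta>i: "smooth \<theta>i"
    unfolding \<theta>i_def by (intro smooth_intros z' inv)
  define \<alpha> where "\<alpha> x = d\<theta> x ** \<theta>i x" for x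
  have s\<alpha>: "smooth \<alpha>"
    unfolding \<alpha>_def[abs_def] by (intro smooth_intros d s\<theta>i)
  have adv\<theta>i: "frechet_derivative \<theta>i (at x) (u x) = - (\<theta>i x ** advect u (\<theta>_part z) x ** \<theta>i x)" for x
    using fun_cong[OF frechet_derivative_at[OF has_derivative_matrix_inv[OF inv z'(3), of x]], of "u x", symmetric]
    by (simp add: \<theta>i_def advect_eq_frechet_derivative smooth_differentiable z'(3))
  have adv\<alpha>: "advect u \<alpha> x = advect u d\<theta> x ** \<theta>i x - \<alpha> x ** advect u (\<theta>_part z) x ** \<theta>i x" for x
    unfolding advect_eq_frechet_derivative[OF smooth_differentiable[OF s\<alpha>]]
    unfolding \<alpha>_def[abs_def] frechet_derivative_bounded_bilinear[OF bounded_bilinear_matrix_mult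
        smooth_differentiable[OF d(4)] smooth_differentiable[OF s\<theta>i]] adv\<theta>i
    by (simp add: advect_eq_frechet_derivative smooth_differentiable d matrix_mult_minus matrix_mul_assoc)
  have \<eta>x: "(advect u (\<theta>_part z) x + \<theta>_part z x ** \<zeta> x) ** \<theta>i x = \<eta> x" for x
    by (simp add: \<eta>_def \<theta>i_def log_velocity_def)
  \<comment> \<open>Advecting the inverse inside \<alpha> leaves a term with the advected \<theta>;
    the same term in \<alpha> \<eta> cancels it and completes the commutator.\<close>
  have var: "(advect u (\<theta>_part z) x + \<theta>_part z x ** \<zeta> x) ** - (\<theta>i x ** d\<theta> x ** \<theta>i x) + (advect u d\<theta> x + d\<theta> x ** \<zeta> x) ** \<theta>i x
      = advect u \<alpha> x + \<alpha> x ** \<eta> x - \<eta> x ** \<alpha> x" for x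
  proof -
    have "\<alpha> x ** \<eta> x = \<alpha> x ** advect u (\<theta>_part z) x ** \<theta>i x + d\<theta> x ** (\<theta>i x ** \<theta>_part z x) ** \<zeta> x ** \<theta>i x"
      unfolding \<eta>x[symmetric] by (simp add: \<alpha>_def matrix_mult_add matrix_mul_assoc)
    also have "\<theta>i x ** \<theta>_part z x = mat 1"
      by (simp add: \<theta>i_def matrix_inv_left inv)
    finally have "\<alpha> x ** \<eta> x = \<alpha> x ** advect u (\<theta>_part z) x ** \<theta>i x + d\<theta> x ** \<zeta> x ** \<theta>i x"
      by simp
    moreover have "(advect u (\<theta>_part z) x + \<theta>_part z x ** \<zeta> x) ** - (\<theta>i x ** d\<theta> x ** \<theta>i x) = - (\<eta> x ** \<alpha> x)"
      unfolding \<eta>x[symmetric] by (simp add: \<alpha>_def matrix_mult_minus matrix_mul_assoc)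
    ultimately show ?thesis
      by (simp add: adv\<alpha> matrix_mult_add)
  qed
  let ?a = "\<lambda>x. w x * (P_part z x \<bullet> advect u dQ x)" and ?a' = "\<lambda>x. w x * (advect u (P_part z) x \<bullet> dQ x)"
  let ?b = "\<lambda>x. w x * (\<sigma>_part z x \<bullet> advect u \<alpha> x)" and ?b' = "\<lambda>x. w x * (advect u (\<sigma>_part z) x \<bullet> \<alpha> x)"
  \<comment> \<open>The two integrands differ by the sums \<open>?a + ?a'\<close> and
    \<open>?b + ?b'\<close>, each the weighted advection of a scalar product, which integrate to
    zero.\<close>
  have pt: "?l x = ?r x + (?a x + ?a' x) + (?b x + ?b' x)" for x
  proof -
    let ?M = "\<sigma>_part z x ** transpose (\<eta> x) - transpose (\<eta> x) ** \<sigma>_part z x - advect u (\<sigma>_part z) x"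
    have "(?M ** transpose (\<theta>i x)) \<bullet> d\<theta> x = ?M \<bullet> \<alpha> x"
      by (simp add: inner_matrix_mult_transpose \<alpha>_def)
    also have "\<dots> = \<sigma>_part z x \<bullet> (\<alpha> x ** \<eta> x) - \<sigma>_part z x \<bullet> (\<eta> x ** \<alpha> x) - advect u (\<sigma>_part z) x \<bullet> \<alpha> x"
      by (simp add: inner_diff_left inner_matrix_mult_transpose)
    finally have M: "(?M ** transpose (\<theta>i x)) \<bullet> d\<theta> x = \<dots>" .
    have r: "?r x = w x * (- (advect u (P_part z) x \<bullet> dQ x) + advect u (Q_part z) x \<bullet> dP x + \<eta> x \<bullet> d\<sigma> x + (?M ** transpose (\<theta>i x)) \<bullet> d\<theta> x)"
      unfolding momentum_derivative_def \<eta>_def[symmetric] \<theta>i_def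
      by (simp add: inner_prod_def algebra_simps)
    show ?thesis
      unfolding r M var
      by (simp add: inner_add_right inner_diff_right inner_commute[of "dP x"] inner_commute[of "d\<sigma> x"] algebra_simps)
  qed
  have int: "integrable lborel ?r" "integrable lborel ?a" "integrable lborel ?a'" "integrable lborel ?b" "integrable lborel ?b'"
  proof -
    have "continuous_on UNIV ?a" "continuous_on UNIV ?a'" "continuous_on UNIV ?b" "continuous_on UNIV ?b'"
      by (intro smooth_continuous smooth_intros w z' smooth_u d s\<alpha>)+
    moreover have "compactly_supported ?a" "compactly_supported ?a'" "compactly_supported ?b" "compactly_supported ?b'"
      by (rule compactly_supportedI[OF K(1)], simp add: K advect_eq_0)+
    ultimately show "integrable lborel ?a" "integrable lborel ?a'" "integrable lborel ?b" "integrable lborel ?b'"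
      by (blast intro: integrable_compactly_supported)+
    show "integrable lborel ?r"
    proof (rule integrable_compactly_supported)
      show "continuous_on UNIV ?r"
        by (intro smooth_continuous smooth_intros momentum_derivative_smooth[OF z] d)
      have "momentum_derivative w u \<zeta> z x = 0" if "x \<notin> K" for x
        using K(2,3)[OF that] unfolding momentum_derivative_def \<eta>_def[symmetric]
        by (simp add: advect_eq_0 zero_prod_def bounded_bilinear.zero_left[OF bounded_bilinear_matrix_mult]
            bounded_bilinear.zero_right[OF bounded_bilinear_matrix_mult] transpose_def flip: zero_vec_def)
      then show "compactly_supported ?r"
        by (intro compactly_supportedI[OF K(1)]) simp
    qed
  qed
  have "(LBINT x. ?l x) = (LBINT x. ?r x) + ((LBINT x. ?a x) + (LBINT x. ?a' x)) + ((LBINT x. ?b x) + (LBINT x. ?b' x))"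
    unfolding pt using int by simp
  also have "\<dots> = (LBINT x. ?r x)"
    using integral_advect_by_parts[OF w u z'(6) d(1)] integral_advect_by_parts[OF w u z'(7) s\<alpha>] by simp
  finally show ?thesis .
qed

text \<open>The fields along a variation are slices of smooth maps on the product of time and space.
  The momentum density is therefore jointly smooth with a support fixed in time, and the derivative
  may be taken under the integral.\<close>

lemma momentum_has_functional_derivative:
  fixes z :: "('k::finite, 'n::finite) fields"
  assumes z: "z \<in> config_space \<O>"
  shows "has_functional_derivative \<O> (\<lambda>z'. aut_pair w (J_R \<O> z') (u, \<zeta>)) z (momentum_derivative w u \<zeta> z)"
  unfolding has_functional_derivative_def
proof (intro conjI allI impI)
  show "locally_integrable (momentum_derivative w u \<zeta> z)"
    unfolding locally_integrable_def set_integrable_def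
    by (intro allI impI borel_integrable_compact smooth_continuous_on momentum_derivative_smooth z)
  show "\<sigma>_part (momentum_derivative w u \<zeta> z) x \<in> lie_algebra \<O>" for x
    by (simp add: momentum_derivative_def \<sigma>_part_def[of "momentum_derivative w u \<zeta> z"] subspace_scale subspace_lie_algebra \<O> log_velocity_in z)
  fix c assume c: "variation \<O> z c"
  have cz: "c t \<in> config_space \<O>" "c 0 = z" for t
    using c by (auto simp: variation_def)
  have sc: "smooth (\<lambda>p. c (fst p) (snd p))"
    using c by (simp add: variation_def case_prod_unfold)
  define CQ CP C\<sigma> C\<theta> where C: "CQ = (\<lambda>p. fst (c (fst p) (snd p)))" "CP = (\<lambda>p. fst (snd (c (fst p) (snd p))))"
    "C\<sigma> = (\<lambda>p. fst (snd (snd (c (fst p) (snd p)))))" "C\<theta> = (\<lambda>p. snd (snd (snd (c (fst p) (snd p)))))"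
  have sC: "smooth CQ" "smooth CP" "smooth C\<sigma>" "smooth C\<theta>"
    unfolding C by (intro smooth_intros sc)+
  have part: "Q_part (c t) = (\<lambda>x. CQ (t, x))" "P_part (c t) = (\<lambda>x. CP (t, x))"
    "\<sigma>_part (c t) = (\<lambda>x. C\<sigma> (t, x))" "\<theta>_part (c t) = (\<lambda>x. C\<theta> (t, x))" for t
    by (simp_all add: fun_eq_iff C Q_part_def P_part_def \<sigma>_part_def \<theta>_part_def)
  have part0: "CQ (0, x) = Q_part z x" "CP (0, x) = P_part z x" "C\<sigma> (0, x) = \<sigma>_part z x" "C\<theta> (0, x) = \<theta>_part z x" for x
    unfolding cz(2)[symmetric] part by simp_all
  have inv: "invertible (C\<theta> p)" for p
    using invertible_\<theta>[OF cz(1)[of "fst p"], of "snd p"] by (simp add: part)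
  let ?d = "\<lambda>C x. frechet_derivative C (at (0, x)) (1, 0)"
  have sd: "smooth (?d CQ)" "smooth (?d CP)" "smooth (?d C\<sigma>)" "smooth (?d C\<theta>)"
    by (intro smooth_compose[OF smooth_frechet_derivative] sC smooth_intros)+
  have vel: "velocity c = (\<lambda>x. (?d CQ x, ?d CP x, ?d C\<sigma> x, ?d C\<theta> x))"
  proof (rule velocity_eqI)
    fix x
    have "c t x = (CQ (t, x), CP (t, x), C\<sigma> (t, x), C\<theta> (t, x))" for t
      by (simp add: C)
    then show "((\<lambda>t. c t x) has_vector_derivative (?d CQ x, ?d CP x, ?d C\<sigma> x, ?d C\<theta> x)) (at 0)"
      by (simp only:) (intro has_vector_derivative_Pair has_vector_derivative_slice sC)
  qed
  define \<Phi> where "\<Phi> p = momentum_density w u \<zeta> (c (fst p)) (snd p)" for p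
  have adv: "advect u (\<lambda>x. D (t, x)) x = frechet_derivative D (at (t, x)) (0, u x)" if "smooth D"
    for D :: "real \<times> (real^3) \<Rightarrow> 'd::euclidean_space" and t x
  proof -
    have "smooth (\<lambda>x. D (t, x))" by (intro smooth_compose[OF that] smooth_intros)
    then show ?thesis
      by (simp add: advect_eq_frechet_derivative smooth_differentiable frechet_derivative_slice[OF that])
  qed
  have "smooth \<Phi>"
    unfolding \<Phi>_def[abs_def] momentum_density_def log_velocity_def part adv[OF sC(1)] adv[OF sC(4)] prod.collapse
    by (intro smooth_intros smooth_compose[OF w] smooth_compose[OF smooth_u] smooth_compose[OF smooth_\<zeta>] sC inv)
  obtain K where K: "compact K" "\<And>\<theta> x. x \<notin> K \<Longrightarrow> log_velocity u \<zeta> \<theta> x = 0" "\<And>x. x \<notin> K \<Longrightarrow> u x = 0"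
    using momentum_support by metis
  \<comment> \<open>This is the product rule applied to the density, kept in the shape that
    \<open>integral_momentum_variation\<close> expects.\<close>
  let ?\<phi> = "\<lambda>x. w x * ((P_part z x \<bullet> advect u (?d CQ) x + ?d CP x \<bullet> advect u (Q_part z) x) +
      (\<sigma>_part z x \<bullet> ((advect u (\<theta>_part z) x + \<theta>_part z x ** \<zeta> x) ** - (matrix_inv (\<theta>_part z x) ** ?d C\<theta> x ** matrix_inv (\<theta>_part z x))
         + (advect u (?d C\<theta>) x + ?d C\<theta> x ** \<zeta> x) ** matrix_inv (\<theta>_part z x)) + ?d C\<sigma> x \<bullet> log_velocity u \<zeta> (\<theta>_part z) x))"
  have "((\<lambda>t. LBINT x. \<Phi> (t, x)) has_real_derivative (LBINT x. ?\<phi> x)) (at 0)"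
  proof (rule has_real_derivative_integral_smooth[OF \<open>smooth \<Phi>\<close> K(1)])
    show "\<Phi> (t, x) = 0" if "x \<notin> K" for t x
      using that by (simp add: \<Phi>_def momentum_density_def K advect_eq_0)
    show "((\<lambda>t. \<Phi> (t, x)) has_real_derivative ?\<phi> x) (at 0)" for x
    proof -
      have advt: "((\<lambda>t. advect u (Q_part (c t)) x) has_vector_derivative advect u (?d CQ) x) (at 0)"
        "((\<lambda>t. advect u (\<theta>_part (c t)) x) has_vector_derivative advect u (?d C\<theta>) x) (at 0)"
        unfolding part by (rule advect_slice_has_vector_derivative[OF sC(1)] advect_slice_has_vector_derivative[OF sC(4)])+
      have t: "((\<lambda>t. P_part (c t) x) has_vector_derivative ?d CP x) (at 0)"
        "((\<lambda>t. \<sigma>_part (c t) x) has_vector_derivative ?d C\<sigma> x) (at 0)"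
        "((\<lambda>t. \<theta>_part (c t) x) has_vector_derivative ?d C\<theta> x) (at 0)"
        unfolding part by (intro has_vector_derivative_slice sC)+
      have "smooth (\<lambda>t. \<theta>_part (c t) x)"
        unfolding part by (intro smooth_compose[OF sC(4)] smooth_intros)
      note ti = has_vector_derivative_matrix_inv[OF invertible_\<theta>[OF cz(1)] this t(3)]
      note inner = bounded_bilinear.has_vector_derivative[OF bounded_bilinear_inner]
      have "((\<lambda>t. \<Phi> (t, x)) has_vector_derivative
        w x * ((P_part (c 0) x \<bullet> advect u (?d CQ) x + ?d CP x \<bullet> advect u (Q_part (c 0)) x) +
        (\<sigma>_part (c 0) x \<bullet> ((advect u (\<theta>_part (c 0)) x + \<theta>_part (c 0) x ** \<zeta> x) **
           - (matrix_inv (\<theta>_part (c 0) x) ** ?d C\<theta> x ** matrix_inv (\<theta>_part (c 0) x))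
         + (advect u (?d C\<theta>) x + ?d C\<theta> x ** \<zeta> x) ** matrix_inv (\<theta>_part (c 0) x)) +
         ?d C\<sigma> x \<bullet> ((advect u (\<theta>_part (c 0)) x + \<theta>_part (c 0) x ** \<zeta> x) ** matrix_inv (\<theta>_part (c 0) x))))) (at 0)"
        unfolding \<Phi>_def momentum_density_def log_velocity_def fst_conv snd_conv
        by (intro has_vector_derivative_mult_right has_vector_derivative_add inner has_vector_derivative_matrix_mult
            has_vector_derivative_matrix_mult_const(2) advt t ti)
      then show ?thesis
        unfolding cz(2) by (simp add: has_real_derivative_iff_has_vector_derivative log_velocity_def)
    qed
  qed
  moreover have "(LBINT x. \<Phi> (t, x)) = aut_pair w (J_R \<O> (c t)) (u, \<zeta>)" for t
    by (simp add: \<Phi>_def aut_pair_J_R[OF cz(1)])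
  moreover have "(LBINT x. ?\<phi> x) = field_pair (momentum_derivative w u \<zeta> z) (velocity c)"
    unfolding field_pair_eq_inner vel by (rule integral_momentum_variation[OF z sd])
  ultimately show "((\<lambda>t. aut_pair w (J_R \<O> (c t)) (u, \<zeta>)) has_real_derivative
      field_pair (momentum_derivative w u \<zeta> z) (velocity c)) (at 0)"
    by simp
qed

end


section \<open>The bracket with the momentum map\<close>

lemma measurable_field_parts:
  assumes "D \<in> borel_measurable M"
  shows "Q_part D \<in> borel_measurable M" "P_part D \<in> borel_measurable M"
    "\<sigma>_part D \<in> borel_measurable M" "\<theta>_part D \<in> borel_measurable M"
  unfolding Q_part_def[abs_def] P_part_def[abs_def] \<sigma>_part_def[abs_def] \<theta>_part_def[abs_def]
  by (rule borel_measurable_continuous_on[OF _ assms]; intro continuous_intros)+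

lemma measurable_matrix_mult:
  fixes f :: "'a \<Rightarrow> real^'m^'n" and g :: "'a \<Rightarrow> real^'p^'m"
  assumes "f \<in> borel_measurable M" "g \<in> borel_measurable M"
  shows "(\<lambda>x. f x ** g x) \<in> borel_measurable M"
  by (rule borel_measurable_continuous_Pair[OF assms])
    (intro bounded_bilinear.continuous_on[OF bounded_bilinear_matrix_mult] continuous_intros)

text \<open>This resolves the \<open>THE\<close> of \<open>dF\<close>: membership in
  \<open>tangent_vectors\<close> provides a curve, and a functional derivative gives all curves with
  the same velocity the same value.\<close>

lemma dF_eq_field_pair:
  assumes D: "has_functional_derivative \<O> F z D" and \<delta>z: "\<delta>z \<in> tangent_vectors \<O> z"
  shows "dF \<O> F z \<delta>z = field_pair D \<delta>z"
  unfolding dF_def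
proof (rule the_equality)
  have der: "((\<lambda>t. F (c t)) has_real_derivative field_pair D (velocity c)) (at 0)" if "variation \<O> z c" for c
    using D that by (simp add: has_functional_derivative_def)
  obtain c where "variation \<O> z c" "velocity c = \<delta>z"
    using \<delta>z unfolding tangent_vectors_def by blast
  then show "\<exists>c. variation \<O> z c \<and> velocity c = \<delta>z \<and> ((\<lambda>t. F (c t)) has_real_derivative field_pair D \<delta>z) (at 0)"
    using der by blast
  show "d = field_pair D \<delta>z"
    if "\<exists>c. variation \<O> z c \<and> velocity c = \<delta>z \<and> ((\<lambda>t. F (c t)) has_real_derivative d) (at 0)" for d
    using that der DERIV_unique by blast
qed

lemma has_functional_derivative_functional_derivative:
  "functionally_differentiable \<O> F z \<Longrightarrow> has_functional_derivative \<O> F z (functional_derivative \<O> F z)"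
  unfolding functionally_differentiable_def functional_derivative_def by (rule someI_ex[of "has_functional_derivative \<O> F z"])

lemma poisson_bracket_momentum:
  fixes z :: "('k::finite, 'n::finite) fields" and \<O> :: "(real^'n^'n) set"
  assumes \<O>: "matrix_lie_group \<O>" and w: "volume_density w" and z: "z \<in> config_space \<O>"
    and u: "u \<in> X_vol w" "compactly_supported u" and \<zeta>: "\<zeta> \<in> gauge_algebra \<O>" "compactly_supported \<zeta>"
    and F: "functionally_differentiable \<O> F z"
  shows "poisson_bracket \<O> w F (\<lambda>z'. aut_pair w (J_R \<O> z') (u, \<zeta>)) z
    = field_pair (functional_derivative \<O> F z) (inf_action (u, \<zeta>) z)"
proof -
  let ?G = "\<lambda>z'. aut_pair w (J_R \<O> z') (u, \<zeta>)"
  let ?\<eta> = "log_velocity u \<zeta> (\<theta>_part z)" and ?M = "momentum_derivative w u \<zeta> z"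
  have sw: "smooth w" and nz: "\<And>x. w x \<noteq> 0"
    using w by (auto simp: volume_density_def)
  note ctxt = \<O> sw u \<zeta>
  note z' = config_spaceD[OF z]
  have su: "smooth u" and s\<zeta>: "smooth \<zeta>"
    using smooth_u[OF ctxt] smooth_\<zeta>[OF ctxt] .
  have inv: "invertible (\<theta>_part z x)" for x
    by (rule invertible_\<theta>[OF ctxt z])
  define DF DG where "DF = functional_derivative \<O> F z" and "DG = functional_derivative \<O> ?G z"
  have DF: "has_functional_derivative \<O> F z DF"
    unfolding DF_def by (rule has_functional_derivative_functional_derivative[OF F])
  have M: "has_functional_derivative \<O> ?G z ?M"
    by (rule momentum_has_functional_derivative[OF ctxt z])
  then have DG: "has_functional_derivative \<O> ?G z DG"
    unfolding DG_def
    by (intro has_functional_derivative_functional_derivative) (auto simp: functionally_differentiable_def)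
  have li: "locally_integrable DF" "locally_integrable DG" and \<sigma>F: "\<And>x. \<sigma>_part DF x \<in> lie_algebra \<O>"
    using DF DG by (auto simp: has_functional_derivative_def)
  note mF = measurable_field_parts[OF locally_integrable_measurable[OF li(1)]]
    and mG = measurable_field_parts[OF locally_integrable_measurable[OF li(2)]]
  have mw: "(\<lambda>x. 1 / w x) \<in> borel_measurable borel"
    by (intro borel_measurable_continuous_onI smooth_continuous smooth_intros sw nz)
  have mz: "\<sigma>_part z \<in> borel_measurable borel" "\<theta>_part z \<in> borel_measurable borel"
    by (intro borel_measurable_continuous_onI smooth_continuous z')+
  \<comment> \<open>\<open>V1\<close> and \<open>V2\<close> split the action so as to match the two
    integrals of the bracket. Both have compact support, so the pairings with \<open>DF\<close>
    converge separately and may be added.\<close>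
  define V1 V2 :: "('k, 'n) fields" where "V1 x = (advect u (Q_part z) x, advect u (P_part z) x, 0, 0)"
    and "V2 x = (0, 0, advect u (\<sigma>_part z) x, advect u (\<theta>_part z) x + \<theta>_part z x ** \<zeta> x)" for x
  have V: "inf_action (u, \<zeta>) z x = V1 x + V2 x" for x
    by (simp add: inf_action_def V1_def V2_def)
  obtain K where K: "compact K" "\<And>x. x \<notin> K \<Longrightarrow> u x = 0" "\<And>x. x \<notin> K \<Longrightarrow> \<zeta> x = 0"
    using momentum_support[OF ctxt] by metis
  have sV: "smooth V1" "smooth V2"
    unfolding V1_def[abs_def] V2_def[abs_def] by (intro smooth_intros z' su s\<zeta>)+
  have cV: "compactly_supported V1" "compactly_supported V2"
    using K by (auto intro!: compactly_supportedI[of K] simp: V1_def V2_def advect_eq_0 zero_prod_def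
        bounded_bilinear.zero_right[OF bounded_bilinear_matrix_mult])
  have int: "integrable lborel (\<lambda>x. DF x \<bullet> V1 x)" "integrable lborel (\<lambda>x. DF x \<bullet> V2 x)"
    by (intro integrable_inner_compactly_supported li smooth_continuous sV cV)+
  note AE = functional_derivative_unique[OF \<O> z DG M]
  have Mparts: "Q_part ?M x = - (w x *\<^sub>R advect u (P_part z) x)" "P_part ?M x = w x *\<^sub>R advect u (Q_part z) x"
    "\<sigma>_part ?M x = w x *\<^sub>R ?\<eta> x" for x
    by (simp_all add: momentum_derivative_def Q_part_def[of ?M] P_part_def[of ?M] \<sigma>_part_def[of ?M])
  have M\<theta>: "\<theta>_part ?M x \<bullet> (\<xi> ** \<theta>_part z x) =
      w x * (\<sigma>_part z x \<bullet> commutator \<xi> (?\<eta> x) - advect u (\<sigma>_part z) x \<bullet> \<xi>)" for x \<xi>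
  proof -
    have "\<xi> ** \<theta>_part z x ** matrix_inv (\<theta>_part z x) = \<xi>"
      by (simp add: matrix_mul_assoc[symmetric] matrix_inv_right inv)
    then show ?thesis
      by (simp add: momentum_derivative_def \<theta>_part_def[of ?M] inner_matrix_mult_transpose commutator_def
          inner_diff_left inner_diff_right)
  qed
  have \<eta>\<theta>: "?\<eta> x ** \<theta>_part z x = advect u (\<theta>_part z) x + \<theta>_part z x ** \<zeta> x" for x
    by (simp add: log_velocity_def matrix_mul_assoc[symmetric] matrix_inv_left inv)
  \<comment> \<open>\<open>DG\<close> is an arbitrary choice and agrees with the explicit derivative
    only almost everywhere; comparing the integrals also takes measurability of both
    integrands.\<close>
  have "(LBINT x. 1 / w x * (Q_part DF x \<bullet> P_part DG x - Q_part DG x \<bullet> P_part DF x)) = (LBINT x. DF x \<bullet> V1 x)"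
  proof (rule integral_cong_AE)
    show "(\<lambda>x. 1 / w x * (Q_part DF x \<bullet> P_part DG x - Q_part DG x \<bullet> P_part DF x)) \<in> borel_measurable lborel"
      unfolding measurable_lborel2
      by (intro borel_measurable_times borel_measurable_diff borel_measurable_inner mw mF mG)
    show "(\<lambda>x. DF x \<bullet> V1 x) \<in> borel_measurable lborel"
      using int(1) by (rule borel_measurable_integrable)
    show "AE x in lborel. 1 / w x * (Q_part DF x \<bullet> P_part DG x - Q_part DG x \<bullet> P_part DF x) = DF x \<bullet> V1 x"
      using AE
    proof eventually_elim
      case (elim x)
      then show ?case
        using nz[of x]
        by (simp add: Mparts V1_def inner_prod_def Q_part_def[of DF] P_part_def[of DF] inner_commute field_simps)
    qed
  qed
  moreover have "(LBINT x. 1 / w x * (tr_pair (\<sigma>_part z x) (commutator (\<sigma>_part DF x) (\<sigma>_part DG x))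
      + tr_pair (\<theta>_part DF x) (\<sigma>_part DG x ** \<theta>_part z x)
      - tr_pair (\<theta>_part DG x) (\<sigma>_part DF x ** \<theta>_part z x))) = (LBINT x. DF x \<bullet> V2 x)"
    unfolding tr_pair_eq_inner
  proof (rule integral_cong_AE)
    show "(\<lambda>x. 1 / w x * (\<sigma>_part z x \<bullet> commutator (\<sigma>_part DF x) (\<sigma>_part DG x)
        + \<theta>_part DF x \<bullet> (\<sigma>_part DG x ** \<theta>_part z x) - \<theta>_part DG x \<bullet> (\<sigma>_part DF x ** \<theta>_part z x))) \<in> borel_measurable lborel"
      unfolding commutator_def measurable_lborel2
      by (intro borel_measurable_times borel_measurable_add borel_measurable_diff borel_measurable_inner
          measurable_matrix_mult mw mF mG mz)
    show "(\<lambda>x. DF x \<bullet> V2 x) \<in> borel_measurable lborel"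
      using int(2) by (rule borel_measurable_integrable)
    show "AE x in lborel. 1 / w x * (\<sigma>_part z x \<bullet> commutator (\<sigma>_part DF x) (\<sigma>_part DG x)
        + \<theta>_part DF x \<bullet> (\<sigma>_part DG x ** \<theta>_part z x) - \<theta>_part DG x \<bullet> (\<sigma>_part DF x ** \<theta>_part z x)) = DF x \<bullet> V2 x"
      using AE
    proof eventually_elim
      case (elim x)
      have "commutator (\<sigma>_part DF x) (w x *\<^sub>R ?\<eta> x) = w x *\<^sub>R commutator (\<sigma>_part DF x) (?\<eta> x)"
        by (simp add: commutator_def scaleR_diff_right matrix_scalar_ac scalar_matrix_assoc)
      moreover have "(w x *\<^sub>R ?\<eta> x) ** \<theta>_part z x = w x *\<^sub>R (advect u (\<theta>_part z) x + \<theta>_part z x ** \<zeta> x)"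
        by (simp only: \<eta>\<theta> scalar_matrix_assoc[symmetric])
      \<comment> \<open>Here the \<sigma>-component of \<open>DF\<close> plays the role of \<xi>;
        its membership in the Lie algebra makes the uniqueness statement for the \<theta>-component
        applicable.\<close>
      moreover have "\<theta>_part DG x \<bullet> (\<sigma>_part DF x ** \<theta>_part z x) =
          w x * (\<sigma>_part z x \<bullet> commutator (\<sigma>_part DF x) (?\<eta> x) - advect u (\<sigma>_part z) x \<bullet> \<sigma>_part DF x)"
        using elim \<sigma>F[of x] M\<theta> by simp
      moreover have "\<sigma>_part DG x = w x *\<^sub>R ?\<eta> x"
        using elim by (simp add: Mparts)
      moreover have "DF x \<bullet> V2 x = \<sigma>_part DF x \<bullet> advect u (\<sigma>_part z) x
          + \<theta>_part DF x \<bullet> (advect u (\<theta>_part z) x + \<theta>_part z x ** \<zeta> x)"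
        by (simp add: V2_def inner_prod_def \<sigma>_part_def[of DF] \<theta>_part_def[of DF])
      ultimately show ?case
        using nz[of x] by (simp add: inner_commute inner_add_right field_simps)
    qed
  qed
  moreover have "(LBINT x. DF x \<bullet> V1 x) + (LBINT x. DF x \<bullet> V2 x) = field_pair DF (inf_action (u, \<zeta>) z)"
    unfolding field_pair_eq_inner V inner_add_right using int by simp
  ultimately show ?thesis
    unfolding poisson_bracket_def Let_def DF_def[symmetric] DG_def[symmetric] by simp
qed

theorem theorem5p1:
  fixes \<O> :: "(real^'n^'n) set" and w :: "real^3 \<Rightarrow> real"
    and z :: "('k::finite, 'n::finite) fields"
    and u :: "real^3 \<Rightarrow> real^3" and \<zeta> :: "real^3 \<Rightarrow> real^'n^'n"
  assumes "matrix_lie_group \<O>"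
    and "volume_density w"
    and "z \<in> config_space \<O>"
    and "(u, \<zeta>) \<in> aut_vol \<O> w"
    and "compactly_supported u" and "compactly_supported \<zeta>"
  shows "inf_action (u, \<zeta>) z \<in> tangent_vectors \<O> z \<and>
    J_R \<O> z \<in> X_vol_dual \<times> gauge_dual \<O> \<and>
    functionally_differentiable \<O> (\<lambda>z'. aut_pair w (J_R \<O> z') (u, \<zeta>)) z \<and>
    (\<forall>F. functionally_differentiable \<O> F z \<longrightarrow>
       poisson_bracket \<O> w F (\<lambda>z'. aut_pair w (J_R \<O> z') (u, \<zeta>)) z
         = dF \<O> F z (inf_action (u, \<zeta>) z))"
proof -
  have w: "smooth w" and u: "u \<in> X_vol w" and \<zeta>: "\<zeta> \<in> gauge_algebra \<O>"
    using assms(2,4) by (auto simp: volume_density_def aut_vol_def)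
  note ctxt = assms(1) w u assms(5) \<zeta> assms(6)
  obtain c where "variation \<O> z c" "velocity c = inf_action (u, \<zeta>) z"
    by (rule inf_action_variation[OF assms(1,3) smooth_u[OF ctxt] assms(5) \<zeta> assms(6)])
  then have tangent: "inf_action (u, \<zeta>) z \<in> tangent_vectors \<O> z"
    unfolding tangent_vectors_def by (auto intro: exI[of _ c])
  moreover have "functionally_differentiable \<O> (\<lambda>z'. aut_pair w (J_R \<O> z') (u, \<zeta>)) z"
    unfolding functionally_differentiable_def
    using momentum_has_functional_derivative[OF ctxt assms(3)] by blast
  moreover have "poisson_bracket \<O> w F (\<lambda>z'. aut_pair w (J_R \<O> z') (u, \<zeta>)) z = dF \<O> F z (inf_action (u, \<zeta>) z)"
    if F: "functionally_differentiable \<O> F z" for F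
    using poisson_bracket_momentum[OF assms(1,2,3) u assms(5) \<zeta> assms(6) F]
      dF_eq_field_pair[OF has_functional_derivative_functional_derivative[OF F] tangent] by simp
  ultimately show ?thesis
    using J_R_in_dual[OF ctxt assms(3)] by blast
qed

end
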